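(* Let $Y=Z_1Z_2$, where $Z_1,Z_2$ are two independent standard normal random variables, and let $-1<\gamma<-1/2$. As $(\gamma_1,\gamma_2)\to(-1/2,\gamma)$ with $(\gamma_1,\gamma_2)\in\boldsymbol{\Delta}$, $$d_W(Z_{\gamma_1,\gamma_2},Y)=O\big((-\gamma_1-1/2)^{1/2}\big).$$
   Context: Let $\boldsymbol{\Delta}=\{(\gamma_1,\gamma_2): -1<\gamma_1<-1/2,\ -1<\gamma_2<-1/2,\ \gamma_1+\gamma_2>-3/2\}$. Write $u_+^{\gamma}=u^\gamma$ if $u>0$ and $0$ otherwise. For $(\gamma_1,\gamma_2)\in\boldsymbol{\Delta}$, the standardized generalized Rosenblatt random variable is $Z_{\gamma_1,\gamma_2}=Z_{\gamma_1,\gamma_2}(1)$, where $$Z_{\gamma_1,\gamma_2}(t)=\frac{A}{2}\int_{\mathbb{R}^2}'\left[\int_0^t\big[(s-x_1)_+^{\gamma_1}(s-x_2)_+^{\gamma_2}+(s-x_1)_+^{\gamma_2}(s-x_2)_+^{\gamma_1}\big]ds\right]B(dx_1)B(dx_2),$$ $B(\cdot)$ is a Brownian random measure on $\mathbb{R}$ (Gaussian white noise with Lebesgue control measure) and $\int'$ denotes the double Wiener-Itô integral (diagonals $x_1=x_2$ excluded). The constant $A=A(\gamma_1,\gamma_2)>0$ is chosen so that $\mathrm{Var}[Z_{\gamma_1,\gamma_2}(1)]=1$; explicitly, with $\mathrm{B}(x,y)=\int_0^1u^{x-1}(1-u)^{y-1}du$ the beta function, $$A(\gamma_1,\gamma_2)=\big[(\gamma_1+\gamma_2+2)(2(\gamma_1+\gamma_2)+3)\big]^{1/2}\big[\mathrm{B}(\gamma_1+1,-\gamma_1-\gamma_2-1)\mathrm{B}(\gamma_2+1,-\gamma_1-\gamma_2-1)+\mathrm{B}(\gamma_1+1,-2\gamma_1-1)\mathrm{B}(\gamma_2+1,-2\gamma_2-1)\big]^{-1/2}.$$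 The Wasserstein distance is $d_W(X,Y)=\sup_{h\in\mathcal{L}}|\mathbb{E}h(X)-\mathbb{E}h(Y)|$, where $\mathcal{L}$ is the class of functions $h:\mathbb{R}\to\mathbb{R}$ with $|h(x)-h(y)|\le|x-y|$ for all $x,y$. *)

theory Defs
  imports "HOL-Probability.Probability" "HOL-Library.Landau_Symbols"
begin

definition finite_borel :: "real set set" where
  "finite_borel = {A \<in> sets borel. emeasure lborel A < \<infinity>}"

text \<open>
  Gaussian white noise on the real line with Lebesgue control measure. The value of \<open>B\<close> is
  meaningful only on \<^const>\<open>finite_borel\<close>. The case of a null set is stated separately because
  \<open>N(0, 0)\<close> has no density. Taking almost all \<open>A i\<close> to be empty in \<open>indep\<close> and \<open>additive\<close> gives
  the versions for finite families.
\<close>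

locale brownian_random_measure = prob_space M for M :: "'a measure" +
  fixes B :: "real set \<Rightarrow> 'a \<Rightarrow> real"
  assumes measurable_B: "A \<in> finite_borel \<Longrightarrow> random_variable borel (B A)"
    and normal: "A \<in> finite_borel \<Longrightarrow> measure lborel A > 0 \<Longrightarrow>
          distributed M lborel (B A) (normal_density 0 (sqrt (measure lborel A)))"
    and null: "A \<in> finite_borel \<Longrightarrow> measure lborel A = 0 \<Longrightarrow> AE \<omega> in M. B A \<omega> = 0"
    and indep: "\<And>A :: nat \<Rightarrow> real set. range A \<subseteq> finite_borel \<Longrightarrow> disjoint_family A \<Longrightarrow>
          indep_vars (\<lambda>_. borel) (\<lambda>i. B (A i)) UNIV"
    and additive: "\<And>A :: nat \<Rightarrow> real set. range A \<subseteq> finite_borel \<Longrightarrow> disjoint_family A \<Longrightarrow>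
          (\<Union>i. A i) \<in> finite_borel \<Longrightarrow>
          AE \<omega> in M. (\<lambda>i. B (A i) \<omega>) sums B (\<Union>i. A i) \<omega>"

text \<open>
  The double Wiener--Ito integral is first defined on the step functions
  \<open>\<Sum>i,j<n. a i j * 1_{A i \<times> A j}\<close> with pairwise disjoint \<open>A i\<close> and vanishing diagonal
  coefficients, and then extended to square-integrable functions by \<open>L\<^sup>2\<close> limits.
\<close>

definition offdiag_step :: "nat \<Rightarrow> (nat \<Rightarrow> real set) \<Rightarrow> (nat \<Rightarrow> nat \<Rightarrow> real) \<Rightarrow> bool" where
  "offdiag_step n A a \<longleftrightarrow>
     A ` {..<n} \<subseteq> finite_borel \<and> disjoint_family_on A {..<n} \<and> (\<forall>i<n. a i i = 0)"

definition step_fun ::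
    "nat \<Rightarrow> (nat \<Rightarrow> real set) \<Rightarrow> (nat \<Rightarrow> nat \<Rightarrow> real) \<Rightarrow> real \<times> real \<Rightarrow> real" where
  "step_fun n A a x = (\<Sum>i<n. \<Sum>j<n. a i j * indicator (A i \<times> A j) x)"

definition step_integral ::
    "(real set \<Rightarrow> 'a \<Rightarrow> real) \<Rightarrow> nat \<Rightarrow> (nat \<Rightarrow> real set) \<Rightarrow> (nat \<Rightarrow> nat \<Rightarrow> real) \<Rightarrow> 'a \<Rightarrow> real" where
  "step_integral B n A a \<omega> = (\<Sum>i<n. \<Sum>j<n. a i j * B (A i) \<omega> * B (A j) \<omega>)"

definition has_double_integral ::
    "'a measure \<Rightarrow> (real set \<Rightarrow> 'a \<Rightarrow> real) \<Rightarrow> (real \<times> real \<Rightarrow> real) \<Rightarrow> ('a \<Rightarrow> real) \<Rightarrow> bool" where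
  "has_double_integral M B f X \<longleftrightarrow>
     f \<in> borel_measurable lborel \<and> X \<in> borel_measurable M \<and>
     (\<exists>n A a. (\<forall>k. offdiag_step (n k) (A k) (a k)) \<and>
        (\<lambda>k. \<integral>\<^sup>+x. ennreal ((step_fun (n k) (A k) (a k) x - f x)\<^sup>2) \<partial>lborel) \<longlonglongrightarrow> 0 \<and>
        (\<lambda>k. \<integral>\<^sup>+\<omega>. ennreal ((step_integral B (n k) (A k) (a k) \<omega> - X \<omega>)\<^sup>2) \<partial>M) \<longlonglongrightarrow> 0)"

text \<open>The integral is determined only almost surely; a version of it is chosen.\<close>

definition double_integral ::
    "'a measure \<Rightarrow> (real set \<Rightarrow> 'a \<Rightarrow> real) \<Rightarrow> (real \<times> real \<Rightarrow> real) \<Rightarrow> 'a \<Rightarrow> real" where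
  "double_integral M B f = (SOME X. has_double_integral M B f X)"

definition Delta :: "(real \<times> real) set" where
  "Delta = {(g1, g2). - 1 < g1 \<and> g1 < - 1/2 \<and> - 1 < g2 \<and> g2 < - 1/2 \<and> g1 + g2 > - 3/2}"

definition pos_powr :: "real \<Rightarrow> real \<Rightarrow> real" where
  "pos_powr u g = (if u > 0 then u powr g else 0)"

definition rosenblatt_kernel :: "real \<Rightarrow> real \<Rightarrow> real \<Rightarrow> real \<times> real \<Rightarrow> real" where
  "rosenblatt_kernel g1 g2 t = (\<lambda>(x1, x2). LINT s:{0..t}|lborel.
     pos_powr (s - x1) g1 * pos_powr (s - x2) g2 + pos_powr (s - x1) g2 * pos_powr (s - x2) g1)"

definition rosenblatt_const :: "real \<Rightarrow> real \<Rightarrow> real" where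
  "rosenblatt_const g1 g2 =
     ((g1 + g2 + 2) * (2 * (g1 + g2) + 3)) powr (1/2) *
     (Beta (g1 + 1) (- g1 - g2 - 1) * Beta (g2 + 1) (- g1 - g2 - 1) +
      Beta (g1 + 1) (- 2 * g1 - 1) * Beta (g2 + 1) (- 2 * g2 - 1)) powr (- 1/2)"

definition rosenblatt ::
    "'a measure \<Rightarrow> (real set \<Rightarrow> 'a \<Rightarrow> real) \<Rightarrow> real \<Rightarrow> real \<Rightarrow> real \<Rightarrow> 'a \<Rightarrow> real" where
  "rosenblatt M B g1 g2 t \<omega> =
     rosenblatt_const g1 g2 / 2 * double_integral M B (rosenblatt_kernel g1 g2 t) \<omega>"

text \<open>
  The two random variables may live on different probability spaces. The supremum is taken in
  \<^typ>\<open>ennreal\<close>, so that it is \<open>\<infinity>\<close> when unbounded.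
\<close>

definition wasserstein ::
    "'a measure \<Rightarrow> ('a \<Rightarrow> real) \<Rightarrow> 'b measure \<Rightarrow> ('b \<Rightarrow> real) \<Rightarrow> ennreal" where
  "wasserstein M X N Y =
     (SUP h \<in> {h :: real \<Rightarrow> real. \<forall>x y. \<bar>h x - h y\<bar> \<le> \<bar>x - y\<bar>}.
        ennreal \<bar>(\<integral>\<omega>. h (X \<omega>) \<partial>M) - (\<integral>\<omega>. h (Y \<omega>) \<partial>N)\<bar>)"

end

theory Submission
  imports Defs "HOL-Real_Asymp.Real_Asymp"
begin

text \<open>
  Write \<open>\<epsilon> = - \<gamma>1 - 1/2\<close>. For \<open>\<epsilon> = 0\<close> the factor \<open>(s - x)\<^sub>+ powr \<gamma>1\<close> just fails to be square integrable
  at \<open>x = -\<infinity>\<close>, where it hardly depends on \<open>s \<in> {0..1}\<close>. Hence the kernel is, up to an error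
  bounded in \<open>L\<^sup>2\<close>, the symmetrised product of \<open>f(x) = (- x) powr \<gamma>1\<close> on \<open>x < -1\<close> (called \<open>tail\<close> below), of squared norm
  \<open>1 / (2 \<epsilon>)\<close>, and \<open>r(y) = \<integral>\<^sub>0\<^sup>1 (s - y)\<^sub>+ powr \<gamma>2 ds\<close> (called \<open>ramp\<close>). The normalising constant is of order
  \<open>\<epsilon> powr (1/2)\<close>, so the error contributes \<open>O(\<epsilon> powr (1/2))\<close>. The double integral of the product differs from
  the product of two Gaussian linear forms by a diagonal term, and these forms are almost orthogonal:
  both effects are controlled by the normalised inner product of \<open>f\<close> and \<open>r\<close>, again \<open>O(\<epsilon> powr (1/2))\<close>.
  Finally the product of the squared norms is \<open>1 + O(\<epsilon>)\<close>.
\<close>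

section \<open>Quadratic forms in orthogonal random variables\<close>

text \<open>Apart from one change of space, comparisons are couplings: for a 1-Lipschitz
  \<open>h\<close> a bound on E|X - Y| suffices, hence one on an L^2 distance, and fixed factors
  lost on the way do not affect the order. The space \<open>M\<close> is left for \<open>N\<close>
  where two uncorrelated Gaussian forms have the law of a scaled pair (Z1, Z2). The Gaussian forms
  are realised as finite sums over the joint level sets of simple functions approximating the two
  factors. The limit is taken in the final inequality, for a fixed variable \<open>X\<close>. As
  \<open>double_integral\<close> is a choice, its existence comes first. The obstacle is the
  excluded diagonal: a bounded square is cut by a grid so fine that its diagonal blocks have small
  total area. In the kernel estimate the obstacle is the factor
  \<open>Beta (g1 + 1) (- 2 * g1 - 1)\<close> in the covariance of the first power, which blows up
  at g1 = -1/2. It stems from x near -\<infinity>, the region covered by \<open>tail\<close>. On x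
  \<ge> -1 the blow-up is traded for a factor |s - t|^(-\<eta>), and \<eta> = 1 + \<gamma> leaves an
  exponent integrable at s = t.\<close>

lemma (in prob_space) indep_var_of_rest:
  fixes X :: "'i \<Rightarrow> 'a \<Rightarrow> real"
  assumes "indep_vars (\<lambda>_. borel) X (insert p I)" "p \<notin> I"
    and F: "F \<in> borel_measurable (PiM I (\<lambda>_. borel))"
    and G: "\<And>\<omega>. G \<omega> = F (\<lambda>i\<in>I. X i \<omega>)"
  shows "indep_var borel (X p) borel G"
proof -
  have "indep_var (PiM {p} (\<lambda>_. borel)) (\<lambda>\<omega>. restrict (\<lambda>i. X i \<omega>) {p})
      (PiM I (\<lambda>_. borel)) (\<lambda>\<omega>. restrict (\<lambda>i. X i \<omega>) I)"
    using assms(2) by (intro indep_var_restrict[OF assms(1)]) auto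
  from indep_var_compose[OF this _ F, of "\<lambda>x. x p" borel]
  have "indep_var borel ((\<lambda>x. x p) \<circ> (\<lambda>\<omega>. restrict (\<lambda>i. X i \<omega>) {p})) borel (F \<circ> (\<lambda>\<omega>. restrict (\<lambda>i. X i \<omega>) I))"
    by simp
  moreover have "(F \<circ> (\<lambda>\<omega>. restrict (\<lambda>i. X i \<omega>) I)) = G" using G by auto
  ultimately show ?thesis by (simp add: comp_def)
qed

lemma integrable_mult_squares:
  fixes f g :: "'a \<Rightarrow> real"
  assumes [measurable]: "f \<in> borel_measurable M" "g \<in> borel_measurable M"
    and "integrable M (\<lambda>x. (f x)\<^sup>2)" "integrable M (\<lambda>x. (g x)\<^sup>2)"
  shows "integrable M (\<lambda>x. f x * g x)"
proof (rule Bochner_Integration.integrable_bound)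
  show "integrable M (\<lambda>x. (f x)\<^sup>2 + (g x)\<^sup>2)" using assms by simp
  have "\<bar>a * b\<bar> \<le> a\<^sup>2 + b\<^sup>2" for a b :: real
  proof -
    have "0 \<le> (\<bar>a\<bar> - \<bar>b\<bar>)\<^sup>2" by simp
    hence "2 * \<bar>a * b\<bar> \<le> a\<^sup>2 + b\<^sup>2" by (simp add: power2_diff abs_mult)
    thus ?thesis by linarith
  qed
  thus "AE x in M. norm (f x * g x) \<le> norm ((f x)\<^sup>2 + (g x)\<^sup>2)" by auto
qed measurable

lemma integrable_add_square:
  fixes f g :: "'a \<Rightarrow> real"
  assumes [measurable]: "f \<in> borel_measurable M" "g \<in> borel_measurable M"
    and "integrable M (\<lambda>x. (f x)\<^sup>2)" "integrable M (\<lambda>x. (g x)\<^sup>2)"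
  shows "integrable M (\<lambda>x. (f x + g x)\<^sup>2)"
    and "(\<integral>x. (f x + g x)\<^sup>2 \<partial>M) = (\<integral>x. (f x)\<^sup>2 \<partial>M) + 2 * (\<integral>x. f x * g x \<partial>M) + (\<integral>x. (g x)\<^sup>2 \<partial>M)"
proof -
  note i = integrable_mult_squares[OF assms] assms(3,4)
  have *: "(\<lambda>x. (f x + g x)\<^sup>2) = (\<lambda>x. (f x)\<^sup>2 + 2 * (f x * g x) + (g x)\<^sup>2)"
    by (auto simp: power2_sum algebra_simps)
  show "integrable M (\<lambda>x. (f x + g x)\<^sup>2)" unfolding * using i by auto
  show "(\<integral>x. (f x + g x)\<^sup>2 \<partial>M) = (\<integral>x. (f x)\<^sup>2 \<partial>M) + 2 * (\<integral>x. f x * g x \<partial>M) + (\<integral>x. (g x)\<^sup>2 \<partial>M)"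
    unfolding * using i by simp
qed

text \<open>What the second moment computations use of the increments of \<open>B\<close> over
  disjoint cells. The index type is general because cells are later indexed by pairs.\<close>

locale orthogonal_family = prob_space M for M :: "'a measure" +
  fixes X :: "'i \<Rightarrow> 'a \<Rightarrow> real" and I :: "'i set"
  assumes fin: "finite I" and ind: "indep_vars (\<lambda>_. borel) X I"
    and sq: "\<And>i. i \<in> I \<Longrightarrow> integrable M (\<lambda>\<omega>. (X i \<omega>)\<^sup>2)"
    and mean0: "\<And>i. i \<in> I \<Longrightarrow> expectation (X i) = 0"
begin

lemma rv [measurable]: "i \<in> I \<Longrightarrow> X i \<in> borel_measurable M"
  using ind by (auto simp: indep_vars_def)

text \<open>Induction on the index set: the new variable is centred and independent of the old sum,
  so the cross term vanishes. Stated for every \<open>J \<subseteq> I\<close> because the quadratic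
  case applies it to the indices already inserted.\<close>

lemma linear_bound:
  fixes c :: "'i \<Rightarrow> real"
  assumes "J \<subseteq> I"
  shows "(\<lambda>\<omega>. \<Sum>i\<in>J. c i * X i \<omega>) \<in> borel_measurable M"
    and "integrable M (\<lambda>\<omega>. (\<Sum>i\<in>J. c i * X i \<omega>)\<^sup>2)"
    and "expectation (\<lambda>\<omega>. (\<Sum>i\<in>J. c i * X i \<omega>)\<^sup>2) = (\<Sum>i\<in>J. (c i)\<^sup>2 * expectation (\<lambda>\<omega>. (X i \<omega>)\<^sup>2))"
proof -
  have "finite J" using fin assms finite_subset by blast
  from this assms have "(\<lambda>\<omega>. \<Sum>i\<in>J. c i * X i \<omega>) \<in> borel_measurable M \<and> integrable M (\<lambda>\<omega>. (\<Sum>i\<in>J. c i * X i \<omega>)\<^sup>2) \<and>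
    expectation (\<lambda>\<omega>. (\<Sum>i\<in>J. c i * X i \<omega>)\<^sup>2) = (\<Sum>i\<in>J. (c i)\<^sup>2 * expectation (\<lambda>\<omega>. (X i \<omega>)\<^sup>2))"
  proof (induction J rule: finite_induct)
    case (insert p J)
    let ?L = "\<lambda>\<omega>. \<Sum>i\<in>J. c i * X i \<omega>"
    have p: "p \<in> I" "J \<subseteq> I" using insert by auto
    have IH: "?L \<in> borel_measurable M" "integrable M (\<lambda>\<omega>. (?L \<omega>)\<^sup>2)"
      "expectation (\<lambda>\<omega>. (?L \<omega>)\<^sup>2) = (\<Sum>i\<in>J. (c i)\<^sup>2 * expectation (\<lambda>\<omega>. (X i \<omega>)\<^sup>2))"
      using insert by auto
    note [measurable] = rv[OF p(1)] IH(1)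
    have indp: "indep_var borel (X p) borel ?L"
      by (rule indep_var_of_rest[OF indep_vars_subset[OF ind insert.prems] insert.hyps(2), of "\<lambda>x. \<Sum>i\<in>J. c i * x i"]) auto
    have "integrable M (X p)" by (rule square_integrable_imp_integrable[OF _ sq[OF p(1)]]) measurable
    moreover have "integrable M ?L" by (rule square_integrable_imp_integrable[OF _ IH(2)]) measurable
    ultimately have "expectation (\<lambda>\<omega>. X p \<omega> * ?L \<omega>) = 0"
      by (subst indep_var_lebesgue_integral[OF indp]) (auto simp: mean0[OF p(1)])
    hence z: "expectation (\<lambda>\<omega>. c p * X p \<omega> * ?L \<omega>) = 0" by (simp add: mult.assoc)
    have "integrable M (\<lambda>\<omega>. (c p * X p \<omega>)\<^sup>2)" using sq[OF p(1)] by (simp add: power_mult_distrib)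
    from integrable_add_square[OF _ IH(1) this IH(2)] z
    show ?case using insert.hyps IH by (simp add: power_mult_distrib)
  qed auto
  thus "(\<lambda>\<omega>. \<Sum>i\<in>J. c i * X i \<omega>) \<in> borel_measurable M"
    and "integrable M (\<lambda>\<omega>. (\<Sum>i\<in>J. c i * X i \<omega>)\<^sup>2)"
    and "expectation (\<lambda>\<omega>. (\<Sum>i\<in>J. c i * X i \<omega>)\<^sup>2) = (\<Sum>i\<in>J. (c i)\<^sup>2 * expectation (\<lambda>\<omega>. (X i \<omega>)\<^sup>2))"
    by auto
qed

text \<open>Adding an index \<open>p\<close> adds X_p times a linear form in the old variables. By
  independence the mixed term with the old quadratic form has mean 0 and the second moment of the
  new term factors. The 2 comes from
  \<open>(x + y)\<^sup>2 \<le> 2 * (x\<^sup>2 + y\<^sup>2)\<close>, as \<open>b\<close> need not be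
  symmetric.\<close>

lemma quadratic_bound:
  fixes b :: "'i \<Rightarrow> 'i \<Rightarrow> real"
  assumes "\<And>i. i \<in> I \<Longrightarrow> b i i = 0"
  shows "integrable M (\<lambda>\<omega>. (\<Sum>i\<in>I. \<Sum>j\<in>I. b i j * X i \<omega> * X j \<omega>)\<^sup>2)"
    and "expectation (\<lambda>\<omega>. (\<Sum>i\<in>I. \<Sum>j\<in>I. b i j * X i \<omega> * X j \<omega>)\<^sup>2)
      \<le> 2 * (\<Sum>i\<in>I. \<Sum>j\<in>I. (b i j)\<^sup>2 * (expectation (\<lambda>\<omega>. (X i \<omega>)\<^sup>2) * expectation (\<lambda>\<omega>. (X j \<omega>)\<^sup>2)))"
proof -
  define v where "v i = expectation (\<lambda>\<omega>. (X i \<omega>)\<^sup>2)" for i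
  have v0: "v i \<ge> 0" for i by (simp add: v_def)
  have "integrable M (\<lambda>\<omega>. (\<Sum>i\<in>J. \<Sum>j\<in>J. b i j * X i \<omega> * X j \<omega>)\<^sup>2) \<and>
    expectation (\<lambda>\<omega>. (\<Sum>i\<in>J. \<Sum>j\<in>J. b i j * X i \<omega> * X j \<omega>)\<^sup>2)
      \<le> 2 * (\<Sum>i\<in>J. \<Sum>j\<in>J. (b i j)\<^sup>2 * (v i * v j))" if "J \<subseteq> I" for J
    using finite_subset[OF that fin] that
  proof (induction J rule: finite_induct)
    case (insert p J)
    let ?S = "\<lambda>\<omega>. \<Sum>i\<in>J. \<Sum>j\<in>J. b i j * X i \<omega> * X j \<omega>"
    let ?L = "\<lambda>\<omega>. \<Sum>i\<in>J. (b p i + b i p) * X i \<omega>"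
    have p: "p \<in> I" "J \<subseteq> I" using insert by auto
    have [measurable]: "i \<in> J \<Longrightarrow> X i \<in> borel_measurable M" for i using p by auto
    have IH: "integrable M (\<lambda>\<omega>. (?S \<omega>)\<^sup>2)"
      "expectation (\<lambda>\<omega>. (?S \<omega>)\<^sup>2) \<le> 2 * (\<Sum>i\<in>J. \<Sum>j\<in>J. (b i j)\<^sup>2 * (v i * v j))"
      using insert by auto
    note L = linear_bound[OF p(2), of "\<lambda>i. b p i + b i p", folded v_def]
    have [measurable]: "X p \<in> borel_measurable M" "?S \<in> borel_measurable M" "?L \<in> borel_measurable M"
      using p by measurable
    have ivs: "indep_vars (\<lambda>_. borel) X (insert p J)" using indep_vars_subset[OF ind insert.prems] .
    have iL2: "indep_var borel (\<lambda>\<omega>. (X p \<omega>)\<^sup>2) borel (\<lambda>\<omega>. (?L \<omega>)\<^sup>2)"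
    proof -
      have "indep_var borel (X p) borel ?L"
        by (rule indep_var_of_rest[OF ivs insert.hyps(2), of "\<lambda>x. \<Sum>i\<in>J. (b p i + b i p) * x i"]) auto
      from indep_var_compose[OF this, of "\<lambda>x. x\<^sup>2" borel "\<lambda>x. x\<^sup>2" borel] show ?thesis by (simp add: comp_def)
    qed
    \<comment> \<open>X_p is independent of the product of both old forms, so E(X_p L S) = E(X_p)
      E(L S) = 0.\<close>
    have iLS: "indep_var borel (X p) borel (\<lambda>\<omega>. ?L \<omega> * ?S \<omega>)"
      by (rule indep_var_of_rest[OF ivs insert.hyps(2), of "\<lambda>x. (\<Sum>i\<in>J. (b p i + b i p) * x i) * (\<Sum>i\<in>J. \<Sum>j\<in>J. b i j * x i * x j)"]) auto
    have iX: "integrable M (X p)" by (rule square_integrable_imp_integrable[OF _ sq[OF p(1)]]) measurable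
    have "integrable M (\<lambda>\<omega>. ?L \<omega> * ?S \<omega>)" by (rule integrable_mult_squares[OF _ _ L(2) IH(1)]) measurable
    hence z: "expectation (\<lambda>\<omega>. X p \<omega> * (?L \<omega> * ?S \<omega>)) = 0"
      by (subst indep_var_lebesgue_integral[OF iLS iX]) (auto simp: mean0[OF p(1)])
    have XL: "integrable M (\<lambda>\<omega>. (X p \<omega> * ?L \<omega>)\<^sup>2)" "expectation (\<lambda>\<omega>. (X p \<omega> * ?L \<omega>)\<^sup>2) = v p * expectation (\<lambda>\<omega>. (?L \<omega>)\<^sup>2)"
      using indep_var_integrable[OF iL2 sq[OF p(1)] L(2)] indep_var_lebesgue_integral[OF iL2 sq[OF p(1)] L(2)]
      by (auto simp: power_mult_distrib v_def)
    \<comment> \<open>The vanishing diagonal enters here: the square of X_p does not occur.\<close>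
    have dec: "(\<Sum>i\<in>insert p J. \<Sum>j\<in>insert p J. b i j * X i \<omega> * X j \<omega>) = X p \<omega> * ?L \<omega> + ?S \<omega>" for \<omega>
      using insert.hyps assms[OF p(1)] by (simp add: sum.distrib sum_distrib_left algebra_simps)
    note A = integrable_add_square[OF _ _ XL(1) IH(1)]
    have "expectation (\<lambda>\<omega>. (X p \<omega> * ?L \<omega> + ?S \<omega>)\<^sup>2) = v p * expectation (\<lambda>\<omega>. (?L \<omega>)\<^sup>2) + expectation (\<lambda>\<omega>. (?S \<omega>)\<^sup>2)"
      using z by (subst A(2)) (simp_all add: XL mult.assoc)
    also have "\<dots> \<le> v p * (\<Sum>i\<in>J. 2 * ((b p i)\<^sup>2 + (b i p)\<^sup>2) * v i) + 2 * (\<Sum>i\<in>J. \<Sum>j\<in>J. (b i j)\<^sup>2 * (v i * v j))"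
    proof (intro add_mono mult_left_mono v0 IH(2))
      have "(b p i + b i p)\<^sup>2 \<le> 2 * ((b p i)\<^sup>2 + (b i p)\<^sup>2)" for i
        using sum_squares_ge_zero[of "b p i - b i p" 0] by (simp add: power2_eq_square algebra_simps)
      thus "expectation (\<lambda>\<omega>. (?L \<omega>)\<^sup>2) \<le> (\<Sum>i\<in>J. 2 * ((b p i)\<^sup>2 + (b i p)\<^sup>2) * v i)"
        unfolding L(3) by (intro sum_mono mult_right_mono v0)
    qed
    also have "\<dots> = 2 * (\<Sum>i\<in>insert p J. \<Sum>j\<in>insert p J. (b i j)\<^sup>2 * (v i * v j))"
      using insert.hyps assms[OF p(1)] by (simp add: sum.distrib sum_distrib_left algebra_simps)
    finally show ?case unfolding dec using A(1) by simp
  qed auto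
  from this[of I]
  show "integrable M (\<lambda>\<omega>. (\<Sum>i\<in>I. \<Sum>j\<in>I. b i j * X i \<omega> * X j \<omega>)\<^sup>2)"
    and "expectation (\<lambda>\<omega>. (\<Sum>i\<in>I. \<Sum>j\<in>I. b i j * X i \<omega> * X j \<omega>)\<^sup>2)
      \<le> 2 * (\<Sum>i\<in>I. \<Sum>j\<in>I. (b i j)\<^sup>2 * (expectation (\<lambda>\<omega>. (X i \<omega>)\<^sup>2) * expectation (\<lambda>\<omega>. (X j \<omega>)\<^sup>2)))"
    by (auto simp: v_def)
qed

end

section \<open>Step integrals and the second moment bound\<close>

lemma sum_atMost_drop_last:
  fixes f :: "nat \<Rightarrow> real"
  shows "f n = 0 \<Longrightarrow> sum f {..n} = sum f {..<n}"
  by (simp add: lessThan_Suc_atMost[symmetric])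

text \<open>Bookkeeping for a common refinement: cells are indexed by pairs, the last index of each
  coordinate stands for a leftover cell with coefficient 0, and summing over the second coordinate
  glues the cells back together. \<open>u\<close> and \<open>w\<close> are arbitrary so that the
  identity serves indicators and values of \<open>B\<close> alike.\<close>

lemma sum_times_blocks_fst:
  fixes u w :: "nat \<times> nat \<Rightarrow> real"
  shows "(\<Sum>p\<in>{..n}\<times>{..m}. \<Sum>q\<in>{..n}\<times>{..m}. (if fst p < n \<and> fst q < n then a (fst p) (fst q) else 0) * u p * w q)
    = (\<Sum>i<n. \<Sum>j<n. a i j * (\<Sum>k\<le>m. u (i,k)) * (\<Sum>k\<le>m. w (j,k)))"
proof -
  have "(\<Sum>p\<in>{..n}\<times>{..m}. \<Sum>q\<in>{..n}\<times>{..m}. (if fst p < n \<and> fst q < n then a (fst p) (fst q) else 0) * u p * w q)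
    = (\<Sum>i\<le>n. \<Sum>k\<le>m. \<Sum>j\<le>n. \<Sum>l\<le>m. (if i < n \<and> j < n then a i j else 0) * u (i,k) * w (j,l))"
    by (simp only: sum.cartesian_product' fst_conv snd_conv)
  also have "\<dots> = (\<Sum>i<n. \<Sum>k\<le>m. \<Sum>j<n. \<Sum>l\<le>m. a i j * u (i,k) * w (j,l))"
    by (subst sum_atMost_drop_last, simp, rule sum.cong[OF refl], rule sum.cong[OF refl],
      subst sum_atMost_drop_last, simp, intro sum.cong refl) auto
  also have "\<dots> = (\<Sum>i<n. \<Sum>j<n. a i j * (\<Sum>k\<le>m. u (i,k)) * (\<Sum>k\<le>m. w (j,k)))"
    by (rule sum.cong[OF refl], subst sum.swap, rule sum.cong[OF refl])
      (simp only: mult.assoc sum_product, simp only: sum_distrib_left)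
  finally show ?thesis .
qed

lemma sum_times_blocks_snd:
  fixes u w :: "nat \<times> nat \<Rightarrow> real"
  shows "(\<Sum>p\<in>{..n}\<times>{..m}. \<Sum>q\<in>{..n}\<times>{..m}. (if snd p < m \<and> snd q < m then c (snd p) (snd q) else 0) * u p * w q)
    = (\<Sum>i<m. \<Sum>j<m. c i j * (\<Sum>k\<le>n. u (k,i)) * (\<Sum>k\<le>n. w (k,j)))"
proof -
  have sw: "(\<Sum>p\<in>{..n}\<times>{..m}. f p) = (\<Sum>p\<in>{..m}\<times>{..n}. f (prod.swap p))" for f :: "nat \<times> nat \<Rightarrow> real"
    by (rule sum.reindex_bij_witness[of _ prod.swap prod.swap]) auto
  show ?thesis
    using sum_times_blocks_fst[where n=m and m=n and a=c and u="\<lambda>p. u (prod.swap p)" and w="\<lambda>p. w (prod.swap p)"]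
    unfolding sw by (simp cong: if_cong)
qed

lemma emeasure_lborel_Times:
  fixes A C :: "real set"
  assumes "A \<in> sets borel" "C \<in> sets borel"
  shows "emeasure lborel (A \<times> C) = emeasure lborel A * emeasure lborel C"
  unfolding lborel_prod[symmetric] using assms by (intro lborel.emeasure_pair_measure_Times) auto

lemma finite_borelD: "A \<in> finite_borel \<Longrightarrow> A \<in> sets borel" "A \<in> finite_borel \<Longrightarrow> emeasure lborel A = ennreal (measure lborel A)"
  by (auto simp: finite_borel_def emeasure_eq_ennreal_measure top.not_eq_extremum)

lemma finite_borel_subset: "A \<in> sets borel \<Longrightarrow> A \<subseteq> C \<Longrightarrow> C \<in> finite_borel \<Longrightarrow> A \<in> finite_borel"
  unfolding finite_borel_def using emeasure_mono[of A C lborel] by auto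

lemma finite_borel_UN: "finite I \<Longrightarrow> D ` I \<subseteq> finite_borel \<Longrightarrow> (\<Union>i\<in>I. D i) \<in> finite_borel"
proof (induction I rule: finite_induct)
  case (insert p I)
  have "emeasure lborel (D p \<union> (\<Union>i\<in>I. D i)) \<le> emeasure lborel (D p) + emeasure lborel (\<Union>i\<in>I. D i)"
    using insert by (intro emeasure_subadditive) (auto simp: finite_borel_def)
  also have "\<dots> < \<infinity>" using insert by (auto simp: finite_borel_def)
  finally show ?case using insert by (auto simp: finite_borel_def)
qed (simp add: finite_borel_def)

text \<open>Disjoint products make the step function's square again a step function.\<close>

lemma nn_integral_square_step:
  fixes D :: "'i \<Rightarrow> real set" and b :: "'i \<Rightarrow> 'i \<Rightarrow> real"
  assumes "finite I" "disjoint_family_on D I" "D ` I \<subseteq> finite_borel"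
  shows "(\<integral>\<^sup>+x. ennreal ((\<Sum>i\<in>I. \<Sum>j\<in>I. b i j * indicator (D i \<times> D j) x)\<^sup>2) \<partial>lborel)
    = ennreal (\<Sum>i\<in>I. \<Sum>j\<in>I. (b i j)\<^sup>2 * (measure lborel (D i) * measure lborel (D j)))"
proof -
  have sq: "(\<Sum>i\<in>I. \<Sum>j\<in>I. b i j * indicator (D i \<times> D j) x)\<^sup>2 = (\<Sum>i\<in>I. \<Sum>j\<in>I. (b i j)\<^sup>2 * indicator (D i \<times> D j) x)" for x
  proof (cases "\<exists>k\<in>I. \<exists>l\<in>I. x \<in> D k \<times> D l")
    case True
    then obtain k l where kl: "k \<in> I" "l \<in> I" "x \<in> D k \<times> D l" by auto
    have *: "indicator (D i \<times> D j) x = (if i = k then if j = l then 1 else 0 else (0::real))" if "i \<in> I" "j \<in> I" for i j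
      using assms(2) kl that unfolding disjoint_family_on_def by (auto simp: indicator_def)
    have "(\<Sum>i\<in>I. \<Sum>j\<in>I. f i j * indicator (D i \<times> D j) x) = f k l" for f :: "'i \<Rightarrow> 'i \<Rightarrow> real"
    proof -
      have "(\<Sum>i\<in>I. \<Sum>j\<in>I. f i j * indicator (D i \<times> D j) x) = (\<Sum>i\<in>I. \<Sum>j\<in>I. if i = k then if j = l then f i j else 0 else 0)"
        by (intro sum.cong refl) (auto simp: *)
      also have "\<dots> = (\<Sum>i\<in>I. if i = k then \<Sum>j\<in>I. if j = l then f i j else 0 else 0)"
        by (intro sum.cong refl) auto
      also have "\<dots> = f k l" using kl assms(1) by simp
      finally show ?thesis .
    qed
    thus ?thesis by simp
  next
    case False
    hence "indicator (D i \<times> D j) x = (0::real)" if "i \<in> I" "j \<in> I" for i j using that by (auto simp: indicator_def)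
    thus ?thesis by simp
  qed
  have [measurable]: "i \<in> I \<Longrightarrow> D i \<in> sets borel" for i using assms finite_borelD by auto
  have m: "D i \<times> D j \<in> sets lborel" if "i \<in> I" "j \<in> I" for i j
    using that by (simp add: borel_prod[symmetric])
  have "(\<integral>\<^sup>+x. ennreal ((\<Sum>i\<in>I. \<Sum>j\<in>I. b i j * indicator (D i \<times> D j) x)\<^sup>2) \<partial>lborel)
      = (\<integral>\<^sup>+x. (\<Sum>i\<in>I. \<Sum>j\<in>I. ennreal ((b i j)\<^sup>2) * indicator (D i \<times> D j) x) \<partial>lborel)"
  proof (intro nn_integral_cong)
    fix x
    have "ennreal ((b i j)\<^sup>2) * indicator (D i \<times> D j) x = ennreal ((b i j)\<^sup>2 * indicator (D i \<times> D j) x)" for i j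
      by (simp add: indicator_def)
    thus "ennreal ((\<Sum>i\<in>I. \<Sum>j\<in>I. b i j * indicator (D i \<times> D j) x)\<^sup>2) = (\<Sum>i\<in>I. \<Sum>j\<in>I. ennreal ((b i j)\<^sup>2) * indicator (D i \<times> D j) x)"
      unfolding sq by (simp add: sum_nonneg)
  qed
  also have "\<dots> = (\<Sum>i\<in>I. \<Sum>j\<in>I. ennreal ((b i j)\<^sup>2) * emeasure lborel (D i \<times> D j))"
    using m by (subst nn_integral_sum; (intro sum.cong refl nn_integral_sum[THEN trans])?) (auto simp: nn_integral_cmult_indicator)
  also have "\<dots> = (\<Sum>i\<in>I. \<Sum>j\<in>I. ennreal ((b i j)\<^sup>2 * (measure lborel (D i) * measure lborel (D j))))"
    using assms(3) by (intro sum.cong refl) (auto simp: emeasure_lborel_Times finite_borelD image_subset_iff ennreal_mult)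
  finally show ?thesis by (simp add: sum_nonneg sum_ennreal)
qed

section \<open>Moments, finite additivity and second moments of step integrals\<close>

context brownian_random_measure
begin

lemma finite_borel_empty [simp]: "{} \<in> finite_borel" by (simp add: finite_borel_def)

lemma B_moments:
  assumes "A \<in> finite_borel"
  shows "integrable M (\<lambda>\<omega>. (B A \<omega>)\<^sup>2)" "expectation (B A) = 0" "expectation (\<lambda>\<omega>. (B A \<omega>)\<^sup>2) = measure lborel A"
proof -
  have [measurable]: "B A \<in> borel_measurable M" using measurable_B[OF assms] .
  have "integrable M (\<lambda>\<omega>. (B A \<omega>)\<^sup>2) \<and> expectation (B A) = 0 \<and> expectation (\<lambda>\<omega>. (B A \<omega>)\<^sup>2) = measure lborel A"
  proof (cases "measure lborel A > 0")
    case True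
    note d = normal[OF assms True]
    from True have s: "0 < sqrt (measure lborel A)" by simp
    have e: "expectation (B A) = 0" using normal_distributed_expectation[OF s d] .
    have i: "integrable lborel (\<lambda>x. normal_density 0 (sqrt (measure lborel A)) x * x\<^sup>2)"
      using integrable_normal_moment[OF s, of 0 2] by simp
    have "integrable M (\<lambda>\<omega>. (B A \<omega>)\<^sup>2)"
      using distributed_integrable[OF d, of "\<lambda>x. x\<^sup>2"] i s by simp
    moreover have "expectation (\<lambda>\<omega>. (B A \<omega>)\<^sup>2) = measure lborel A"
      using normal_distributed_variance[OF s d] e s by simp
    ultimately show ?thesis using e by simp
  next
    case False
    hence z: "measure lborel A = 0" by (simp add: zero_less_measure_iff)
    from null[OF assms z] have ae: "AE \<omega> in M. B A \<omega> = 0" .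
    have "integrable M (\<lambda>\<omega>. (B A \<omega>)\<^sup>2) \<longleftrightarrow> integrable M (\<lambda>\<omega>. 0::real)" using ae by (intro integrable_cong_AE) auto
    moreover have "expectation (B A) = (\<integral>\<omega>. 0 \<partial>M)" using ae by (intro integral_cong_AE) auto
    moreover have "expectation (\<lambda>\<omega>. (B A \<omega>)\<^sup>2) = (\<integral>\<omega>. 0 \<partial>M)" using ae by (intro integral_cong_AE) auto
    ultimately show ?thesis using z by simp
  qed
  thus "integrable M (\<lambda>\<omega>. (B A \<omega>)\<^sup>2)" "expectation (B A) = 0" "expectation (\<lambda>\<omega>. (B A \<omega>)\<^sup>2) = measure lborel A" by auto
qed

text \<open>The axiom speaks of sequences, so the finite family is spread along an injection into
  the naturals and padded with empty sets.\<close>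

lemma indep_finite:
  assumes "finite I" "disjoint_family_on D I" "D ` I \<subseteq> finite_borel"
  shows "indep_vars (\<lambda>_. borel) (\<lambda>i. B (D i)) I"
proof -
  obtain h :: "_ \<Rightarrow> nat" where h: "inj_on h I" using assms(1) finite_imp_inj_to_nat_seg by blast
  define A where "A k = (if k \<in> h ` I then D (the_inv_into I h k) else {})" for k
  have Ah: "A (h i) = D i" if "i \<in> I" for i using that h by (auto simp: A_def the_inv_into_f_f)
  have "range A \<subseteq> finite_borel" using assms(3) h by (auto simp: A_def the_inv_into_f_f)
  moreover have "disjoint_family A"
    using assms(2) h unfolding disjoint_family_on_def
    by (auto simp: A_def the_inv_into_f_f) (metis disjoint_iff)
  ultimately have "indep_vars (\<lambda>_. borel) (\<lambda>k. B (A k)) UNIV" by (rule indep)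
  hence "indep_vars (\<lambda>i. PiM {h i} (\<lambda>_. borel)) (\<lambda>i \<omega>. restrict (\<lambda>k. B (A k) \<omega>) {h i}) I"
    by (rule indep_vars_restrict) (use h in \<open>auto simp: disjoint_family_on_def inj_on_def\<close>)
  hence "indep_vars (\<lambda>_. borel) (\<lambda>i \<omega>. (\<lambda>x. x (h i)) (restrict (\<lambda>k. B (A k) \<omega>) {h i})) I"
    by (rule indep_vars_compose2) auto
  thus ?thesis by (rule indep_vars_cong[THEN iffD1, rotated -1]) (auto simp: Ah)
qed

lemma additive_finite:
  assumes "finite I" "disjoint_family_on D I" "D ` I \<subseteq> finite_borel"
  shows "AE \<omega> in M. B (\<Union>i\<in>I. D i) \<omega> = (\<Sum>i\<in>I. B (D i) \<omega>)"
proof -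
  obtain h :: "_ \<Rightarrow> nat" where h: "inj_on h I" using assms(1) finite_imp_inj_to_nat_seg by blast
  define A where "A k = (if k \<in> h ` I then D (the_inv_into I h k) else {})" for k
  have Ah: "A (h i) = D i" if "i \<in> I" for i using that h by (auto simp: A_def the_inv_into_f_f)
  have r: "range A \<subseteq> finite_borel" using assms(3) h by (auto simp: A_def the_inv_into_f_f)
  have d: "disjoint_family A"
    using assms(2) h unfolding disjoint_family_on_def
    by (auto simp: A_def the_inv_into_f_f) (metis disjoint_iff)
  have U: "(\<Union>k. A k) = (\<Union>i\<in>I. D i)" using h by (fastforce simp: A_def the_inv_into_f_f split: if_splits)
  have "AE \<omega> in M. (\<lambda>k. B (A k) \<omega>) sums B (\<Union>k. A k) \<omega>"
    by (rule additive[OF r d]) (unfold U, rule finite_borel_UN[OF assms(1,3)])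
  \<comment> \<open>The padding sets contribute nothing almost surely, so the series of the axiom is
    a finite sum.\<close>
  moreover have "AE \<omega> in M. B {} \<omega> = 0" by (rule null) auto
  ultimately show ?thesis
  proof eventually_elim
    case (elim \<omega>)
    have "(\<lambda>k. B (A k) \<omega>) sums (\<Sum>k\<in>h ` I. B (A k) \<omega>)"
      using assms(1) elim(2) by (intro sums_finite) (auto simp: A_def)
    hence "B (\<Union>i\<in>I. D i) \<omega> = (\<Sum>k\<in>h ` I. B (A k) \<omega>)" using elim(1) U sums_unique2 by fastforce
    also have "\<dots> = (\<Sum>i\<in>I. B (D i) \<omega>)" using h by (simp add: sum.reindex Ah)
    finally show ?case .
  qed
qed

lemma family:
  assumes "finite I" "disjoint_family_on D I" "D ` I \<subseteq> finite_borel"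
  shows "orthogonal_family M (\<lambda>i. B (D i)) I"
  using assms B_moments indep_finite[OF assms] by unfold_locales auto

text \<open>Both sides are governed by the same weighted sum of squared coefficients, because the
  variance of an increment is the length of its cell.\<close>

lemma nn_integral_square_quadratic_le:
  fixes D :: "'i \<Rightarrow> real set" and b :: "'i \<Rightarrow> 'i \<Rightarrow> real"
  assumes "finite I" "disjoint_family_on D I" "D ` I \<subseteq> finite_borel" "\<And>i. i \<in> I \<Longrightarrow> b i i = 0"
  shows "(\<integral>\<^sup>+\<omega>. ennreal ((\<Sum>i\<in>I. \<Sum>j\<in>I. b i j * B (D i) \<omega> * B (D j) \<omega>)\<^sup>2) \<partial>M)
    \<le> 2 * (\<integral>\<^sup>+x. ennreal ((\<Sum>i\<in>I. \<Sum>j\<in>I. b i j * indicator (D i \<times> D j) x)\<^sup>2) \<partial>lborel)"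
proof -
  interpret orthogonal_family M "\<lambda>i. B (D i)" I by (rule family[OF assms(1-3)])
  have "(\<integral>\<^sup>+\<omega>. ennreal ((\<Sum>i\<in>I. \<Sum>j\<in>I. b i j * B (D i) \<omega> * B (D j) \<omega>)\<^sup>2) \<partial>M)
    = ennreal (expectation (\<lambda>\<omega>. (\<Sum>i\<in>I. \<Sum>j\<in>I. b i j * B (D i) \<omega> * B (D j) \<omega>)\<^sup>2))"
    by (rule nn_integral_eq_integral[OF quadratic_bound(1)[OF assms(4)]]) auto
  also have "\<dots> \<le> ennreal (2 * (\<Sum>i\<in>I. \<Sum>j\<in>I. (b i j)\<^sup>2 * (measure lborel (D i) * measure lborel (D j))))"
  proof (rule ennreal_leI, rule order_trans[OF quadratic_bound(2)[OF assms(4)]])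
    show "2 * (\<Sum>i\<in>I. \<Sum>j\<in>I. (b i j)\<^sup>2 * (expectation (\<lambda>\<omega>. (B (D i) \<omega>)\<^sup>2) * expectation (\<lambda>\<omega>. (B (D j) \<omega>)\<^sup>2)))
      \<le> 2 * (\<Sum>i\<in>I. \<Sum>j\<in>I. (b i j)\<^sup>2 * (measure lborel (D i) * measure lborel (D j)))"
      using assms(3) by (intro mult_left_mono sum_mono) (auto simp: B_moments(3) image_subset_iff)
  qed
  also have "\<dots> = 2 * (\<integral>\<^sup>+x. ennreal ((\<Sum>i\<in>I. \<Sum>j\<in>I. b i j * indicator (D i \<times> D j) x)\<^sup>2) \<partial>lborel)"
    unfolding nn_integral_square_step[OF assms(1-3)] by (simp add: ennreal_mult sum_nonneg)
  finally show ?thesis .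
qed

text \<open>Brings sums over any finite index type into the numbered form of
  \<open>offdiag_step\<close>; the indices are later pairs of cells or pairs of function
  values.\<close>

lemma offdiag_step_reindex:
  fixes D :: "'i \<Rightarrow> real set" and b :: "'i \<Rightarrow> 'i \<Rightarrow> real"
  assumes "finite I" "disjoint_family_on D I" "D ` I \<subseteq> finite_borel" "\<And>i. i \<in> I \<Longrightarrow> b i i = 0"
  obtains n A a where "offdiag_step n A a"
    "\<And>x. step_fun n A a x = (\<Sum>i\<in>I. \<Sum>j\<in>I. b i j * indicator (D i \<times> D j) x)"
    "\<And>\<omega>. step_integral B n A a \<omega> = (\<Sum>i\<in>I. \<Sum>j\<in>I. b i j * B (D i) \<omega> * B (D j) \<omega>)"
proof -
  obtain e where e: "bij_betw e {..<card I} I"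
    using ex_bij_betw_nat_finite[OF assms(1)] by (auto simp: atLeast0LessThan)
  hence eI: "\<And>k. k < card I \<Longrightarrow> e k \<in> I" and ei: "inj_on e {..<card I}" by (auto simp: bij_betw_def)
  have s: "(\<Sum>k<card I. f (e k)) = (\<Sum>i\<in>I. f i)" for f :: "'i \<Rightarrow> real" using sum.reindex_bij_betw[OF e] .
  have "offdiag_step (card I) (\<lambda>k. D (e k)) (\<lambda>k l. b (e k) (e l))"
  proof -
    have "disjoint_family_on (\<lambda>k. D (e k)) {..<card I}"
      using assms(2) eI ei unfolding disjoint_family_on_def by (metis inj_onD lessThan_iff)
    thus ?thesis unfolding offdiag_step_def using assms eI by auto
  qed
  moreover have "step_fun (card I) (\<lambda>k. D (e k)) (\<lambda>k l. b (e k) (e l)) x = (\<Sum>i\<in>I. \<Sum>j\<in>I. b i j * indicator (D i \<times> D j) x)" for x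
    unfolding step_fun_def s[of "\<lambda>i. \<Sum>l<card I. b i (e l) * indicator (D i \<times> D (e l)) x"]
    by (intro sum.cong refl s[of "\<lambda>j. b _ j * indicator (D _ \<times> D j) x"])
  moreover have "step_integral B (card I) (\<lambda>k. D (e k)) (\<lambda>k l. b (e k) (e l)) \<omega> = (\<Sum>i\<in>I. \<Sum>j\<in>I. b i j * B (D i) \<omega> * B (D j) \<omega>)" for \<omega>
    unfolding step_integral_def s[of "\<lambda>i. \<Sum>l<card I. b i (e l) * B (D i) \<omega> * B (D (e l)) \<omega>"]
    by (intro sum.cong refl s[of "\<lambda>j. b _ j * B (D _) \<omega> * B (D j) \<omega>"])
  ultimately show ?thesis by (rule that)
qed

text \<open>Both step functions are rewritten on a common refinement. The identity for the integrals
  is only almost sure because \<open>B\<close> is additive only up to a null set that may depend on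
  the cells.\<close>

lemma offdiag_step_diff:
  assumes "offdiag_step n A a" "offdiag_step m C c"
  obtains l E d where "offdiag_step l E d"
    "\<And>x. step_fun l E d x = step_fun n A a x - step_fun m C c x"
    "AE \<omega> in M. step_integral B l E d \<omega> = step_integral B n A a \<omega> - step_integral B m C c \<omega>"
proof -
  define UA where "UA = (\<Union>i<n. A i)"
  define UC where "UC = (\<Union>i<m. C i)"
  \<comment> \<open>Index \<open>n\<close> holds the part of the other support that the sets
    \<open>A i\<close> miss, so that the two extended families cover the same set. Its coefficient
    is 0.\<close>
  define A' where "A' i = (if i < n then A i else UC - UA)" for i
  define C' where "C' j = (if j < m then C j else UA - UC)" for j
  define D where "D p = A' (fst p) \<inter> C' (snd p)" for p
  define I where "I = {..n} \<times> {..m}"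
  define d where "d p q = (if fst p < n \<and> fst q < n then a (fst p) (fst q) else 0)
    - (if snd p < m \<and> snd q < m then c (snd p) (snd q) else 0)" for p q :: "nat \<times> nat"
  have dA: "disjoint_family_on A' {..n}"
  proof -
    have "A i \<subseteq> UA" if "i < n" for i using that by (auto simp: UA_def)
    moreover have "A i \<inter> A j = {}" if "i < n" "j < n" "i \<noteq> j" for i j
      using assms(1) that by (auto simp: offdiag_step_def disjoint_family_on_def)
    ultimately show ?thesis unfolding disjoint_family_on_def A'_def by (auto simp: disjoint_iff subset_iff le_less)
  qed
  have dC: "disjoint_family_on C' {..m}"
  proof -
    have "C i \<subseteq> UC" if "i < m" for i using that by (auto simp: UC_def)
    moreover have "C i \<inter> C j = {}" if "i < m" "j < m" "i \<noteq> j" for i j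
      using assms(2) that by (auto simp: offdiag_step_def disjoint_family_on_def)
    ultimately show ?thesis unfolding disjoint_family_on_def C'_def by (auto simp: disjoint_iff subset_iff le_less)
  qed
  have "UA \<in> finite_borel" "UC \<in> finite_borel"
    using assms unfolding UA_def UC_def offdiag_step_def by (auto intro!: finite_borel_UN)
  hence fA: "A' i \<in> finite_borel" and fC: "C' j \<in> finite_borel" for i j
    using assms unfolding offdiag_step_def A'_def C'_def
    by (auto intro!: finite_borel_subset[of "UC - UA" UC] finite_borel_subset[of "UA - UC" UA] simp: finite_borelD)
  have fD: "D ` I \<subseteq> finite_borel"
    unfolding D_def using fA fC by (auto intro!: finite_borel_subset[of "A' _ \<inter> C' _" "A' _"] simp: finite_borelD)
  have dD: "disjoint_family_on D I"
    unfolding disjoint_family_on_def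
  proof (intro ballI impI)
    fix p q assume *: "p \<in> I" "q \<in> I" "p \<noteq> q"
    have "A' (fst p) \<inter> A' (fst q) = {} \<or> C' (snd p) \<inter> C' (snd q) = {}"
    proof (cases "fst p = fst q")
      case True
      hence "snd p \<noteq> snd q" using * by (simp add: prod_eq_iff)
      thus ?thesis using disjoint_family_onD[OF dC, of "snd p" "snd q"] * by (auto simp: I_def)
    next
      case False
      thus ?thesis using disjoint_family_onD[OF dA, of "fst p" "fst q"] * by (auto simp: I_def)
    qed
    thus "D p \<inter> D q = {}" unfolding D_def by auto
  qed
  have fI: "finite I" by (simp add: I_def)
  \<comment> \<open>On the diagonal both coordinates agree, so only diagonal entries of
    \<open>a\<close> and \<open>c\<close> could occur, and these vanish: the refinement stays
    off-diagonal.\<close>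
  have d0: "d p p = 0" for p using assms by (simp add: d_def offdiag_step_def)
  obtain l E e where e: "offdiag_step l E e"
    "\<And>x. step_fun l E e x = (\<Sum>i\<in>I. \<Sum>j\<in>I. d i j * indicator (D i \<times> D j) x)"
    "\<And>\<omega>. step_integral B l E e \<omega> = (\<Sum>i\<in>I. \<Sum>j\<in>I. d i j * B (D i) \<omega> * B (D j) \<omega>)"
    by (rule offdiag_step_reindex[OF fI dD fD, of d, OF d0]) (rule that)
  have Ar: "A i = (\<Union>k\<le>m. D (i,k))" if "i < n" for i
  proof -
    have "A i \<subseteq> UA" using that by (auto simp: UA_def)
    moreover have "UA \<subseteq> (\<Union>k\<le>m. C' k)"
    proof
      fix x assume "x \<in> UA"
      show "x \<in> (\<Union>k\<le>m. C' k)"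
      proof (cases "x \<in> UC")
        case True
        then obtain k where "k < m" "x \<in> C k" by (auto simp: UC_def)
        thus ?thesis by (auto simp: C'_def intro!: bexI[of _ k])
      qed (use \<open>x \<in> UA\<close> in \<open>auto simp: C'_def intro!: bexI[of _ m]\<close>)
    qed
    ultimately show ?thesis using that by (auto simp: D_def A'_def)
  qed
  have Cr: "C j = (\<Union>k\<le>n. D (k,j))" if "j < m" for j
  proof -
    have "C j \<subseteq> UC" using that by (auto simp: UC_def)
    moreover have "UC \<subseteq> (\<Union>k\<le>n. A' k)"
    proof
      fix x assume "x \<in> UC"
      show "x \<in> (\<Union>k\<le>n. A' k)"
      proof (cases "x \<in> UA")
        case True
        then obtain k where "k < n" "x \<in> A k" by (auto simp: UA_def)
        thus ?thesis by (auto simp: A'_def intro!: bexI[of _ k])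
      qed (use \<open>x \<in> UC\<close> in \<open>auto simp: A'_def intro!: bexI[of _ n]\<close>)
    qed
    ultimately show ?thesis using that by (auto simp: D_def C'_def)
  qed
  have dAr: "disjoint_family_on (\<lambda>k. D (i,k)) {..m}" if "i < n" for i
    using that dD unfolding I_def disjoint_family_on_def by (metis (no_types, lifting) Pair_inject SigmaI atMost_iff less_imp_le_nat)
  have dCr: "disjoint_family_on (\<lambda>k. D (k,j)) {..n}" if "j < m" for j
    using that dD unfolding I_def disjoint_family_on_def by (metis (no_types, lifting) Pair_inject SigmaI atMost_iff less_imp_le_nat)
  \<comment> \<open>Used twice: with indicators in the two plane coordinates and with the values of
    \<open>B\<close> on the cells.\<close>
  have split: "(\<Sum>p\<in>I. \<Sum>q\<in>I. d p q * u p * w q)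
    = (\<Sum>i<n. \<Sum>j<n. a i j * (\<Sum>k\<le>m. u (i,k)) * (\<Sum>k\<le>m. w (j,k))) - (\<Sum>i<m. \<Sum>j<m. c i j * (\<Sum>k\<le>n. u (k,i)) * (\<Sum>k\<le>n. w (k,j)))" for u w
    unfolding I_def sum_times_blocks_fst[symmetric] sum_times_blocks_snd[symmetric]
    by (simp only: d_def left_diff_distrib sum_subtractf)
  have "step_fun l E e x = step_fun n A a x - step_fun m C c x" for x
  proof -
    have i1: "indicator (A i) y = (\<Sum>k\<le>m. indicator (D (i,k)) y :: real)" if "i < n" for i y
      by (subst Ar[OF that]) (rule indicator_UN_disjoint[OF _ dAr[OF that]], simp)
    have i2: "indicator (C j) y = (\<Sum>k\<le>n. indicator (D (k,j)) y :: real)" if "j < m" for j y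
      by (subst Cr[OF that]) (rule indicator_UN_disjoint[OF _ dCr[OF that]], simp)
    show ?thesis
      by (subst e(2), unfold step_fun_def indicator_times mult.assoc[symmetric] split)
        (intro arg_cong2[where f=minus] sum.cong arg_cong2[where f=times] refl i1[symmetric] i2[symmetric]; simp)
  qed
  moreover have "AE \<omega> in M. step_integral B l E e \<omega> = step_integral B n A a \<omega> - step_integral B m C c \<omega>"
  proof -
    have "AE \<omega> in M. \<forall>i\<in>{..<n}. B (A i) \<omega> = (\<Sum>k\<le>m. B (D (i,k)) \<omega>)"
      using fD by (intro AE_finite_allI) (auto simp: Ar I_def intro!: additive_finite dAr)
    moreover have "AE \<omega> in M. \<forall>j\<in>{..<m}. B (C j) \<omega> = (\<Sum>k\<le>n. B (D (k,j)) \<omega>)"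
      using fD by (intro AE_finite_allI) (auto simp: Cr I_def intro!: additive_finite dCr)
    ultimately show ?thesis
      by eventually_elim (subst e(3), unfold split step_integral_def, simp)
  qed
  ultimately show ?thesis using e(1) that by blast
qed

lemma step_integral_diff_le:
  assumes "offdiag_step n A a" "offdiag_step m C c"
  shows "(\<integral>\<^sup>+\<omega>. ennreal ((step_integral B n A a \<omega> - step_integral B m C c \<omega>)\<^sup>2) \<partial>M)
    \<le> 2 * (\<integral>\<^sup>+x. ennreal ((step_fun n A a x - step_fun m C c x)\<^sup>2) \<partial>lborel)"
proof -
  obtain l E d where d: "offdiag_step l E d"
    "\<And>x. step_fun l E d x = step_fun n A a x - step_fun m C c x"
    "AE \<omega> in M. step_integral B l E d \<omega> = step_integral B n A a \<omega> - step_integral B m C c \<omega>"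
    using offdiag_step_diff[OF assms] by metis
  have "(\<integral>\<^sup>+\<omega>. ennreal ((step_integral B n A a \<omega> - step_integral B m C c \<omega>)\<^sup>2) \<partial>M)
    = (\<integral>\<^sup>+\<omega>. ennreal ((step_integral B l E d \<omega>)\<^sup>2) \<partial>M)"
    using d(3) by (intro nn_integral_cong_AE) auto
  also have "\<dots> \<le> 2 * (\<integral>\<^sup>+x. ennreal ((step_fun l E d x)\<^sup>2) \<partial>lborel)"
    using d(1) unfolding step_integral_def step_fun_def offdiag_step_def
    by (intro nn_integral_square_quadratic_le) auto
  finally show ?thesis by (simp add: d(2))
qed

lemma step_integral_measurable [measurable (raw)]:
  "offdiag_step n A a \<Longrightarrow> step_integral B n A a \<in> borel_measurable M"
  unfolding step_integral_def offdiag_step_def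
  by (intro borel_measurable_sum borel_measurable_times measurable_B borel_measurable_const) auto

lemma step_fun_measurable [measurable (raw)]:
  assumes "offdiag_step n A a" shows "step_fun n A a \<in> borel_measurable borel"
proof -
  have [measurable]: "i < n \<Longrightarrow> A i \<in> sets borel" for i using assms by (auto simp: offdiag_step_def finite_borelD)
  have "step_fun n A a \<in> borel_measurable (borel \<Otimes>\<^sub>M borel)"
    unfolding step_fun_def by measurable
  thus ?thesis by (simp add: borel_prod)
qed

end

section \<open>Existence of the double integral\<close>

text \<open>The squared L^2 norm, with the value \<infinity> in place of an integrability side
  condition.\<close>

definition sq_norm :: "'a measure \<Rightarrow> ('a \<Rightarrow> real) \<Rightarrow> ennreal" where
  "sq_norm M f = (\<integral>\<^sup>+x. ennreal ((f x)\<^sup>2) \<partial>M)"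

text \<open>Minkowski's inequality in squared form, from 2ab \<le> a^2 + b^2. Each use costs a
  factor 2; such factors make up most of the numerical constants below.\<close>

lemma sq_norm_triangle:
  assumes [measurable]: "f \<in> borel_measurable M" "g \<in> borel_measurable M" "h \<in> borel_measurable M"
  shows "sq_norm M (\<lambda>x. f x - h x) \<le> 2 * sq_norm M (\<lambda>x. f x - g x) + 2 * sq_norm M (\<lambda>x. g x - h x)"
proof -
  have "ennreal ((f x - h x)\<^sup>2) \<le> 2 * ennreal ((f x - g x)\<^sup>2) + 2 * ennreal ((g x - h x)\<^sup>2)" for x
  proof -
    have "0 \<le> ((f x - g x) - (g x - h x))\<^sup>2" by simp
    hence "(f x - h x)\<^sup>2 \<le> 2 * (f x - g x)\<^sup>2 + 2 * (g x - h x)\<^sup>2"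
      by (simp add: power2_eq_square algebra_simps)
    from ennreal_leI[OF this] show ?thesis by (simp add: ennreal_mult ennreal_plus)
  qed
  hence "sq_norm M (\<lambda>x. f x - h x) \<le> (\<integral>\<^sup>+x. 2 * ennreal ((f x - g x)\<^sup>2) + 2 * ennreal ((g x - h x)\<^sup>2) \<partial>M)"
    unfolding sq_norm_def by (intro nn_integral_mono)
  also have "\<dots> = 2 * sq_norm M (\<lambda>x. f x - g x) + 2 * sq_norm M (\<lambda>x. g x - h x)"
    unfolding sq_norm_def by (subst nn_integral_add) (auto simp: nn_integral_cmult)
  finally show ?thesis .
qed

lemma sq_norm_commute: "sq_norm M (\<lambda>x. f x - g x) = sq_norm M (\<lambda>x. g x - f x)"
  unfolding sq_norm_def by (simp add: power2_commute)

lemma sq_norm_scale: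
  assumes [measurable]: "f \<in> borel_measurable M"
  shows "sq_norm M (\<lambda>x. c * f x) = ennreal (c\<^sup>2) * sq_norm M f"
  unfolding sq_norm_def by (simp add: power_mult_distrib ennreal_mult nn_integral_cmult)

lemma sq_norm_dominated_convergence:
  assumes [measurable]: "\<And>n. G n \<in> borel_measurable M" "F \<in> borel_measurable M" "H \<in> borel_measurable M"
    and "sq_norm M H < \<infinity>" and bd: "\<And>n x. x \<in> space M \<Longrightarrow> \<bar>G n x\<bar> \<le> H x"
    and lim: "\<And>x. x \<in> space M \<Longrightarrow> (\<lambda>n. G n x) \<longlonglongrightarrow> F x"
  shows "(\<lambda>n. sq_norm M (\<lambda>x. G n x - F x)) \<longlonglongrightarrow> 0"
proof -
  have "(\<lambda>n. \<integral>\<^sup>+x. ennreal ((G n x - F x)\<^sup>2) \<partial>M) \<longlonglongrightarrow> (\<integral>\<^sup>+x. 0 \<partial>M)"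
  proof (rule nn_integral_dominated_convergence[where w="\<lambda>x. 4 * ennreal ((H x)\<^sup>2)"])
    show "AE x in M. ennreal ((G n x - F x)\<^sup>2) \<le> 4 * ennreal ((H x)\<^sup>2)" for n
    proof (rule AE_I2)
      fix x assume x: "x \<in> space M"
      have "\<bar>F x\<bar> \<le> H x"
        using tendsto_rabs[OF lim[OF x]] by (rule LIMSEQ_le_const2) (use bd[OF x] in auto)
      with bd[OF x, of n] have "\<bar>G n x - F x\<bar> \<le> 2 * H x" by linarith
      hence "(G n x - F x)\<^sup>2 \<le> (2 * H x)\<^sup>2" using abs_le_square_iff[of "G n x - F x" "2 * H x"] by linarith
      from ennreal_leI[OF this] show "ennreal ((G n x - F x)\<^sup>2) \<le> 4 * ennreal ((H x)\<^sup>2)"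
        by (simp add: power_mult_distrib ennreal_mult)
    qed
    show "(\<integral>\<^sup>+ x. 4 * ennreal ((H x)\<^sup>2) \<partial>M) < \<infinity>"
      using assms(4) by (simp add: nn_integral_cmult sq_norm_def ennreal_mult_less_top)
    show "AE x in M. (\<lambda>n. ennreal ((G n x - F x)\<^sup>2)) \<longlonglongrightarrow> 0"
    proof (rule AE_I2)
      fix x assume x: "x \<in> space M"
      have "(\<lambda>n. (G n x - F x)\<^sup>2) \<longlonglongrightarrow> (F x - F x)\<^sup>2" by (intro tendsto_intros lim x)
      from tendsto_ennrealI[OF this] show "(\<lambda>n. ennreal ((G n x - F x)\<^sup>2)) \<longlonglongrightarrow> 0" by simp
    qed
  qed measurable
  thus ?thesis by (simp add: sq_norm_def)
qed

text \<open>The Riesz-Fischer argument. The geometric rate makes the whole sequence converge almost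
  everywhere, and Fatou's lemma turns the pointwise limit into an L^2 limit.\<close>

lemma L2_complete:
  fixes Y :: "nat \<Rightarrow> 'a \<Rightarrow> real"
  assumes [measurable]: "\<And>k. Y k \<in> borel_measurable M"
    and cauchy: "\<And>k m. k \<le> m \<Longrightarrow> sq_norm M (\<lambda>x. Y k x - Y m x) \<le> ennreal (C * (1/4)^k)"
    and C: "C \<ge> 0"
  obtains X where "X \<in> borel_measurable M" "(\<lambda>k. sq_norm M (\<lambda>x. Y k x - X x)) \<longlonglongrightarrow> 0"
proof -
  define X where "X x = lim (\<lambda>k. Y k x)" for x
  have [measurable]: "X \<in> borel_measurable M" unfolding X_def by measurable
  \<comment> \<open>The weight 2^k leaves a summable series against the rate (1/4)^k, yet is strong
    enough to control the first powers of the increments.\<close>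
  have "(\<integral>\<^sup>+x. (\<Sum>k. ennreal (2^k * (Y k x - Y (Suc k) x)\<^sup>2)) \<partial>M) = (\<Sum>k. \<integral>\<^sup>+x. ennreal (2^k * (Y k x - Y (Suc k) x)\<^sup>2) \<partial>M)"
    by (rule nn_integral_suminf) measurable
  also have "\<dots> \<le> (\<Sum>k. ennreal (C * (1/2)^k))"
  proof (intro suminf_le)
    fix k
    have "(\<integral>\<^sup>+x. ennreal (2^k * (Y k x - Y (Suc k) x)\<^sup>2) \<partial>M) = ennreal (2^k) * sq_norm M (\<lambda>x. Y k x - Y (Suc k) x)"
      unfolding sq_norm_def by (simp add: ennreal_mult nn_integral_cmult)
    also have "\<dots> \<le> ennreal (2^k) * ennreal (C * (1/4)^k)" by (intro mult_left_mono cauchy) auto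
    also have "\<dots> = ennreal (2^k * (C * (1/4)^k))" using C by (simp add: ennreal_mult)
    also have "2^k * (C * (1/4)^k) = C * (1/2)^k"
      using power_mult_distrib[of 2 "1/4::real" k] by simp
    finally show "(\<integral>\<^sup>+x. ennreal (2^k * (Y k x - Y (Suc k) x)\<^sup>2) \<partial>M) \<le> ennreal (C * (1/2)^k)" .
  qed auto
  also have "\<dots> = ennreal (\<Sum>k. C * (1/2)^k)"
    using C by (intro suminf_ennreal2 summable_mult summable_geometric) auto
  also have "\<dots> < \<infinity>" by simp
  finally have "AE x in M. (\<Sum>k. ennreal (2^k * (Y k x - Y (Suc k) x)\<^sup>2)) \<noteq> \<infinity>"
    by (intro nn_integral_noteq_infinite) auto
  hence lim: "AE x in M. (\<lambda>k. Y k x) \<longlonglongrightarrow> X x"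
  proof eventually_elim
    case (elim x)
    have s: "summable (\<lambda>k. 2^k * (Y k x - Y (Suc k) x)\<^sup>2)"
      by (rule summable_suminf_not_top) (use elim in auto)
    have "summable (\<lambda>k. \<bar>Y k x - Y (Suc k) x\<bar>)"
    proof (rule summable_comparison_test', rule summable_add[OF s])
      show "summable (\<lambda>k. (1/2::real)^k)" by (rule summable_geometric) simp
      fix k
      let ?d = "\<bar>Y k x - Y (Suc k) x\<bar>"
      \<comment> \<open>Arithmetic-geometric mean, giving d \<le> 2^k d^2 + 2^(-k) with both terms
        summable.\<close>
      have "0 \<le> (2^k * ?d - 1)\<^sup>2" by simp
      hence "2 * (2^k * ?d) \<le> (2^k)\<^sup>2 * ?d\<^sup>2 + 1" by (simp add: power2_diff power_mult_distrib)
      hence "2^k * ?d \<le> (2^k)\<^sup>2 * ?d\<^sup>2 + 1" by (smt (verit) zero_le_mult_iff zero_le_power abs_ge_zero)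
      hence "2^k * ?d \<le> 2^k * (2^k * ?d\<^sup>2 + (1/2)^k)"
        by (simp add: power2_eq_square algebra_simps power_one_over)
      hence "?d \<le> 2^k * ?d\<^sup>2 + (1/2)^k" by (simp add: mult_le_cancel_left_pos)
      thus "norm \<bar>Y k x - Y (Suc k) x\<bar> \<le> 2 ^ k * (Y k x - Y (Suc k) x)\<^sup>2 + (1 / 2) ^ k" by simp
    qed
    moreover have "\<bar>Y k x - Y (Suc k) x\<bar> = \<bar>Y (Suc k) x - Y k x\<bar>" for k by (rule abs_minus_commute)
    ultimately have "summable (\<lambda>k. Y (Suc k) x - Y k x)" using summable_rabs_cancel by simp
    hence "convergent (\<lambda>n. \<Sum>k<n. Y (Suc k) x - Y k x)" by (simp add: summable_iff_convergent)
    hence "convergent (\<lambda>n. Y n x - Y 0 x)" unfolding sum_lessThan_telescope[of "\<lambda>k. Y k x"] .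
    hence "convergent (\<lambda>n. (Y n x - Y 0 x) + Y 0 x)" by (intro convergent_add convergent_const)
    thus ?case unfolding X_def by (simp add: convergent_LIMSEQ_iff)
  qed
  \<comment> \<open>Fatou in the second index \<open>m\<close>, with \<open>k\<close> fixed.\<close>
  have bnd: "sq_norm M (\<lambda>x. Y k x - X x) \<le> ennreal (C * (1/4)^k)" for k
  proof -
    have "sq_norm M (\<lambda>x. Y k x - X x) = (\<integral>\<^sup>+x. liminf (\<lambda>m. ennreal ((Y k x - Y m x)\<^sup>2)) \<partial>M)"
      unfolding sq_norm_def
    proof (rule nn_integral_cong_AE, use lim in eventually_elim)
      case (elim x)
      have "(\<lambda>m. (Y k x - Y m x)\<^sup>2) \<longlonglongrightarrow> (Y k x - X x)\<^sup>2" by (intro tendsto_intros elim)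
      from tendsto_ennrealI[OF this] show ?case
        using lim_imp_Liminf[OF trivial_limit_sequentially] by metis
    qed
    also have "\<dots> \<le> liminf (\<lambda>m. \<integral>\<^sup>+x. ennreal ((Y k x - Y m x)\<^sup>2) \<partial>M)" by (rule nn_integral_liminf) measurable
    also have "\<dots> \<le> limsup (\<lambda>m. sq_norm M (\<lambda>x. Y k x - Y m x))" unfolding sq_norm_def by (rule Liminf_le_Limsup) simp
    also have "\<dots> \<le> ennreal (C * (1/4)^k)"
      by (rule Limsup_bounded) (use cauchy[of k] in \<open>auto simp: eventually_sequentially\<close>)
    finally show ?thesis .
  qed
  have "(\<lambda>k. C * (1/4)^k) \<longlonglongrightarrow> C * 0" by (intro tendsto_intros LIMSEQ_power_zero) simp
  hence "(\<lambda>k. ennreal (C * (1/4)^k)) \<longlonglongrightarrow> 0" using tendsto_ennrealI by fastforce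
  hence "(\<lambda>k. sq_norm M (\<lambda>x. Y k x - X x)) \<longlonglongrightarrow> 0"
    by (rule tendsto_sandwich[OF _ _ tendsto_const, rotated 2]) (auto simp: bnd)
  thus ?thesis using that \<open>X \<in> borel_measurable M\<close> by blast
qed

lemma step_fun_scale: "step_fun n A (\<lambda>i j. c * a i j) x = c * step_fun n A a x"
  unfolding step_fun_def sum_distrib_left by (simp add: mult.assoc)

lemma step_integral_scale: "step_integral B n A (\<lambda>i j. c * a i j) \<omega> = c * step_integral B n A a \<omega>"
  unfolding step_integral_def sum_distrib_left by (simp add: mult.assoc)

lemma offdiag_step_scale: "offdiag_step n A a \<Longrightarrow> offdiag_step n A (\<lambda>i j. c * a i j)"
  by (simp add: offdiag_step_def)

text \<open>Grid cells of mesh 1/m, used to slice a bounded set so finely that the diagonal blocks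
  of its square have small area.\<close>

lemma floor_cell_measure:
  fixes D :: "real set"
  assumes "D \<in> sets borel" "m > 0"
  shows "D \<inter> {x. \<lfloor>real m * (x + c)\<rfloor> = z} \<in> finite_borel"
    "measure lborel (D \<inter> {x. \<lfloor>real m * (x + c)\<rfloor> = z}) \<le> 1 / real m"
proof -
  let ?E = "D \<inter> {x. \<lfloor>real m * (x + c)\<rfloor> = z}" and ?J = "{of_int z / real m - c .. (of_int z + 1) / real m - c}"
  have sub: "?E \<subseteq> ?J" using assms(2) by (auto simp: field_simps floor_eq_iff)
  have E: "?E \<in> sets borel" using assms(1) by measurable
  have le: "of_int z / real m - c \<le> (of_int z + 1) / real m - c" by (simp add: divide_right_mono)
  have J: "emeasure lborel ?J = ennreal (1 / real m)"
    using emeasure_lborel_Icc[OF le] by (simp add: diff_divide_distrib[symmetric])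
  have "emeasure lborel ?E \<le> ennreal (1 / real m)"
    unfolding J[symmetric] using E by (intro emeasure_mono sub) auto
  thus "?E \<in> finite_borel" "measure lborel ?E \<le> 1 / real m"
    using E order_le_less_trans[of "emeasure lborel ?E" "ennreal (1 / real m)" \<infinity>]
    by (auto simp: finite_borel_def measure_def enn2real_leI)
qed

section \<open>Density of the off-diagonal step functions in L^2 of the plane\<close>

context brownian_random_measure
begin

text \<open>The L^2 closure of the off-diagonal step functions. The goal is that it contains all
  square integrable functions, although these functions vanish on diagonal blocks.\<close>

definition approximable :: "(real \<times> real \<Rightarrow> real) \<Rightarrow> bool" where
  "approximable F \<longleftrightarrow> F \<in> borel_measurable borel \<and>
     (\<forall>e>0. \<exists>n A a. offdiag_step n A a \<and> sq_norm lborel (\<lambda>x. step_fun n A a x - F x) \<le> e)"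

lemma approximableD: "approximable F \<Longrightarrow> F \<in> borel_measurable borel" by (simp add: approximable_def)

lemma approximable_step: "offdiag_step n A a \<Longrightarrow> approximable (step_fun n A a)"
  unfolding approximable_def
  by (auto intro!: step_fun_measurable exI[of _ n] exI[of _ A] exI[of _ a] simp: sq_norm_def)

lemma approximable_limit:
  assumes [measurable]: "F \<in> borel_measurable borel"
    and *: "\<And>e. e > 0 \<Longrightarrow> \<exists>G. approximable G \<and> sq_norm lborel (\<lambda>x. G x - F x) \<le> e"
  shows "approximable F"
  unfolding approximable_def
proof (intro conjI allI impI)
  fix e :: ennreal assume "e > 0"
  \<comment> \<open>A quarter of the tolerance, since the squared triangle inequality doubles each
    of the two errors.\<close>
  hence e4: "e / 4 > 0" by (simp add: ennreal_zero_less_divide)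
  obtain G where G: "approximable G" "sq_norm lborel (\<lambda>x. G x - F x) \<le> e / 4" using *[OF e4] by auto
  obtain n A a where a: "offdiag_step n A a" "sq_norm lborel (\<lambda>x. step_fun n A a x - G x) \<le> e / 4"
    using G(1) e4 unfolding approximable_def by blast
  have [measurable]: "G \<in> borel_measurable borel" "step_fun n A a \<in> borel_measurable borel"
    using G(1) a(1) by (auto intro: approximableD step_fun_measurable)
  have "sq_norm lborel (\<lambda>x. step_fun n A a x - F x) \<le> 2 * (e/4) + 2 * (e/4)"
    by (rule order_trans[OF sq_norm_triangle[of _ _ G] add_mono[OF mult_left_mono[OF a(2)] mult_left_mono[OF G(2)]]]) auto
  also have "\<dots> = 4 * (e / 4)" by (simp add: distrib_right[symmetric])
  also have "\<dots> = e" by (simp add: ennreal_times_divide ennreal_mult_divide_eq mult.commute[of 4])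
  finally show "\<exists>n A a. offdiag_step n A a \<and> sq_norm lborel (\<lambda>x. step_fun n A a x - F x) \<le> e" using a(1) by blast
qed simp

lemma approximable_LIMSEQ:
  assumes "F \<in> borel_measurable borel" "\<And>k. approximable (G k)"
    "(\<lambda>k. sq_norm lborel (\<lambda>x. G k x - F x)) \<longlonglongrightarrow> 0"
  shows "approximable F"
proof (rule approximable_limit[OF assms(1)])
  fix e :: ennreal assume "e > 0"
  from order_tendstoD(2)[OF assms(3) this] obtain k where "sq_norm lborel (\<lambda>x. G k x - F x) < e"
    by (auto simp: eventually_sequentially)
  thus "\<exists>G. approximable G \<and> sq_norm lborel (\<lambda>x. G x - F x) \<le> e" using assms(2) by (auto intro!: exI[of _ "G k"])
qed

lemma approximable_diff:
  assumes "approximable F" "approximable G"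
  shows "approximable (\<lambda>x. F x - G x)"
  unfolding approximable_def
proof (intro conjI allI impI)
  have [measurable]: "F \<in> borel_measurable borel" "G \<in> borel_measurable borel" using assms approximableD by auto
  show "(\<lambda>x. F x - G x) \<in> borel_measurable borel" by measurable
  fix e :: ennreal assume "e > 0"
  hence e4: "e / 4 > 0" by (simp add: ennreal_zero_less_divide)
  obtain n A a where a: "offdiag_step n A a" "sq_norm lborel (\<lambda>x. step_fun n A a x - F x) \<le> e / 4"
    using assms(1) e4 unfolding approximable_def by blast
  obtain m C c where c: "offdiag_step m C c" "sq_norm lborel (\<lambda>x. step_fun m C c x - G x) \<le> e / 4"
    using assms(2) e4 unfolding approximable_def by blast
  obtain l E d where d: "offdiag_step l E d" "\<And>x. step_fun l E d x = step_fun n A a x - step_fun m C c x"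
    using offdiag_step_diff[OF a(1) c(1)] by metis
  have [measurable]: "step_fun m C c \<in> borel_measurable borel" "step_fun n A a \<in> borel_measurable borel"
    using a(1) c(1) by (auto intro: approximableD step_fun_measurable)
  have "sq_norm lborel (\<lambda>x. step_fun l E d x - (F x - G x))
     \<le> 2 * sq_norm lborel (\<lambda>x. (step_fun n A a x - step_fun m C c x) - (F x - step_fun m C c x))
     + 2 * sq_norm lborel (\<lambda>x. (F x - step_fun m C c x) - (F x - G x))"
    unfolding d(2) by (rule sq_norm_triangle) measurable
  also have "\<dots> = 2 * sq_norm lborel (\<lambda>x. step_fun n A a x - F x) + 2 * sq_norm lborel (\<lambda>x. step_fun m C c x - G x)"
    by (simp add: sq_norm_commute[of _ G])
  also have "\<dots> \<le> 2 * (e/4) + 2 * (e/4)" by (intro add_mono mult_left_mono a(2) c(2)) auto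
  also have "\<dots> = 4 * (e / 4)" by (simp add: distrib_right[symmetric])
  also have "\<dots> = e" by (simp add: ennreal_times_divide ennreal_mult_divide_eq mult.commute[of 4])
  finally show "\<exists>n A a. offdiag_step n A a \<and> sq_norm lborel (\<lambda>x. step_fun n A a x - (F x - G x)) \<le> e" using d(1) by blast
qed

lemma approximable_0: "approximable (\<lambda>_. 0)"
proof -
  have "offdiag_step 0 (\<lambda>_. {}) (\<lambda>_ _. 0)" by (simp add: offdiag_step_def disjoint_family_on_def)
  from approximable_step[OF this] show ?thesis by (simp add: step_fun_def[abs_def])
qed

lemma approximable_add: "approximable F \<Longrightarrow> approximable G \<Longrightarrow> approximable (\<lambda>x. F x + G x)"
  using approximable_diff[OF _ approximable_diff[OF approximable_0, of G], of F] by simp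

lemma approximable_sum: "(\<And>i. i \<in> S \<Longrightarrow> approximable (F i)) \<Longrightarrow> approximable (\<lambda>x. \<Sum>i\<in>S. F i x)"
  by (induction S rule: infinite_finite_induct) (auto intro: approximable_0 approximable_add)

lemma approximable_scale:
  assumes "approximable F"
  shows "approximable (\<lambda>x. c * F x)"
proof -
  have [measurable]: "F \<in> borel_measurable borel" using assms approximableD by auto
  \<comment> \<open>Explicit errors (1/4)^k, because the tolerance cannot be divided by
    \<open>c\<^sup>2\<close> when c = 0.\<close>
  have "\<exists>n A a. offdiag_step n A a \<and> sq_norm lborel (\<lambda>x. step_fun n A a x - F x) \<le> ennreal ((1/4)^k)" for k :: nat
    using assms unfolding approximable_def by simp
  then obtain n A a where a: "\<And>k. offdiag_step (n k) (A k) (a k)"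
      "\<And>k. sq_norm lborel (\<lambda>x. step_fun (n k) (A k) (a k) x - F x) \<le> ennreal ((1/4)^k)" by metis
  have [measurable]: "step_fun (n k) (A k) (a k) \<in> borel_measurable borel" for k using a step_fun_measurable by auto
  show ?thesis
  proof (rule approximable_LIMSEQ[where G="\<lambda>k. step_fun (n k) (A k) (\<lambda>i j. c * a k i j)"])
    show "approximable (step_fun (n k) (A k) (\<lambda>i j. c * a k i j))" for k
      by (intro approximable_step offdiag_step_scale a)
    have eq: "sq_norm lborel (\<lambda>x. step_fun (n k) (A k) (\<lambda>i j. c * a k i j) x - c * F x)
      = ennreal (c\<^sup>2) * sq_norm lborel (\<lambda>x. step_fun (n k) (A k) (a k) x - F x)" for k
      by (subst sq_norm_scale[symmetric]) (auto simp: step_fun_scale right_diff_distrib)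
    have "(\<lambda>k. c\<^sup>2 * (1/4)^k) \<longlonglongrightarrow> c\<^sup>2 * 0" by (intro tendsto_intros LIMSEQ_power_zero) simp
    hence "(\<lambda>k. ennreal (c\<^sup>2 * (1/4)^k)) \<longlonglongrightarrow> 0" using tendsto_ennrealI by fastforce
    thus "(\<lambda>k. sq_norm lborel (\<lambda>x. step_fun (n k) (A k) (\<lambda>i j. c * a k i j) x - c * F x)) \<longlonglongrightarrow> 0"
      unfolding eq by (rule tendsto_sandwich[OF _ _ tendsto_const, rotated 2])
        (auto simp: ennreal_mult intro!: always_eventually mult_left_mono a(2))
  qed measurable
qed

lemma approximable_disjoint_rectangle:
  assumes "A \<in> finite_borel" "C \<in> finite_borel" "A \<inter> C = {}"
  shows "approximable (indicator (A \<times> C))"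
proof -
  have "offdiag_step 2 (\<lambda>i. if i = 0 then A else C) (\<lambda>i j. if i = 0 \<and> j = 1 then 1 else 0)"
    using assms by (auto simp: offdiag_step_def disjoint_family_on_def)
  moreover have "step_fun 2 (\<lambda>i. if i = 0 then A else C) (\<lambda>i j. if i = 0 \<and> j = 1 then 1 else 0) = indicator (A \<times> C)"
    by (auto simp: step_fun_def numeral_2_eq_2)
  ultimately show ?thesis using approximable_step by metis
qed

text \<open>This is where the diagonal is seen to be negligible. \<open>D\<close> is cut into 2Nm
  cells of length at most 1/m; dropping the diagonal blocks, each of area at most 1/m^2, changes the
  indicator by at most 2N/m in squared norm.\<close>

lemma approximable_square:
  fixes N :: nat
  assumes [measurable]: "D \<in> sets borel" and "D \<subseteq> {- real N..<real N}"
  shows "approximable (indicator (D \<times> D))"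
proof (rule approximable_limit)
  show "indicator (D \<times> D) \<in> borel_measurable borel" unfolding borel_prod[symmetric] by measurable
  fix e :: ennreal assume "e > 0"
  have "(\<lambda>m. 2 * real N * inverse (real (Suc m))) \<longlonglongrightarrow> 2 * real N * 0" by (intro tendsto_intros LIMSEQ_inverse_real_of_nat)
  hence "(\<lambda>m. ennreal (2 * real N * inverse (real (Suc m)))) \<longlonglongrightarrow> 0" using tendsto_ennrealI by fastforce
  from order_tendstoD(2)[OF this \<open>e > 0\<close>] obtain m0 where m0: "ennreal (2 * real N * inverse (real (Suc m0))) < e"
    by (auto simp: eventually_sequentially)
  define m where "m = Suc m0"
  have m: "m > 0" "ennreal (2 * real N / real m) < e" using m0 by (auto simp: m_def divide_inverse)
  define P where "P i = D \<inter> {x. \<lfloor>real m * (x + real N)\<rfloor> = int i}" for i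
  define n where "n = 2 * N * m"
  have P: "P i \<in> finite_borel" "measure lborel (P i) \<le> 1 / real m" for i
    unfolding P_def using floor_cell_measure[OF assms(1) m(1)] by auto
  have dP: "disjoint_family_on P {..<n}" by (auto simp: disjoint_family_on_def P_def)
  have UP: "D = (\<Union>i<n. P i)"
  proof
    show "D \<subseteq> (\<Union>i<n. P i)"
    proof
      fix x assume x: "x \<in> D"
      hence r: "0 \<le> x + N" "x + N < 2 * N" using assms(2) by auto
      have "real m * (x + N) < real m * (2 * N)" using r m by (intro mult_strict_left_mono) auto
      hence "nat \<lfloor>real m * (x + N)\<rfloor> < n" using r m by (simp add: n_def nat_less_iff floor_less_iff mult_ac)
      moreover have "x \<in> P (nat \<lfloor>real m * (x + N)\<rfloor>)" using x r m by (simp add: P_def)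
      ultimately show "x \<in> (\<Union>i<n. P i)" by blast
    qed
  qed (auto simp: P_def)
  let ?a = "\<lambda>i j. if i = j then 0 else (1::real)"
  have off: "offdiag_step n P ?a" using P dP by (auto simp: offdiag_step_def)
  have ind: "indicator D y = (\<Sum>i<n. indicator (P i) y :: real)" for y
    by (subst UP) (rule indicator_UN_disjoint[OF _ dP], simp)
  have diff: "step_fun n P ?a x - indicator (D \<times> D) x = - (\<Sum>i<n. \<Sum>j<n. (if i = j then 1 else 0) * indicator (P i \<times> P j) x)" for x
  proof -
    have "indicator (D \<times> D) x = (\<Sum>i<n. \<Sum>j<n. indicator (P i \<times> P j) x :: real)"
      unfolding indicator_times ind sum_product ..
    moreover have "(\<Sum>i<n. \<Sum>j<n. indicator (P i \<times> P j) x :: real)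
      = step_fun n P ?a x + (\<Sum>i<n. \<Sum>j<n. (if i = j then 1 else 0) * indicator (P i \<times> P j) x)"
      unfolding step_fun_def sum.distrib[symmetric] by (intro sum.cong refl) auto
    ultimately show ?thesis by simp
  qed
  have "(\<Sum>i<n. \<Sum>j<n. (if i = j then 1 else 0)\<^sup>2 * (measure lborel (P i) * measure lborel (P j)))
      = (\<Sum>i<n. measure lborel (P i) * measure lborel (P i))"
    by (simp add: if_distrib[of "\<lambda>x. x\<^sup>2"] if_distrib[of "\<lambda>x. x * _"] cong: if_cong)
  also have "\<dots> \<le> (\<Sum>i<n. 1 / real m * (1 / real m))" by (intro sum_mono mult_mono P) auto
  also have "\<dots> = 2 * real N / real m" using m by (simp add: n_def)
  finally have le: "(\<Sum>i<n. \<Sum>j<n. (if i = j then 1 else 0)\<^sup>2 * (measure lborel (P i) * measure lborel (P j))) \<le> 2 * real N / real m" .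
  have "sq_norm lborel (\<lambda>x. step_fun n P ?a x - indicator (D \<times> D) x)
      = ennreal (\<Sum>i<n. \<Sum>j<n. (if i = j then 1 else 0)\<^sup>2 * (measure lborel (P i) * measure lborel (P j)))"
    unfolding diff sq_norm_def power2_minus using P by (intro nn_integral_square_step dP) auto
  also have "\<dots> \<le> ennreal (2 * real N / real m)" by (rule ennreal_leI[OF le])
  also have "\<dots> < e" by fact
  finally show "\<exists>G. approximable G \<and> sq_norm lborel (\<lambda>x. G x - indicator (D \<times> D) x) \<le> e"
    using approximable_step[OF off] by (auto intro: less_imp_le)
qed

text \<open>Splits along the intersection into two rectangles with disjoint sides and the square of
  \<open>A \<inter> C\<close>.\<close>

lemma approximable_rectangle:
  fixes N :: nat
  assumes [measurable]: "A \<in> sets borel" "C \<in> sets borel" and "A \<subseteq> {- real N..<real N}" "C \<subseteq> {- real N..<real N}"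
  shows "approximable (indicator (A \<times> C))"
proof -
  have fin: "{- real N..<real N} \<in> finite_borel" by (simp add: finite_borel_def)
  have f: "A - C \<in> finite_borel" "C - A \<in> finite_borel" "A \<inter> C \<in> finite_borel" "C \<in> finite_borel"
    using assms by (auto intro!: finite_borel_subset[OF _ _ fin])
  have "approximable (\<lambda>x. (indicator ((A - C) \<times> C) x + indicator ((A \<inter> C) \<times> (C - A)) x) + indicator ((A \<inter> C) \<times> (A \<inter> C)) x)"
    using assms(3) by (intro approximable_add approximable_disjoint_rectangle approximable_square[where N=N] f) auto
  moreover have "(\<lambda>x. (indicator ((A - C) \<times> C) x + indicator ((A \<inter> C) \<times> (C - A)) x) + indicator ((A \<inter> C) \<times> (A \<inter> C)) x)
     = (indicator (A \<times> C) :: _ \<Rightarrow> real)"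
    by (auto simp: indicator_def)
  ultimately show ?thesis by simp
qed

text \<open>Dynkin's argument from rectangles. The bounding box keeps areas finite, so complements
  are differences of approximable indicators and disjoint countable unions follow by dominated
  convergence.\<close>

lemma approximable_bounded_set:
  fixes N :: nat
  assumes "E \<in> sets borel"
  shows "approximable (indicator (E \<inter> {- real N..<real N} \<times> {- real N..<real N}))"
proof -
  let ?Q = "{- real N..<real N} \<times> {- real N..<real N}"
  have [measurable]: "?Q \<in> sets (borel \<Otimes>\<^sub>M borel)" by simp
  have fQ: "emeasure lborel ?Q < \<infinity>" by (simp add: emeasure_lborel_Times ennreal_mult_less_top)
  have "E \<in> sigma_sets UNIV {a \<times> b | a b. a \<in> sets (borel :: real measure) \<and> b \<in> sets (borel :: real measure)}"
    using assms unfolding borel_prod[symmetric] sets_pair_measure by simp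
  note E = this
  have G: "{a \<times> b | a b. a \<in> sets (borel :: real measure) \<and> b \<in> sets (borel :: real measure)} \<subseteq> Pow UNIV" by simp
  from Int_stable_pair_measure_generator[of "borel :: real measure" "borel :: real measure"] G E show ?thesis
  proof (induction rule: sigma_sets_induct_disjoint)
    case (basic A)
    then obtain a b where "A = a \<times> b" "a \<in> sets borel" "b \<in> sets borel" by auto
    thus ?case using approximable_rectangle[of "a \<inter> {- real N..<real N}" "b \<inter> {- real N..<real N}" N] by (simp add: Times_Int_Times)
  next
    case empty
    thus ?case using approximable_0 by (simp add: indicator_def[abs_def])
  next
    case (compl A)
    have "approximable (\<lambda>x. indicator ?Q x - indicator (A \<inter> ?Q) x)"
      by (intro approximable_diff compl approximable_rectangle) auto
    moreover have "(\<lambda>x. indicator ?Q x - indicator (A \<inter> ?Q) x) = (indicator ((UNIV - A) \<inter> ?Q) :: _ \<Rightarrow> real)"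
      by (auto simp: indicator_def)
    ultimately show ?case by simp
  next
    case (union A)
    have "A i \<in> sets (borel \<Otimes>\<^sub>M borel)" for i using union(2) unfolding sets_pair_measure by auto
    hence [measurable]: "A i \<in> sets borel" for i unfolding borel_prod .
    have [measurable]: "?Q \<in> sets borel" using \<open>?Q \<in> sets (borel \<Otimes>\<^sub>M borel)\<close> unfolding borel_prod .
    have s: "(\<Sum>i<n. indicator (A i \<inter> ?Q) x) = (indicator ((\<Union>i<n. A i) \<inter> ?Q) x :: real)" for n x
    proof -
      have dis: "disjoint_family_on (\<lambda>i. A i \<inter> ?Q) {..<n}" using union(1) by (auto simp: disjoint_family_on_def)
      have "indicator (\<Union>i<n. A i \<inter> ?Q) x = (\<Sum>i<n. indicator (A i \<inter> ?Q) x :: real)"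
        by (rule indicator_UN_disjoint[OF _ dis]) simp
      thus ?thesis by (simp add: UN_extend_simps(4) del: UN_simps)
    qed
    show ?case
    proof (rule approximable_LIMSEQ[where G="\<lambda>n x. \<Sum>i<n. indicator (A i \<inter> ?Q) x"])
      show "approximable (\<lambda>x. \<Sum>i<n. indicator (A i \<inter> ?Q) x)" for n by (intro approximable_sum union)
      show "(\<lambda>n. sq_norm lborel (\<lambda>x. (\<Sum>i<n. indicator (A i \<inter> ?Q) x) - indicator ((\<Union>i. A i) \<inter> ?Q) x)) \<longlonglongrightarrow> 0"
        unfolding s
      proof (rule sq_norm_dominated_convergence[where H="indicator ?Q"])
        show "sq_norm lborel (indicator ?Q) < \<infinity>"
        proof -
          have "sq_norm lborel (indicator ?Q) = (\<integral>\<^sup>+x. indicator ?Q x \<partial>lborel)"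
            unfolding sq_norm_def by (intro nn_integral_cong) (auto simp: indicator_def)
          thus ?thesis using fQ by simp
        qed
        fix x
        show "(\<lambda>n. indicator ((\<Union>i<n. A i) \<inter> ?Q) x :: real) \<longlonglongrightarrow> indicator ((\<Union>i. A i) \<inter> ?Q) x"
        proof (cases "x \<in> (\<Union>i. A i)")
          case True
          then obtain i where i: "x \<in> A i" by auto
          have "eventually (\<lambda>n. indicator ((\<Union>i<n. A i) \<inter> ?Q) x = (indicator ((\<Union>i. A i) \<inter> ?Q) x :: real)) sequentially"
            using eventually_gt_at_top[of i] by eventually_elim (use i in \<open>auto simp: indicator_def\<close>)
          thus ?thesis by (simp add: tendsto_eventually)
        qed (auto simp: indicator_def)
      qed (auto simp: indicator_def intro!: borel_measurable_indicator)
    qed measurable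
  qed
qed

text \<open>Simple functions dominated by 2|F| are cut off to boxes growing with the same index;
  each is a finite combination of indicators of bounded sets.\<close>

lemma approximable_square_integrable:
  assumes [measurable]: "F \<in> borel_measurable borel" and fin: "sq_norm lborel F < \<infinity>"
  shows "approximable F"
proof -
  obtain s where s: "\<And>i. simple_function lborel (s i)" "\<And>x. (\<lambda>i. s i x) \<longlonglongrightarrow> F x" "\<And>i x. \<bar>s i x\<bar> \<le> 2 * \<bar>F x\<bar>"
    using borel_measurable_implies_sequence_metric[of F lborel 0] by (auto simp: dist_real_def)
  let ?Q = "\<lambda>N::nat. {- real N..<real N} \<times> {- real N..<real N}"
  have Q[measurable]: "?Q N \<in> sets borel" for N by (simp add: borel_prod[symmetric])
  have [measurable]: "s i \<in> borel_measurable borel" for i using borel_measurable_simple_function[OF s(1)] by simp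
  show ?thesis
  proof (rule approximable_LIMSEQ[where G="\<lambda>i x. s i x * indicator (?Q i) x"])
    fix i
    have "approximable (\<lambda>x. \<Sum>y\<in>range (s i). y * indicator (s i -` {y} \<inter> ?Q i) x)"
    proof (intro approximable_sum approximable_scale approximable_bounded_set)
      fix y show "s i -` {y} \<in> sets borel" using measurable_sets[of "s i" borel borel "{y}"] by simp
    qed
    moreover have "(\<Sum>y\<in>range (s i). y * indicator (s i -` {y} \<inter> ?Q i) x) = s i x * indicator (?Q i) x" for x
    proof -
      have "(\<Sum>y\<in>range (s i). y * indicator (s i -` {y} \<inter> ?Q i) x) = (\<Sum>y\<in>range (s i). if y = s i x then y * indicator (?Q i) x else 0)"
        by (intro sum.cong refl) (auto simp: indicator_def)
      thus ?thesis using s(1)[of i] by (simp add: simple_function_def)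
    qed
    ultimately show "approximable (\<lambda>x. s i x * indicator (?Q i) x)" by simp
  next
    show "(\<lambda>i. sq_norm lborel (\<lambda>x. s i x * indicator (?Q i) x - F x)) \<longlonglongrightarrow> 0"
    proof (rule sq_norm_dominated_convergence[where H="\<lambda>x. 2 * \<bar>F x\<bar>"])
      show "sq_norm lborel (\<lambda>x. 2 * \<bar>F x\<bar>) < \<infinity>"
        using fin by (subst sq_norm_scale) (auto simp: sq_norm_def ennreal_mult_less_top)
      show "\<bar>s n x * indicator (?Q n) x\<bar> \<le> 2 * \<bar>F x\<bar>" for n x
        using s(3)[of n x] by (auto simp: indicator_def)
      fix x :: "real \<times> real"
      obtain k :: nat where k: "\<bar>fst x\<bar> < k" "\<bar>snd x\<bar> < k"
        using reals_Archimedean2[of "max \<bar>fst x\<bar> \<bar>snd x\<bar>"] by auto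
      have "eventually (\<lambda>n. s n x * indicator (?Q n) x = s n x) sequentially"
        using eventually_ge_at_top[of k]
      proof eventually_elim
        case (elim n)
        hence "real k \<le> real n" by simp
        with k have "x \<in> ?Q n" by (cases x) (simp, linarith)
        thus ?case by simp
      qed
      from tendsto_cong[OF this] s(2)[of x] show "(\<lambda>n. s n x * indicator (?Q n) x) \<longlonglongrightarrow> F x" by blast
    qed measurable
  qed measurable
qed

section \<open>Existence, scaling and continuity of the double integral\<close>

lemma double_integral_exists:
  assumes [measurable]: "F \<in> borel_measurable borel" and "sq_norm lborel F < \<infinity>"
  shows "has_double_integral M B F (double_integral M B F)"
proof -
  have "\<exists>n A a. offdiag_step n A a \<and> sq_norm lborel (\<lambda>x. step_fun n A a x - F x) \<le> ennreal ((1/4)^k)" for k :: nat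
    using approximable_square_integrable[OF assms] unfolding approximable_def by simp
  then obtain n A a where a: "\<And>k. offdiag_step (n k) (A k) (a k)"
      "\<And>k. sq_norm lborel (\<lambda>x. step_fun (n k) (A k) (a k) x - F x) \<le> ennreal ((1/4)^k)" by metis
  have [measurable]: "step_fun (n k) (A k) (a k) \<in> borel_measurable borel"
    "step_integral B (n k) (A k) (a k) \<in> borel_measurable M" for k using a by (auto intro: step_fun_measurable step_integral_measurable)
  \<comment> \<open>8 = 2 * (2 + 2): the second moment bound and the triangle inequality through
    \<open>F\<close>, where the later error is also at most (1/4)^k.\<close>
  have cauchy: "sq_norm M (\<lambda>\<omega>. step_integral B (n k) (A k) (a k) \<omega> - step_integral B (n m) (A m) (a m) \<omega>) \<le> ennreal (8 * (1/4)^k)"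
    if "k \<le> m" for k m
  proof -
    have "sq_norm M (\<lambda>\<omega>. step_integral B (n k) (A k) (a k) \<omega> - step_integral B (n m) (A m) (a m) \<omega>)
      \<le> 2 * sq_norm lborel (\<lambda>x. step_fun (n k) (A k) (a k) x - step_fun (n m) (A m) (a m) x)"
      using step_integral_diff_le[OF a(1) a(1)] by (simp add: sq_norm_def)
    also have "\<dots> \<le> 2 * (2 * sq_norm lborel (\<lambda>x. step_fun (n k) (A k) (a k) x - F x) + 2 * sq_norm lborel (\<lambda>x. F x - step_fun (n m) (A m) (a m) x))"
      by (intro mult_left_mono sq_norm_triangle) auto
    also have "\<dots> \<le> 2 * (2 * ennreal ((1/4)^k) + 2 * ennreal ((1/4)^k))"
    proof -
      have "sq_norm lborel (\<lambda>x. step_fun (n m) (A m) (a m) x - F x) \<le> ennreal ((1/4)^k)"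
        by (rule order_trans[OF a(2)]) (use that in \<open>auto intro!: ennreal_leI power_decreasing\<close>)
      thus ?thesis unfolding sq_norm_commute[of _ F] by (intro mult_left_mono add_mono a(2)) auto
    qed
    also have "\<dots> = ennreal (8 * (1/4)^k)"
      by (simp add: distrib_right[symmetric] ennreal_mult mult.assoc[symmetric])
    finally show ?thesis .
  qed
  obtain X where X: "X \<in> borel_measurable M" "(\<lambda>k. sq_norm M (\<lambda>\<omega>. step_integral B (n k) (A k) (a k) \<omega> - X \<omega>)) \<longlonglongrightarrow> 0"
    by (rule L2_complete[OF _ cauchy]) auto
  have "(\<lambda>k. (1/4::real)^k) \<longlonglongrightarrow> 0" by (intro LIMSEQ_power_zero) simp
  hence "(\<lambda>k. ennreal ((1/4)^k)) \<longlonglongrightarrow> 0" using tendsto_ennrealI by fastforce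
  hence "(\<lambda>k. sq_norm lborel (\<lambda>x. step_fun (n k) (A k) (a k) x - F x)) \<longlonglongrightarrow> 0"
    by (rule tendsto_sandwich[OF _ _ tendsto_const, rotated 2]) (auto simp: a(2))
  hence "has_double_integral M B F X" unfolding has_double_integral_def
    using X a(1) unfolding sq_norm_def by auto
  thus ?thesis unfolding double_integral_def by (rule someI[of "has_double_integral M B F"])
qed

lemma has_double_integral_scale:
  assumes "has_double_integral M B F X"
  shows "has_double_integral M B (\<lambda>x. c * F x) (\<lambda>\<omega>. c * X \<omega>)"
proof -
  from assms obtain n A a where a: "\<And>k. offdiag_step (n k) (A k) (a k)"
     "(\<lambda>k. sq_norm lborel (\<lambda>x. step_fun (n k) (A k) (a k) x - F x)) \<longlonglongrightarrow> 0"
     "(\<lambda>k. sq_norm M (\<lambda>\<omega>. step_integral B (n k) (A k) (a k) \<omega> - X \<omega>)) \<longlonglongrightarrow> 0"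
    and [measurable]: "F \<in> borel_measurable borel" "X \<in> borel_measurable M"
    unfolding has_double_integral_def sq_norm_def by auto
  have [measurable]: "step_fun (n k) (A k) (a k) \<in> borel_measurable borel"
    "step_integral B (n k) (A k) (a k) \<in> borel_measurable M" for k using a by (auto intro: step_fun_measurable step_integral_measurable)
  have "sq_norm lborel (\<lambda>x. step_fun (n k) (A k) (\<lambda>i j. c * a k i j) x - c * F x)
      = ennreal (c\<^sup>2) * sq_norm lborel (\<lambda>x. step_fun (n k) (A k) (a k) x - F x)" for k
    by (subst sq_norm_scale[symmetric]) (auto simp: step_fun_scale right_diff_distrib)
  moreover have "sq_norm M (\<lambda>x. step_integral B (n k) (A k) (\<lambda>i j. c * a k i j) x - c * X x)
      = ennreal (c\<^sup>2) * sq_norm M (\<lambda>x. step_integral B (n k) (A k) (a k) x - X x)" for k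
    by (subst sq_norm_scale[symmetric]) (auto simp: step_integral_scale right_diff_distrib)
  moreover have "(\<lambda>k. ennreal (c\<^sup>2) * sq_norm lborel (\<lambda>x. step_fun (n k) (A k) (a k) x - F x)) \<longlonglongrightarrow> 0"
    using ennreal_tendsto_cmult[OF _ a(2), of "ennreal (c\<^sup>2)"] by simp
  moreover have "(\<lambda>k. ennreal (c\<^sup>2) * sq_norm M (\<lambda>x. step_integral B (n k) (A k) (a k) x - X x)) \<longlonglongrightarrow> 0"
    using ennreal_tendsto_cmult[OF _ a(3), of "ennreal (c\<^sup>2)"] by simp
  ultimately have "(\<lambda>k. sq_norm lborel (\<lambda>x. step_fun (n k) (A k) (\<lambda>i j. c * a k i j) x - c * F x)) \<longlonglongrightarrow> 0"
    "(\<lambda>k. sq_norm M (\<lambda>x. step_integral B (n k) (A k) (\<lambda>i j. c * a k i j) x - c * X x)) \<longlonglongrightarrow> 0" by simp_all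
  thus ?thesis unfolding has_double_integral_def sq_norm_def
    using offdiag_step_scale[OF a(1)] by (auto intro!: exI[of _ n] exI[of _ A] exI[of _ "\<lambda>k i j. c * a k i j"])
qed

text \<open>Holds for every version \<open>X\<close>; apart from measurability, this is all that the
  comparison with Z1 Z2 uses about \<open>X\<close>. The 8 is 2 * 2 * 2: triangle inequality on
  \<open>M\<close>, second moment bound, triangle inequality on the plane.\<close>

lemma step_integral_dist_le:
  assumes "has_double_integral M B F X" and s: "offdiag_step m C c"
  shows "sq_norm M (\<lambda>\<omega>. step_integral B m C c \<omega> - X \<omega>) \<le> 8 * sq_norm lborel (\<lambda>x. step_fun m C c x - F x)"
proof -
  from assms obtain n A a where a: "\<And>k. offdiag_step (n k) (A k) (a k)"
     "(\<lambda>k. sq_norm lborel (\<lambda>x. step_fun (n k) (A k) (a k) x - F x)) \<longlonglongrightarrow> 0"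
     "(\<lambda>k. sq_norm M (\<lambda>\<omega>. step_integral B (n k) (A k) (a k) \<omega> - X \<omega>)) \<longlonglongrightarrow> 0"
    and [measurable]: "F \<in> borel_measurable borel" "X \<in> borel_measurable M"
    unfolding has_double_integral_def sq_norm_def by auto
  note [measurable] = step_fun_measurable[OF s] step_integral_measurable[OF s]
  have [measurable]: "step_fun (n k) (A k) (a k) \<in> borel_measurable borel"
    "step_integral B (n k) (A k) (a k) \<in> borel_measurable M" for k using a by (auto intro: step_fun_measurable step_integral_measurable)
  define P where "P k = sq_norm lborel (\<lambda>x. step_fun (n k) (A k) (a k) x - F x)" for k
  define Q where "Q k = sq_norm M (\<lambda>\<omega>. step_integral B (n k) (A k) (a k) \<omega> - X \<omega>)" for k
  let ?L = "sq_norm lborel (\<lambda>x. step_fun m C c x - F x)"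
  have le: "sq_norm M (\<lambda>\<omega>. step_integral B m C c \<omega> - X \<omega>) \<le> 2 * (2 * (2 * ?L + 2 * P k)) + 2 * Q k" for k
  proof -
    have "sq_norm M (\<lambda>\<omega>. step_integral B m C c \<omega> - X \<omega>) \<le> 2 * sq_norm M (\<lambda>\<omega>. step_integral B m C c \<omega> - step_integral B (n k) (A k) (a k) \<omega>) + 2 * Q k"
      unfolding Q_def by (rule sq_norm_triangle) measurable
    also have "\<dots> \<le> 2 * (2 * sq_norm lborel (\<lambda>x. step_fun m C c x - step_fun (n k) (A k) (a k) x)) + 2 * Q k"
      using step_integral_diff_le[OF s a(1)] by (intro add_mono mult_left_mono) (auto simp: sq_norm_def)
    also have "\<dots> \<le> 2 * (2 * (2 * ?L + 2 * P k)) + 2 * Q k"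
      unfolding P_def sq_norm_commute[of _ "step_fun (n k) (A k) (a k)" F]
      by (intro add_mono mult_left_mono sq_norm_triangle order_refl) auto
    finally show ?thesis .
  qed
  have "(\<lambda>k. 2 * (2 * (2 * ?L + 2 * P k)) + 2 * Q k) \<longlonglongrightarrow> 2 * (2 * (2 * ?L + 2 * 0)) + 2 * 0"
    using a(2,3) unfolding P_def[symmetric] Q_def[symmetric] by (intro tendsto_add ennreal_tendsto_cmult tendsto_const) auto
  from LIMSEQ_le_const[OF this] le show ?thesis by (auto simp: mult.assoc[symmetric])
qed

end

section \<open>Independence from characteristic functions\<close>

text \<open>Normalising \<open>w\<close> gives a new probability measure. By \<open>char\<close> the
  law of \<open>U\<close> has the same characteristic function under it as under \<open>M\<close>,
  so the two laws agree.\<close>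

lemma (in prob_space) expectation_weighted_indicator:
  fixes U w :: "'a \<Rightarrow> real"
  assumes [measurable]: "U \<in> borel_measurable M" "w \<in> borel_measurable M"
    and w: "\<And>\<omega>. 0 \<le> w \<omega>" "\<And>\<omega>. w \<omega> \<le> b" and c: "expectation w = c" "c > 0"
    and char: "\<And>s. (\<integral>\<omega>. iexp (s * U \<omega>) * of_real (w \<omega>) \<partial>M) = c * (\<integral>\<omega>. iexp (s * U \<omega>) \<partial>M)"
    and A[measurable]: "A \<in> sets borel"
  shows "expectation (\<lambda>\<omega>. indicat_real A (U \<omega>) * w \<omega>) = c * expectation (\<lambda>\<omega>. indicat_real A (U \<omega>))"
proof -
  have iw: "integrable M w" using w by (intro integrable_const_bound[of _ b]) auto
  define N where "N = density M (\<lambda>\<omega>. ennreal (w \<omega> / c))"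
  have "emeasure N (space N) = (\<integral>\<^sup>+\<omega>. ennreal (w \<omega> / c) \<partial>M)" unfolding N_def by (simp add: emeasure_density cong: nn_integral_cong)
  also have "\<dots> = ennreal (\<integral>\<omega>. w \<omega> / c \<partial>M)" using iw w c by (intro nn_integral_eq_integral) auto
  also have "\<dots> = 1" using c by simp
  finally interpret N: prob_space N by (rule prob_spaceI)
  have [measurable]: "U \<in> borel_measurable N" by (simp add: N_def)
  have "distr N borel U = distr M borel U"
  proof (rule Levy_uniqueness)
    show "real_distribution (distr N borel U)" by (rule N.real_distribution_distr) simp
    show "real_distribution (distr M borel U)" by (rule real_distribution_distr) simp
    show "char (distr N borel U) = char (distr M borel U)"
    proof
      fix s
      have "char (distr N borel U) s = (\<integral>\<omega>. iexp (s * U \<omega>) \<partial>N)" unfolding char_def by (subst integral_distr) auto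
      also have "\<dots> = (\<integral>\<omega>. (w \<omega> / c) *\<^sub>R iexp (s * U \<omega>) \<partial>M)" unfolding N_def using w c by (subst integral_density) auto
      also have "\<dots> = (\<integral>\<omega>. (1 / c) *\<^sub>R (iexp (s * U \<omega>) * of_real (w \<omega>)) \<partial>M)"
        by (intro Bochner_Integration.integral_cong refl) (simp add: scaleR_conv_of_real)
      also have "\<dots> = (1 / c) *\<^sub>R (\<integral>\<omega>. iexp (s * U \<omega>) * of_real (w \<omega>) \<partial>M)" by (rule integral_scaleR_right)
      also have "\<dots> = (\<integral>\<omega>. iexp (s * U \<omega>) \<partial>M)" unfolding char using c by (simp add: scaleR_conv_of_real)
      also have "\<dots> = char (distr M borel U) s" unfolding char_def by (subst integral_distr) auto
      finally show "char (distr N borel U) s = char (distr M borel U) s" .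
    qed
  qed
  hence "(\<integral>x. indicator A x \<partial>distr N borel U) = (\<integral>x. indicator A x \<partial>distr M borel U :: real)" by simp
  hence "(\<integral>\<omega>. indicat_real A (U \<omega>) \<partial>N :: real) = expectation (\<lambda>\<omega>. indicat_real A (U \<omega>))"
    using integral_distr[of U N borel "\<lambda>x. indicator A x :: real"] integral_distr[of U M borel "\<lambda>x. indicator A x :: real"] by simp
  moreover have "(\<integral>\<omega>. indicat_real A (U \<omega>) \<partial>N) = (\<integral>\<omega>. (w \<omega> / c) *\<^sub>R indicat_real A (U \<omega>) \<partial>M :: real)"
    unfolding N_def using w c by (subst integral_density) auto
  moreover have "(\<integral>\<omega>. (w \<omega> / c) *\<^sub>R indicat_real A (U \<omega>) \<partial>M :: real) = (1 / c) * expectation (\<lambda>\<omega>. indicat_real A (U \<omega>) * w \<omega>)"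
    by (subst integral_mult_right_zero[symmetric]) (auto intro!: Bochner_Integration.integral_cong)
  ultimately show ?thesis using c by (simp add: field_simps)
qed

lemma (in prob_space) integrable_iexp_bounded:
  fixes U w :: "'a \<Rightarrow> real"
  assumes [measurable]: "U \<in> borel_measurable M" "w \<in> borel_measurable M" and "\<And>\<omega>. \<bar>w \<omega>\<bar> \<le> b"
  shows "integrable M (\<lambda>\<omega>. iexp (U \<omega>) * of_real (w \<omega>))"
  using assms(3) by (intro integrable_const_bound[of _ b]) (auto simp: norm_mult)

text \<open>Kac's criterion. Weighting the law of \<open>U\<close> by \<open>2 + cos (t W)\<close> and \<open>2 + sin (t W)\<close>, and then
  the law of \<open>W\<close> by the indicator of \<open>U \<in> A\<close>, reduces it to uniqueness for characteristic
  functions of one variable.\<close>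

lemma (in prob_space) indep_var_of_char:
  fixes U W :: "'a \<Rightarrow> real"
  assumes [measurable]: "U \<in> borel_measurable M" "W \<in> borel_measurable M"
    and char: "\<And>s t. (\<integral>\<omega>. iexp (s * U \<omega> + t * W \<omega>) \<partial>M) = (\<integral>\<omega>. iexp (s * U \<omega>) \<partial>M) * (\<integral>\<omega>. iexp (t * W \<omega>) \<partial>M)"
  shows "indep_var borel U borel W"
proof -
  have i1 [simp]: "integrable M (\<lambda>\<omega>. iexp (X \<omega>))" if [measurable]: "X \<in> borel_measurable M" for X :: "'a \<Rightarrow> real"
    by (intro integrable_const_bound[of _ 1]) auto
  have ii [simp]: "integrable M (\<lambda>\<omega>. cos (t * W \<omega>))" "integrable M (\<lambda>\<omega>. sin (t * W \<omega>))" for t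
    by (intro integrable_const_bound[of _ 1]; simp)+
  have cosE: "complex_of_real (cos x) = (iexp x + iexp (- x)) / 2" for x
    by (simp add: cos_of_real[symmetric] cos_exp_eq)
  have sinE: "complex_of_real (sin x) = (iexp x - iexp (- x)) / (2 * \<i>)" for x
    by (simp add: sin_of_real[symmetric] sin_exp_eq)
  have iexp_add: "iexp (x + y) = iexp x * iexp y" for x y by (simp add: distrib_left exp_add)
  have ccos: "(\<integral>\<omega>. iexp (s * U \<omega>) * of_real (cos (t * W \<omega>)) \<partial>M) = (\<integral>\<omega>. iexp (s * U \<omega>) \<partial>M) * of_real (expectation (\<lambda>\<omega>. cos (t * W \<omega>)))" for s t
  proof -
    have "(\<integral>\<omega>. iexp (s * U \<omega>) * of_real (cos (t * W \<omega>)) \<partial>M) = (\<integral>\<omega>. (iexp (s * U \<omega> + t * W \<omega>) + iexp (s * U \<omega> + (- t) * W \<omega>)) / 2 \<partial>M)"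
      unfolding iexp_add cosE by (intro Bochner_Integration.integral_cong refl) (simp add: algebra_simps)
    also have "\<dots> = ((\<integral>\<omega>. iexp (s * U \<omega> + t * W \<omega>) \<partial>M) + (\<integral>\<omega>. iexp (s * U \<omega> + (- t) * W \<omega>) \<partial>M)) / 2"
      by (subst Bochner_Integration.integral_divide_zero, subst Bochner_Integration.integral_add) (auto intro!: i1 simp del: of_real_add of_real_mult of_real_minus of_real_diff)
    also have "\<dots> = (\<integral>\<omega>. iexp (s * U \<omega>) \<partial>M) * (((\<integral>\<omega>. iexp (t * W \<omega>) \<partial>M) + (\<integral>\<omega>. iexp ((- t) * W \<omega>) \<partial>M)) / 2)"
      unfolding char by (simp add: algebra_simps)
    also have "((\<integral>\<omega>. iexp (t * W \<omega>) \<partial>M) + (\<integral>\<omega>. iexp ((- t) * W \<omega>) \<partial>M)) / 2 = (\<integral>\<omega>. (iexp (t * W \<omega>) + iexp ((- t) * W \<omega>)) / 2 \<partial>M)"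
      by (subst Bochner_Integration.integral_divide_zero, subst Bochner_Integration.integral_add) (auto intro!: i1 simp del: of_real_add of_real_mult of_real_minus of_real_diff)
    also have "\<dots> = (\<integral>\<omega>. complex_of_real (cos (t * W \<omega>)) \<partial>M)" unfolding cosE by simp
    finally show ?thesis by simp
  qed
  have csin: "(\<integral>\<omega>. iexp (s * U \<omega>) * of_real (sin (t * W \<omega>)) \<partial>M) = (\<integral>\<omega>. iexp (s * U \<omega>) \<partial>M) * of_real (expectation (\<lambda>\<omega>. sin (t * W \<omega>)))" for s t
  proof -
    have "(\<integral>\<omega>. iexp (s * U \<omega>) * of_real (sin (t * W \<omega>)) \<partial>M) = (\<integral>\<omega>. (iexp (s * U \<omega> + t * W \<omega>) - iexp (s * U \<omega> + (- t) * W \<omega>)) / (2 * \<i>) \<partial>M)"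
      unfolding iexp_add sinE by (intro Bochner_Integration.integral_cong refl) (simp add: algebra_simps)
    also have "\<dots> = ((\<integral>\<omega>. iexp (s * U \<omega> + t * W \<omega>) \<partial>M) - (\<integral>\<omega>. iexp (s * U \<omega> + (- t) * W \<omega>) \<partial>M)) / (2 * \<i>)"
      by (subst Bochner_Integration.integral_divide_zero, subst Bochner_Integration.integral_diff) (auto intro!: i1 simp del: of_real_add of_real_mult of_real_minus of_real_diff)
    also have "\<dots> = (\<integral>\<omega>. iexp (s * U \<omega>) \<partial>M) * (((\<integral>\<omega>. iexp (t * W \<omega>) \<partial>M) - (\<integral>\<omega>. iexp ((- t) * W \<omega>) \<partial>M)) / (2 * \<i>))"
      unfolding char by (simp add: algebra_simps)
    also have "((\<integral>\<omega>. iexp (t * W \<omega>) \<partial>M) - (\<integral>\<omega>. iexp ((- t) * W \<omega>) \<partial>M)) / (2 * \<i>) = (\<integral>\<omega>. (iexp (t * W \<omega>) - iexp ((- t) * W \<omega>)) / (2 * \<i>) \<partial>M)"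
      by (subst Bochner_Integration.integral_divide_zero, subst Bochner_Integration.integral_diff) (auto intro!: i1 simp del: of_real_add of_real_mult of_real_minus of_real_diff)
    also have "\<dots> = (\<integral>\<omega>. complex_of_real (sin (t * W \<omega>)) \<partial>M)" unfolding sinE by simp
    finally show ?thesis by simp
  qed
  \<comment> \<open>\<open>f\<close> stands for cos or sin. The shift by 2 makes it a nonnegative
    weight and is subtracted again at the end.\<close>
  have step: "expectation (\<lambda>\<omega>. indicat_real A (U \<omega>) * f (t * W \<omega>)) = expectation (\<lambda>\<omega>. f (t * W \<omega>)) * expectation (\<lambda>\<omega>. indicat_real A (U \<omega>))"
    if [measurable]: "A \<in> sets borel" "f \<in> borel_measurable borel" and f: "\<And>x. \<bar>f x\<bar> \<le> 1"
      and cf: "\<And>s. (\<integral>\<omega>. iexp (s * U \<omega>) * of_real (f (t * W \<omega>)) \<partial>M) = (\<integral>\<omega>. iexp (s * U \<omega>) \<partial>M) * of_real (expectation (\<lambda>\<omega>. f (t * W \<omega>)))"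
    for A t and f :: "real \<Rightarrow> real"
  proof -
    have int: "integrable M (\<lambda>\<omega>. f (t * W \<omega>))" using f by (intro integrable_const_bound[of _ 1]) auto
    have int2: "integrable M (\<lambda>\<omega>. indicat_real A (U \<omega>) * f (t * W \<omega>))"
      using f by (intro integrable_const_bound[of _ 1]) (auto simp: indicator_def)
    have int3: "integrable M (\<lambda>\<omega>. indicat_real A (U \<omega>) :: real)"
      by (intro integrable_const_bound[of _ 1]) (auto simp: indicator_def)
    have f2: "0 \<le> 2 + f x" "2 + f x \<le> 3" for x using f[of x] by linarith+
    define c where "c = expectation (\<lambda>\<omega>. 2 + f (t * W \<omega>))"
    have c2: "c = 2 + expectation (\<lambda>\<omega>. f (t * W \<omega>))" unfolding c_def using int by (simp add: prob_space)
    have "\<bar>expectation (\<lambda>\<omega>. f (t * W \<omega>))\<bar> \<le> expectation (\<lambda>\<omega>. 1)"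
      using int f by (intro order_trans[OF integral_abs_bound] integral_mono) auto
    hence "c > 0" unfolding c2 by (simp add: prob_space)
    have ch: "(\<integral>\<omega>. iexp (s * U \<omega>) * of_real (2 + f (t * W \<omega>)) \<partial>M) = of_real c * (\<integral>\<omega>. iexp (s * U \<omega>) \<partial>M)" for s
    proof -
      have "(\<integral>\<omega>. iexp (s * U \<omega>) * of_real (2 + f (t * W \<omega>)) \<partial>M) = (\<integral>\<omega>. 2 * iexp (s * U \<omega>) + iexp (s * U \<omega>) * of_real (f (t * W \<omega>)) \<partial>M)"
        by (intro Bochner_Integration.integral_cong refl) (simp add: algebra_simps)
      also have "\<dots> = 2 * (\<integral>\<omega>. iexp (s * U \<omega>) \<partial>M) + (\<integral>\<omega>. iexp (s * U \<omega>) * of_real (f (t * W \<omega>)) \<partial>M)"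
      proof -
        have "integrable M (\<lambda>\<omega>. iexp (s * U \<omega>))" by (rule i1) measurable
        moreover have "integrable M (\<lambda>\<omega>. iexp (s * U \<omega>) * of_real (f (t * W \<omega>)))"
          by (rule integrable_iexp_bounded[OF _ _ f]) measurable
        ultimately show ?thesis by (subst Bochner_Integration.integral_add) (simp_all del: of_real_mult)
      qed
      also have "\<dots> = of_real c * (\<integral>\<omega>. iexp (s * U \<omega>) \<partial>M)" unfolding cf c2 by (simp add: algebra_simps)
      finally show ?thesis .
    qed
    have "expectation (\<lambda>\<omega>. indicat_real A (U \<omega>) * (2 + f (t * W \<omega>))) = c * expectation (\<lambda>\<omega>. indicat_real A (U \<omega>))"
      by (rule expectation_weighted_indicator[OF _ _ f2 c_def[symmetric] \<open>c > 0\<close> ch]) auto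
    moreover have "expectation (\<lambda>\<omega>. indicat_real A (U \<omega>) * (2 + f (t * W \<omega>))) = 2 * expectation (\<lambda>\<omega>. indicat_real A (U \<omega>)) + expectation (\<lambda>\<omega>. indicat_real A (U \<omega>) * f (t * W \<omega>))"
      using int2 int3 by (simp add: distrib_left mult.commute[of _ 2])
    ultimately show ?thesis unfolding c2 by (simp add: algebra_simps)
  qed
  have indicat: "expectation (\<lambda>\<omega>. indicat_real C (W \<omega>) * indicat_real A (U \<omega>)) = expectation (\<lambda>\<omega>. indicat_real A (U \<omega>)) * expectation (\<lambda>\<omega>. indicat_real C (W \<omega>))"
    if A[measurable]: "A \<in> sets borel" and C[measurable]: "C \<in> sets borel" for A C
  proof (cases "expectation (\<lambda>\<omega>. indicat_real A (U \<omega>) :: real) = 0")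
    \<comment> \<open>An event of probability 0 cannot be normalised to a weight; here both sides
      vanish.\<close>
    case True
    have int3: "integrable M (\<lambda>\<omega>. indicat_real A (U \<omega>) :: real)"
      by (intro integrable_const_bound[of _ 1]) (auto simp: indicator_def)
    have int4: "integrable M (\<lambda>\<omega>. indicat_real C (W \<omega>) * indicat_real A (U \<omega>) :: real)"
      by (intro integrable_const_bound[of _ 1]) (auto simp: indicator_def)
    have "expectation (\<lambda>\<omega>. indicat_real C (W \<omega>) * indicat_real A (U \<omega>)) \<le> expectation (\<lambda>\<omega>. indicat_real A (U \<omega>))"
      by (rule integral_mono[OF int4 int3]) (auto simp: indicator_def)
    moreover have "0 \<le> expectation (\<lambda>\<omega>. indicat_real C (W \<omega>) * indicat_real A (U \<omega>) :: real)" by simp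
    ultimately show ?thesis using True by simp
  next
    case False
    define p where "p = expectation (\<lambda>\<omega>. indicat_real A (U \<omega>) :: real)"
    have "p \<ge> 0" by (simp add: p_def)
    hence p: "p > 0" using False[folded p_def] by simp
    have ch: "(\<integral>\<omega>. iexp (t * W \<omega>) * of_real (indicat_real A (U \<omega>)) \<partial>M) = of_real p * (\<integral>\<omega>. iexp (t * W \<omega>) \<partial>M)" for t
    proof -
      \<comment> \<open>Euler's formula reassembles the cosine and sine parts into the
        characteristic function of \<open>W\<close> weighted by the event that \<open>U\<close> lies
        in \<open>A\<close>.\<close>
      have cs: "iexp (t * W \<omega>) = of_real (cos (t * W \<omega>)) + \<i> * of_real (sin (t * W \<omega>))" for \<omega>
        unfolding exp_Euler cos_of_real sin_of_real ..
      have j: "integrable M (\<lambda>\<omega>. complex_of_real (indicat_real A (U \<omega>) * cos (t * W \<omega>)))" "integrable M (\<lambda>\<omega>. complex_of_real (indicat_real A (U \<omega>) * sin (t * W \<omega>)))"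
        by (intro integrable_const_bound[of _ 1]; simp add: indicator_def)+
      have "(\<integral>\<omega>. iexp (t * W \<omega>) * of_real (indicat_real A (U \<omega>)) \<partial>M)
        = (\<integral>\<omega>. of_real (indicat_real A (U \<omega>) * cos (t * W \<omega>)) + \<i> * of_real (indicat_real A (U \<omega>) * sin (t * W \<omega>)) \<partial>M)"
        unfolding cs by (intro Bochner_Integration.integral_cong refl) (simp add: algebra_simps)
      also have "\<dots> = of_real (expectation (\<lambda>\<omega>. indicat_real A (U \<omega>) * cos (t * W \<omega>))) + \<i> * of_real (expectation (\<lambda>\<omega>. indicat_real A (U \<omega>) * sin (t * W \<omega>)))"
        using j by (subst Bochner_Integration.integral_add) (auto simp del: of_real_mult)
      also have "\<dots> = of_real p * (of_real (expectation (\<lambda>\<omega>. cos (t * W \<omega>))) + \<i> * of_real (expectation (\<lambda>\<omega>. sin (t * W \<omega>))))"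
        using step[of A cos t, OF A _ _ ccos] step[of A sin t, OF A _ _ csin] by (simp add: p_def algebra_simps)
      also have "of_real (expectation (\<lambda>\<omega>. cos (t * W \<omega>))) + \<i> * of_real (expectation (\<lambda>\<omega>. sin (t * W \<omega>))) = (\<integral>\<omega>. iexp (t * W \<omega>) \<partial>M)"
        unfolding cs by (subst Bochner_Integration.integral_add) auto
      finally show ?thesis .
    qed
    show ?thesis unfolding p_def[symmetric]
      by (rule expectation_weighted_indicator[OF _ _ _ _ p_def[symmetric] p ch C, of 1]) (auto simp: indicator_def)
  qed
  have "distr M borel U \<Otimes>\<^sub>M distr M borel W = distr M (borel \<Otimes>\<^sub>M borel) (\<lambda>x. (U x, W x))"
  proof (rule pair_measure_eqI)
    show "sigma_finite_measure (distr M borel U)" "sigma_finite_measure (distr M borel W)"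
      by (auto intro!: prob_space_imp_sigma_finite prob_space_distr)
    fix A C assume "A \<in> sets (distr M borel U)" "C \<in> sets (distr M borel W)"
    hence [measurable]: "A \<in> sets borel" "C \<in> sets borel" by auto
    have "prob {\<omega>\<in>space M. U \<omega> \<in> A \<and> W \<omega> \<in> C} = prob {\<omega>\<in>space M. U \<omega> \<in> A} * prob {\<omega>\<in>space M. W \<omega> \<in> C}"
    proof -
      have "expectation (\<lambda>\<omega>. indicat_real A (U \<omega>)) = expectation (indicat_real {\<omega>\<in>space M. U \<omega> \<in> A})"
        by (rule Bochner_Integration.integral_cong) (auto split: split_indicator)
      moreover have "expectation (\<lambda>\<omega>. indicat_real C (W \<omega>)) = expectation (indicat_real {\<omega>\<in>space M. W \<omega> \<in> C})"
        by (rule Bochner_Integration.integral_cong) (auto split: split_indicator)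
      moreover have "expectation (\<lambda>\<omega>. indicat_real C (W \<omega>) * indicat_real A (U \<omega>)) = expectation (indicat_real {\<omega>\<in>space M. U \<omega> \<in> A \<and> W \<omega> \<in> C})"
        by (rule Bochner_Integration.integral_cong) (auto split: split_indicator)
      ultimately show ?thesis using indicat[of A C] by simp
    qed
    moreover have "U -` A \<inter> space M = {\<omega>\<in>space M. U \<omega> \<in> A}" "W -` C \<inter> space M = {\<omega>\<in>space M. W \<omega> \<in> C}"
      "(\<lambda>x. (U x, W x)) -` (A \<times> C) \<inter> space M = {\<omega>\<in>space M. U \<omega> \<in> A \<and> W \<omega> \<in> C}" by auto
    ultimately show "emeasure (distr M borel U) A * emeasure (distr M borel W) C = emeasure (distr M (borel \<Otimes>\<^sub>M borel) (\<lambda>x. (U x, W x))) (A \<times> C)"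
      by (simp add: emeasure_distr emeasure_eq_measure ennreal_mult)
  qed simp
  thus ?thesis by (simp add: indep_var_distribution_eq)
qed

lemma (in prob_space) char_std_normal:
  assumes "distributed M lborel Z std_normal_density"
  shows "(\<integral>\<omega>. iexp (t * Z \<omega>) \<partial>M) = of_real (exp (- t\<^sup>2 / 2))"
proof -
  have [measurable]: "Z \<in> borel_measurable M" using assms by (simp add: distributed_def)
  have "distr M borel Z = distr M lborel Z" by (rule distr_cong) auto
  also have "\<dots> = std_normal_distribution" using assms by (simp add: distributed_def)
  finally have "char (distr M borel Z) t = of_real (exp (- t\<^sup>2 / 2))" by (simp add: char_std_normal_distribution)
  thus ?thesis unfolding char_def by (subst (asm) integral_distr) auto
qed

text \<open>The factorised characteristic function gives independence, and each marginal is that of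
  a scaled standard normal, so (U, W) and (\<sigma> Z1, \<tau> Z2) have the same law. Working with
  characteristic functions instead of densities admits \<sigma> = 0 or \<tau> = 0.\<close>

lemma expectation_product_normal:
  fixes U W :: "'a \<Rightarrow> real" and Z1 Z2 :: "'b \<Rightarrow> real"
  assumes "prob_space M" "prob_space N"
    and [measurable]: "U \<in> borel_measurable M" "W \<in> borel_measurable M"
    and char: "\<And>s t. (\<integral>\<omega>. iexp (s * U \<omega> + t * W \<omega>) \<partial>M) = of_real (exp (- (s\<^sup>2 * \<sigma>\<^sup>2 + t\<^sup>2 * \<tau>\<^sup>2) / 2))"
    and Z: "distributed N lborel Z1 std_normal_density" "distributed N lborel Z2 std_normal_density"
    and ind: "prob_space.indep_var N borel Z1 borel Z2"
    and [measurable]: "h \<in> borel_measurable borel"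
  shows "(\<integral>\<omega>. h (U \<omega> * W \<omega>) \<partial>M) = (\<integral>\<omega>. h (\<sigma> * \<tau> * (Z1 \<omega> * Z2 \<omega>)) \<partial>N :: real)"
proof -
  interpret prob_space M by fact
  interpret N: prob_space N by fact
  have [measurable]: "Z1 \<in> borel_measurable N" "Z2 \<in> borel_measurable N" using Z by (simp_all add: distributed_def)
  have cU: "(\<integral>\<omega>. iexp (s * U \<omega>) \<partial>M) = of_real (exp (- (s\<^sup>2 * \<sigma>\<^sup>2) / 2))" for s using char[of s 0] by simp
  have cW: "(\<integral>\<omega>. iexp (t * W \<omega>) \<partial>M) = of_real (exp (- (t\<^sup>2 * \<tau>\<^sup>2) / 2))" for t using char[of 0 t] by simp
  have "indep_var borel U borel W"
  proof (rule indep_var_of_char)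
    fix s t
    have "exp (- (s\<^sup>2 * \<sigma>\<^sup>2 + t\<^sup>2 * \<tau>\<^sup>2) / 2) = exp (- (s\<^sup>2 * \<sigma>\<^sup>2) / 2) * exp (- (t\<^sup>2 * \<tau>\<^sup>2) / 2)"
      by (simp add: exp_add[symmetric] add_divide_distrib diff_divide_distrib)
    thus "(\<integral>\<omega>. iexp (s * U \<omega> + t * W \<omega>) \<partial>M) = (\<integral>\<omega>. iexp (s * U \<omega>) \<partial>M) * (\<integral>\<omega>. iexp (t * W \<omega>) \<partial>M)"
      unfolding char cU cW by (simp only: of_real_mult)
  qed auto
  hence joint: "distr M (borel \<Otimes>\<^sub>M borel) (\<lambda>x. (U x, W x)) = distr M borel U \<Otimes>\<^sub>M distr M borel W"
    by (simp add: indep_var_distribution_eq)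
  have "N.indep_var borel ((\<lambda>x. \<sigma> * x) \<circ> Z1) borel ((\<lambda>x. \<tau> * x) \<circ> Z2)" by (rule N.indep_var_compose[OF ind]) auto
  hence joint': "distr N (borel \<Otimes>\<^sub>M borel) (\<lambda>x. (\<sigma> * Z1 x, \<tau> * Z2 x)) = distr N borel (\<lambda>x. \<sigma> * Z1 x) \<Otimes>\<^sub>M distr N borel (\<lambda>x. \<tau> * Z2 x)"
    by (simp add: N.indep_var_distribution_eq comp_def)
  have eq: "distr M borel X = distr N borel (\<lambda>x. r * Z x)"
    if [measurable]: "X \<in> borel_measurable M" and Z: "distributed N lborel Z std_normal_density"
      and c: "\<And>s. (\<integral>\<omega>. iexp (s * X \<omega>) \<partial>M) = of_real (exp (- (s\<^sup>2 * r\<^sup>2) / 2))" for X r and Z :: "'b \<Rightarrow> real"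
  proof (rule Levy_uniqueness)
    have [measurable]: "Z \<in> borel_measurable N" using Z by (simp add: distributed_def)
    show "real_distribution (distr M borel X)" by (rule real_distribution_distr) simp
    show "real_distribution (distr N borel (\<lambda>x. r * Z x))" by (rule N.real_distribution_distr) simp
    show "char (distr M borel X) = char (distr N borel (\<lambda>x. r * Z x))"
    proof
      fix s
      have "char (distr M borel X) s = (\<integral>\<omega>. iexp (s * X \<omega>) \<partial>M)" unfolding char_def by (subst integral_distr) auto
      also have "\<dots> = (\<integral>\<omega>. iexp (s * r * Z \<omega>) \<partial>N)" unfolding c N.char_std_normal[OF Z] by (simp add: power_mult_distrib)
      also have "\<dots> = char (distr N borel (\<lambda>x. r * Z x)) s" unfolding char_def by (subst integral_distr) (auto simp: mult.assoc)
      finally show "char (distr M borel X) s = char (distr N borel (\<lambda>x. r * Z x)) s" .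
    qed
  qed
  have "(\<integral>\<omega>. h (U \<omega> * W \<omega>) \<partial>M) = (\<integral>z. h (fst z * snd z) \<partial>distr M (borel \<Otimes>\<^sub>M borel) (\<lambda>x. (U x, W x)))"
    by (subst integral_distr) auto
  also have "\<dots> = (\<integral>z. h (fst z * snd z) \<partial>distr N (borel \<Otimes>\<^sub>M borel) (\<lambda>x. (\<sigma> * Z1 x, \<tau> * Z2 x)))"
    unfolding joint joint' using eq[OF _ Z(1) cU] eq[OF _ Z(2) cW] by simp
  also have "\<dots> = (\<integral>\<omega>. h (\<sigma> * Z1 \<omega> * (\<tau> * Z2 \<omega>)) \<partial>N)"
    by (subst integral_distr) auto
  finally show ?thesis by (simp add: mult_ac)
qed

section \<open>Products of Gaussian linear forms\<close>

lemma lipschitz_measurable: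
  fixes h :: "real \<Rightarrow> real"
  assumes "\<And>x y. \<bar>h x - h y\<bar> \<le> \<bar>x - y\<bar>"
  shows "h \<in> borel_measurable borel"
proof (rule borel_measurable_continuous_onI)
  have "1-lipschitz_on UNIV h" using assms by (intro lipschitz_onI) (auto simp: dist_real_def)
  thus "continuous_on UNIV h" by (rule lipschitz_on_continuous_on)
qed

text \<open>The coupling bound for the Wasserstein distance, for one test function. Integrability of
  \<open>h\<close> composed with an integrable variable comes from |h x| \<le> |h 0| + |x|.\<close>

lemma (in prob_space) lipschitz_expectation:
  fixes h :: "real \<Rightarrow> real"
  assumes h: "\<And>x y. \<bar>h x - h y\<bar> \<le> \<bar>x - y\<bar>" and X: "integrable M X" and Y: "integrable M Y"
  shows "\<bar>expectation (\<lambda>\<omega>. h (X \<omega>)) - expectation (\<lambda>\<omega>. h (Y \<omega>))\<bar> \<le> expectation (\<lambda>\<omega>. \<bar>X \<omega> - Y \<omega>\<bar>)"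
proof -
  have [measurable]: "h \<in> borel_measurable borel" by (rule lipschitz_measurable[OF h])
  have i: "integrable M (\<lambda>\<omega>. h (Z \<omega>))" if Z: "integrable M Z" for Z
  proof (rule Bochner_Integration.integrable_bound)
    show "integrable M (\<lambda>\<omega>. \<bar>h 0\<bar> + \<bar>Z \<omega>\<bar>)" using Z by auto
    have "\<bar>h x\<bar> \<le> \<bar>h 0\<bar> + \<bar>x\<bar>" for x using h[of x 0] by auto
    thus "AE \<omega> in M. norm (h (Z \<omega>)) \<le> norm (\<bar>h 0\<bar> + \<bar>Z \<omega>\<bar>)" by (auto intro!: AE_I2 intro: order_trans)
  qed (use Z in measurable)
  have "\<bar>expectation (\<lambda>\<omega>. h (X \<omega>)) - expectation (\<lambda>\<omega>. h (Y \<omega>))\<bar> = \<bar>expectation (\<lambda>\<omega>. h (X \<omega>) - h (Y \<omega>))\<bar>"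
    using i[OF X] i[OF Y] by simp
  also have "\<dots> \<le> expectation (\<lambda>\<omega>. \<bar>h (X \<omega>) - h (Y \<omega>)\<bar>)" by (rule integral_abs_bound)
  also have "\<dots> \<le> expectation (\<lambda>\<omega>. \<bar>X \<omega> - Y \<omega>\<bar>)" using X Y i[OF X] i[OF Y] h by (intro integral_mono) auto
  finally show ?thesis .
qed

text \<open>The second inequality is the nonnegativity of the variance of |X|.\<close>

lemma (in prob_space) expectation_abs_le_sq_norm:
  fixes X :: "'a \<Rightarrow> real"
  assumes [measurable]: "X \<in> borel_measurable M" and le: "sq_norm M X \<le> ennreal r" and r: "0 \<le> r"
  shows "integrable M X" "expectation (\<lambda>\<omega>. \<bar>X \<omega>\<bar>) \<le> sqrt r"
proof -
  have "sq_norm M X < \<infinity>" using le order_le_less_trans by fastforce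
  hence i2: "integrable M (\<lambda>\<omega>. (X \<omega>)\<^sup>2)" by (intro integrableI_nonneg) (auto simp: sq_norm_def)
  show i: "integrable M X" by (rule square_integrable_imp_integrable[OF _ i2]) measurable
  have "ennreal (expectation (\<lambda>\<omega>. (X \<omega>)\<^sup>2)) \<le> ennreal r"
    using le unfolding sq_norm_def by (subst (asm) nn_integral_eq_integral[OF i2]) auto
  hence "expectation (\<lambda>\<omega>. (X \<omega>)\<^sup>2) \<le> r" using r by (simp add: ennreal_le_iff)
  moreover have "variance (\<lambda>\<omega>. \<bar>X \<omega>\<bar>) = expectation (\<lambda>\<omega>. \<bar>X \<omega>\<bar>\<^sup>2) - (expectation (\<lambda>\<omega>. \<bar>X \<omega>\<bar>))\<^sup>2"
    using i i2 by (intro variance_eq) auto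
  moreover have "0 \<le> variance (\<lambda>\<omega>. \<bar>X \<omega>\<bar>)" by simp
  ultimately have "(expectation (\<lambda>\<omega>. \<bar>X \<omega>\<bar>))\<^sup>2 \<le> r" by simp
  thus "expectation (\<lambda>\<omega>. \<bar>X \<omega>\<bar>) \<le> sqrt r" by (rule real_le_rsqrt)
qed

locale std_normal_pair = prob_space N for N :: "'b measure" +
  fixes Z1 Z2 :: "'b \<Rightarrow> real"
  assumes Z1: "distributed N lborel Z1 std_normal_density"
    and Z2: "distributed N lborel Z2 std_normal_density"
    and indZ: "indep_var borel Z1 borel Z2"
begin

lemma Z_measurable [measurable]: "Z1 \<in> borel_measurable N" "Z2 \<in> borel_measurable N"
  using Z1 Z2 by (simp_all add: distributed_def)

lemma std_square:
  assumes "distributed N lborel Z std_normal_density"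
  shows "integrable N (\<lambda>\<omega>. (Z \<omega>)\<^sup>2)" "expectation (\<lambda>\<omega>. (Z \<omega>)\<^sup>2) = 1"
proof -
  show "integrable N (\<lambda>\<omega>. (Z \<omega>)\<^sup>2)"
    using distributed_integrable[OF assms, of "\<lambda>x. x\<^sup>2"] integrable_normal_moment[of 1 0 2] by simp
  show "expectation (\<lambda>\<omega>. (Z \<omega>)\<^sup>2) = 1"
    using standard_normal_distributed_variance[OF assms] standard_normal_distributed_expectation[OF assms] by simp
qed

lemma product_integrable: "integrable N (\<lambda>\<omega>. Z1 \<omega> * Z2 \<omega>)"
  by (rule integrable_mult_squares) (auto intro: std_square Z1 Z2)

lemma expectation_abs_product: "expectation (\<lambda>\<omega>. \<bar>Z1 \<omega> * Z2 \<omega>\<bar>) \<le> 1"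
proof -
  have "expectation (\<lambda>\<omega>. \<bar>Z1 \<omega> * Z2 \<omega>\<bar>) \<le> expectation (\<lambda>\<omega>. ((Z1 \<omega>)\<^sup>2 + (Z2 \<omega>)\<^sup>2) / 2)"
  proof (intro integral_mono)
    fix \<omega>
    have "0 \<le> (\<bar>Z1 \<omega>\<bar> - \<bar>Z2 \<omega>\<bar>)\<^sup>2" by simp
    thus "\<bar>Z1 \<omega> * Z2 \<omega>\<bar> \<le> ((Z1 \<omega>)\<^sup>2 + (Z2 \<omega>)\<^sup>2) / 2" by (simp add: power2_diff abs_mult)
  qed (use product_integrable std_square[OF Z1] std_square[OF Z2] in auto)
  also have "\<dots> = 1" using std_square[OF Z1] std_square[OF Z2] by simp
  finally show ?thesis .
qed

lemma expectation_scaled_product: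
  fixes h :: "real \<Rightarrow> real"
  assumes h: "\<And>x y. \<bar>h x - h y\<bar> \<le> \<bar>x - y\<bar>"
  shows "\<bar>expectation (\<lambda>\<omega>. h (r * (Z1 \<omega> * Z2 \<omega>))) - expectation (\<lambda>\<omega>. h (Z1 \<omega> * Z2 \<omega>))\<bar> \<le> \<bar>r - 1\<bar>"
proof -
  have "\<bar>expectation (\<lambda>\<omega>. h (r * (Z1 \<omega> * Z2 \<omega>))) - expectation (\<lambda>\<omega>. h (Z1 \<omega> * Z2 \<omega>))\<bar>
    \<le> expectation (\<lambda>\<omega>. \<bar>r * (Z1 \<omega> * Z2 \<omega>) - Z1 \<omega> * Z2 \<omega>\<bar>)"
    using product_integrable by (intro lipschitz_expectation[OF h]) auto
  also have "(\<lambda>\<omega>. \<bar>r * (Z1 \<omega> * Z2 \<omega>) - Z1 \<omega> * Z2 \<omega>\<bar>) = (\<lambda>\<omega>. \<bar>r - 1\<bar> * \<bar>Z1 \<omega> * Z2 \<omega>\<bar>)"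
    by (auto simp: abs_mult[symmetric] algebra_simps)
  also have "expectation \<dots> = \<bar>r - 1\<bar> * expectation (\<lambda>\<omega>. \<bar>Z1 \<omega> * Z2 \<omega>\<bar>)" by simp
  also have "\<dots> \<le> \<bar>r - 1\<bar> * 1" by (intro mult_left_mono expectation_abs_product) auto
  finally show ?thesis by simp
qed

end

lemma abs_sqrt_diff_1: "0 \<le> x \<Longrightarrow> \<bar>sqrt x - 1\<bar> \<le> \<bar>x - 1\<bar>"
proof -
  assume x: "0 \<le> x"
  have "\<bar>x - 1\<bar> = \<bar>sqrt x - 1\<bar> * (sqrt x + 1)"
  proof -
    have "x - 1 = (sqrt x - 1) * (sqrt x + 1)" using x by (simp add: algebra_simps)
    thus ?thesis using x by (simp add: abs_mult)
  qed
  moreover have "\<bar>sqrt x - 1\<bar> * 1 \<le> \<bar>sqrt x - 1\<bar> * (sqrt x + 1)" using x by (intro mult_left_mono) auto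
  ultimately show ?thesis by simp
qed

context brownian_random_measure
begin

lemma char_B:
  assumes "A \<in> finite_borel"
  shows "(\<integral>\<omega>. iexp (t * B A \<omega>) \<partial>M) = of_real (exp (- (t\<^sup>2 * measure lborel A) / 2))"
proof (cases "measure lborel A > 0")
  case True
  hence s: "0 < sqrt (measure lborel A)" by simp
  have "distributed M lborel (\<lambda>x. (B A x - 0) / sqrt (measure lborel A)) std_normal_density"
    using normal_standard_normal_convert[OF s, of "B A" 0] normal[OF assms True] by simp
  from char_std_normal[OF this, of "t * sqrt (measure lborel A)"] show ?thesis
    using s by (simp add: power_mult_distrib)
next
  case False
  hence z: "measure lborel A = 0" by (simp add: zero_less_measure_iff)
  note [measurable] = measurable_B[OF assms]
  have "(\<integral>\<omega>. iexp (t * B A \<omega>) \<partial>M) = (\<integral>\<omega>. 1 \<partial>M)" using null[OF assms z] by (intro integral_cong_AE) auto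
  thus ?thesis using z by (simp add: prob_space)
qed

lemma char_linear:
  assumes "finite I" "disjoint_family_on D I" "D ` I \<subseteq> finite_borel"
  shows "(\<integral>\<omega>. iexp (\<Sum>i\<in>I. c i * B (D i) \<omega>) \<partial>M) = of_real (exp (- (\<Sum>i\<in>I. (c i)\<^sup>2 * measure lborel (D i)) / 2))"
proof -
  have [measurable]: "i \<in> I \<Longrightarrow> B (D i) \<in> borel_measurable M" for i using assms measurable_B by auto
  have ind: "indep_vars (\<lambda>_. borel) (\<lambda>i \<omega>. c i * B (D i) \<omega>) I"
    using indep_vars_compose2[OF indep_finite[OF assms], of "\<lambda>i x. c i * x" "\<lambda>_. borel"] by simp
  have "(\<integral>\<omega>. iexp (\<Sum>i\<in>I. c i * B (D i) \<omega>) \<partial>M) = char (distr M borel (\<lambda>\<omega>. \<Sum>i\<in>I. c i * B (D i) \<omega>)) 1"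
    unfolding char_def by (subst integral_distr) auto
  also have "\<dots> = (\<Prod>i\<in>I. char (distr M borel (\<lambda>\<omega>. c i * B (D i) \<omega>)) 1)" by (rule char_distr_sum[OF ind])
  also have "\<dots> = (\<Prod>i\<in>I. of_real (exp (- ((c i)\<^sup>2 * measure lborel (D i)) / 2)))"
  proof (rule prod.cong[OF refl])
    fix i assume i: "i \<in> I"
    have "char (distr M borel (\<lambda>\<omega>. c i * B (D i) \<omega>)) 1 = (\<integral>\<omega>. iexp (c i * B (D i) \<omega>) \<partial>M)"
      unfolding char_def using i by (subst integral_distr) auto
    also have "\<dots> = of_real (exp (- ((c i)\<^sup>2 * measure lborel (D i)) / 2))" using i assms(3) by (intro char_B) auto
    finally show "char (distr M borel (\<lambda>\<omega>. c i * B (D i) \<omega>)) 1 = of_real (exp (- ((c i)\<^sup>2 * measure lborel (D i)) / 2))" .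
  qed
  also have "\<dots> = of_real (exp (\<Sum>i\<in>I. - ((c i)\<^sup>2 * measure lborel (D i)) / 2))"
    using assms(1) by (simp add: exp_sum del: of_real_exp)
  also have "(\<Sum>i\<in>I. - ((c i)\<^sup>2 * measure lborel (D i)) / 2) = - (\<Sum>i\<in>I. (c i)\<^sup>2 * measure lborel (D i)) / 2"
    by (simp add: sum_divide_distrib sum_negf)
  finally show ?thesis .
qed

end

text \<open>One test function is fixed. The bounds proved in this locale do not involve
  \<open>h\<close>, so the supremum over test functions is taken only at the end.\<close>

locale white_noise_comparison = brownian_random_measure M B + N: std_normal_pair N Z1 Z2
  for M :: "'a measure" and B and N :: "'b measure" and Z1 Z2 +
  fixes h :: "real \<Rightarrow> real"
  assumes h: "\<And>x y. \<bar>h x - h y\<bar> \<le> \<bar>x - y\<bar>"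
begin

lemma h_measurable [measurable]: "h \<in> borel_measurable borel" by (rule lipschitz_measurable[OF h])

text \<open>Orthogonalising \<open>V\<close> against \<open>U\<close> gives an independent pair.\<close>

lemma gaussian_product_bound:
  fixes a b :: "'i \<Rightarrow> real"
  assumes D: "finite I" "disjoint_family_on D I" "D ` I \<subseteq> finite_borel"
  defines "U \<equiv> \<lambda>\<omega>. \<Sum>i\<in>I. a i * B (D i) \<omega>" and "V \<equiv> \<lambda>\<omega>. \<Sum>i\<in>I. b i * B (D i) \<omega>"
    and "\<alpha> \<equiv> \<Sum>i\<in>I. (a i)\<^sup>2 * measure lborel (D i)" and "\<beta> \<equiv> \<Sum>i\<in>I. (b i)\<^sup>2 * measure lborel (D i)"
    and "\<kappa> \<equiv> \<Sum>i\<in>I. a i * b i * measure lborel (D i)"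
  shows "\<bar>expectation (\<lambda>\<omega>. h (U \<omega> * V \<omega>)) - N.expectation (\<lambda>\<omega>. h (Z1 \<omega> * Z2 \<omega>))\<bar> \<le> \<bar>\<kappa>\<bar> + \<bar>\<alpha> * \<beta> - 1\<bar> + \<kappa>\<^sup>2"
proof -
  interpret F: orthogonal_family M "\<lambda>i. B (D i)" I by (rule family[OF D])
  define \<mu> where "\<mu> i = measure lborel (D i)" for i
  have \<mu>: "\<mu> i \<ge> 0" for i by (simp add: \<mu>_def)
  have EB: "expectation (\<lambda>\<omega>. (B (D i) \<omega>)\<^sup>2) = \<mu> i" if "i \<in> I" for i using B_moments(3) D that by (auto simp: \<mu>_def)
  have \<alpha>0: "\<alpha> \<ge> 0" unfolding \<alpha>_def by (intro sum_nonneg) auto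
  \<comment> \<open>If U has variance 0, the quotient \<open>\<kappa> / \<alpha>\<close> below is 0
    by convention, and \<open>\<rho> * \<alpha> = \<kappa>\<close> still holds because \<kappa> = 0
    as well.\<close>
  have \<kappa>0: "\<kappa> = 0" if "\<alpha> = 0"
  proof -
    have "(a i)\<^sup>2 * \<mu> i = 0" if "i \<in> I" for i
      using \<open>\<alpha> = 0\<close> D(1) that unfolding \<alpha>_def \<mu>_def by (subst (asm) sum_nonneg_eq_0_iff) auto
    thus ?thesis unfolding \<kappa>_def \<mu>_def[symmetric] by (intro sum.neutral) auto
  qed
  define \<rho> where "\<rho> = \<kappa> / \<alpha>"
  have \<rho>\<alpha>: "\<rho> * \<alpha> = \<kappa>" using \<kappa>0 by (simp add: \<rho>_def)
  define w where "w i = b i - \<rho> * a i" for i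
  define W where "W \<omega> = (\<Sum>i\<in>I. w i * B (D i) \<omega>)" for \<omega>
  have WV: "W \<omega> = V \<omega> - \<rho> * U \<omega>" for \<omega>
    unfolding W_def V_def U_def w_def by (simp add: left_diff_distrib sum_subtractf sum_distrib_left mult.assoc)
  define \<tau>2 where "\<tau>2 = (\<Sum>i\<in>I. (w i)\<^sup>2 * \<mu> i)"
  have \<tau>0: "\<tau>2 \<ge> 0" unfolding \<tau>2_def by (intro sum_nonneg) (auto simp: \<mu>)
  have "\<tau>2 = (\<Sum>i\<in>I. (b i)\<^sup>2 * \<mu> i - 2 * \<rho> * (a i * b i * \<mu> i) + \<rho>\<^sup>2 * ((a i)\<^sup>2 * \<mu> i))"
    unfolding \<tau>2_def w_def by (intro sum.cong refl) (simp add: power2_eq_square algebra_simps)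
  also have "\<dots> = \<beta> - 2 * \<rho> * \<kappa> + \<rho>\<^sup>2 * \<alpha>"
    unfolding \<alpha>_def \<beta>_def \<kappa>_def \<mu>_def[symmetric] by (simp add: sum.distrib sum_subtractf sum_distrib_left)
  also have "\<rho>\<^sup>2 * \<alpha> = \<rho> * \<kappa>" using \<rho>\<alpha> by (simp add: power2_eq_square)
  finally have \<tau>2: "\<tau>2 = \<beta> - \<rho> * \<kappa>" by simp
  have prod: "\<alpha> * \<tau>2 = \<alpha> * \<beta> - \<kappa>\<^sup>2" unfolding \<tau>2 using \<rho>\<alpha> by (simp add: power2_eq_square algebra_simps)
  have orth: "(\<Sum>i\<in>I. a i * w i * \<mu> i) = 0"
  proof -
    have "(\<Sum>i\<in>I. a i * w i * \<mu> i) = (\<Sum>i\<in>I. a i * b i * \<mu> i - \<rho> * ((a i)\<^sup>2 * \<mu> i))"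
      unfolding w_def by (intro sum.cong refl) (simp add: power2_eq_square algebra_simps)
    also have "\<dots> = \<kappa> - \<rho> * \<alpha>" unfolding \<alpha>_def \<kappa>_def \<mu>_def[symmetric] by (simp add: sum_subtractf sum_distrib_left)
    finally show ?thesis using \<rho>\<alpha> by simp
  qed
  have U[measurable]: "U \<in> borel_measurable M" and U2: "integrable M (\<lambda>\<omega>. (U \<omega>)\<^sup>2)" "expectation (\<lambda>\<omega>. (U \<omega>)\<^sup>2) = \<alpha>"
    unfolding U_def \<alpha>_def using F.linear_bound[OF order_refl, of a] EB by (auto simp: \<mu>_def)
  have V[measurable]: "V \<in> borel_measurable M" and V2: "integrable M (\<lambda>\<omega>. (V \<omega>)\<^sup>2)"
    unfolding V_def using F.linear_bound[OF order_refl, of b] by auto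
  have W[measurable]: "W \<in> borel_measurable M" and W2: "integrable M (\<lambda>\<omega>. (W \<omega>)\<^sup>2)"
    unfolding W_def[abs_def] using F.linear_bound[OF order_refl, of w] by auto
  \<comment> \<open>By \<open>orth\<close> the variance of s U + t W has no cross term; this is what
    makes the pair independent.\<close>
  have char: "(\<integral>\<omega>. iexp (s * U \<omega> + t * W \<omega>) \<partial>M) = of_real (exp (- (s\<^sup>2 * (sqrt \<alpha>)\<^sup>2 + t\<^sup>2 * (sqrt \<tau>2)\<^sup>2) / 2))" for s t
  proof -
    have e1: "s * U \<omega> + t * W \<omega> = (\<Sum>i\<in>I. (s * a i + t * w i) * B (D i) \<omega>)" for \<omega>
      unfolding U_def W_def by (simp add: sum_distrib_left distrib_right sum.distrib mult.assoc)
    have "(\<Sum>i\<in>I. (s * a i + t * w i)\<^sup>2 * \<mu> i) = (\<Sum>i\<in>I. s\<^sup>2 * ((a i)\<^sup>2 * \<mu> i) + 2 * s * t * (a i * w i * \<mu> i) + t\<^sup>2 * ((w i)\<^sup>2 * \<mu> i))"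
      by (intro sum.cong refl) (simp add: power2_eq_square algebra_simps)
    also have "\<dots> = s\<^sup>2 * \<alpha> + 2 * s * t * (\<Sum>i\<in>I. a i * w i * \<mu> i) + t\<^sup>2 * \<tau>2"
      unfolding \<alpha>_def \<tau>2_def \<mu>_def[symmetric] by (simp add: sum.distrib sum_distrib_left)
    finally have "(\<Sum>i\<in>I. (s * a i + t * w i)\<^sup>2 * \<mu> i) = s\<^sup>2 * (sqrt \<alpha>)\<^sup>2 + t\<^sup>2 * (sqrt \<tau>2)\<^sup>2"
      using orth \<alpha>0 \<tau>0 by simp
    thus ?thesis unfolding e1 char_linear[OF D] \<mu>_def by simp
  qed
  have "prob_space M" "prob_space N" by unfold_locales
  from expectation_product_normal[OF this U W char N.Z1 N.Z2 N.indZ h_measurable]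
  have eq: "expectation (\<lambda>\<omega>. h (U \<omega> * W \<omega>)) = N.expectation (\<lambda>\<omega>. h (sqrt \<alpha> * sqrt \<tau>2 * (Z1 \<omega> * Z2 \<omega>)))" .
  \<comment> \<open>Replacing V by W costs |\<rho>| E(U^2) = |\<rho>| \<alpha> = |\<kappa>|.\<close>
  have "\<bar>expectation (\<lambda>\<omega>. h (U \<omega> * V \<omega>)) - expectation (\<lambda>\<omega>. h (U \<omega> * W \<omega>))\<bar> \<le> expectation (\<lambda>\<omega>. \<bar>U \<omega> * V \<omega> - U \<omega> * W \<omega>\<bar>)"
    by (intro lipschitz_expectation[OF h] integrable_mult_squares U2 V2 W2) auto
  also have "(\<lambda>\<omega>. \<bar>U \<omega> * V \<omega> - U \<omega> * W \<omega>\<bar>) = (\<lambda>\<omega>. \<bar>\<rho>\<bar> * (U \<omega>)\<^sup>2)"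
  proof
    fix \<omega>
    have "U \<omega> * V \<omega> - U \<omega> * W \<omega> = \<rho> * (U \<omega>)\<^sup>2" by (simp add: WV power2_eq_square algebra_simps)
    thus "\<bar>U \<omega> * V \<omega> - U \<omega> * W \<omega>\<bar> = \<bar>\<rho>\<bar> * (U \<omega>)\<^sup>2" by (simp add: abs_mult)
  qed
  also have "expectation \<dots> = \<bar>\<kappa>\<bar>" using U2(2) \<alpha>0 by (simp add: \<rho>\<alpha>[symmetric] abs_mult)
  finally have 1: "\<bar>expectation (\<lambda>\<omega>. h (U \<omega> * V \<omega>)) - expectation (\<lambda>\<omega>. h (U \<omega> * W \<omega>))\<bar> \<le> \<bar>\<kappa>\<bar>" .
  have "\<bar>expectation (\<lambda>\<omega>. h (U \<omega> * W \<omega>)) - N.expectation (\<lambda>\<omega>. h (Z1 \<omega> * Z2 \<omega>))\<bar> \<le> \<bar>sqrt \<alpha> * sqrt \<tau>2 - 1\<bar>"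
    unfolding eq by (rule N.expectation_scaled_product[OF h])
  also have "\<dots> = \<bar>sqrt (\<alpha> * \<tau>2) - 1\<bar>" by (simp add: real_sqrt_mult)
  also have "\<dots> \<le> \<bar>\<alpha> * \<tau>2 - 1\<bar>" using \<alpha>0 \<tau>0 by (intro abs_sqrt_diff_1) auto
  \<comment> \<open>By \<open>prod\<close>, orthogonalising changes the product of the variances
    only by \<kappa>^2.\<close>
  also have "\<dots> \<le> \<bar>\<alpha> * \<beta> - 1\<bar> + \<kappa>\<^sup>2" unfolding prod using zero_le_power2[of \<kappa>] by linarith
  finally show ?thesis using 1 by linarith
qed

text \<open>Three replacements: \<open>X\<close> by the step integral of the symmetrised
  coefficients with erased diagonal, that integral by the product U V of linear forms, and U V by Z1
  Z2. Here \<delta>, the L^1 norm of f g, bounds the erased blocks in L^2, the mean of the diagonal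
  correction, and the covariance of U and V; the last two give \<open>2 * \<delta>\<close>.\<close>

lemma step_product_bound:
  fixes a b :: "'i \<Rightarrow> real"
  assumes D: "finite I" "disjoint_family_on D I" "D ` I \<subseteq> finite_borel"
  defines "\<alpha> \<equiv> \<Sum>i\<in>I. (a i)\<^sup>2 * measure lborel (D i)" and "\<beta> \<equiv> \<Sum>i\<in>I. (b i)\<^sup>2 * measure lborel (D i)"
    and "\<delta> \<equiv> \<Sum>i\<in>I. \<bar>a i * b i\<bar> * measure lborel (D i)"
    and "f \<equiv> \<lambda>x. \<Sum>i\<in>I. a i * indicator (D i) x" and "g \<equiv> \<lambda>x. \<Sum>i\<in>I. b i * indicator (D i) x"
  assumes X: "has_double_integral M B K X" and E: "E \<ge> 0"
    and le: "sq_norm lborel (\<lambda>z. (f (fst z) * g (snd z) + f (snd z) * g (fst z)) / 2 - K z) \<le> ennreal E"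
  shows "\<bar>expectation (\<lambda>\<omega>. h (X \<omega>)) - N.expectation (\<lambda>\<omega>. h (Z1 \<omega> * Z2 \<omega>))\<bar>
    \<le> sqrt (16 * \<delta>\<^sup>2 + 16 * E) + 2 * \<delta> + \<bar>\<alpha> * \<beta> - 1\<bar> + \<delta>\<^sup>2"
proof -
  interpret F: orthogonal_family M "\<lambda>i. B (D i)" I by (rule family[OF D])
  define \<mu> where "\<mu> i = measure lborel (D i)" for i
  have \<mu>: "\<mu> i \<ge> 0" for i by (simp add: \<mu>_def)
  have EB: "expectation (\<lambda>\<omega>. (B (D i) \<omega>)\<^sup>2) = \<mu> i" "integrable M (\<lambda>\<omega>. (B (D i) \<omega>)\<^sup>2)" if "i \<in> I" for i
    using B_moments D that by (auto simp: \<mu>_def)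
  have [measurable]: "K \<in> borel_measurable borel" "X \<in> borel_measurable M" using X by (auto simp: has_double_integral_def)
  have [measurable]: "i \<in> I \<Longrightarrow> D i \<in> sets borel" "i \<in> I \<Longrightarrow> B (D i) \<in> borel_measurable M" for i
    using D(3) finite_borelD measurable_B by auto
  have [measurable]: "f \<in> borel_measurable borel" "g \<in> borel_measurable borel" unfolding f_def g_def by measurable
  define t where "t i j = (if i = j then 0 else (a i * b j + a j * b i) / 2)" for i j
  obtain n A c where c: "offdiag_step n A c"
    "\<And>x. step_fun n A c x = (\<Sum>i\<in>I. \<Sum>j\<in>I. t i j * indicator (D i \<times> D j) x)"
    "\<And>\<omega>. step_integral B n A c \<omega> = (\<Sum>i\<in>I. \<Sum>j\<in>I. t i j * B (D i) \<omega> * B (D j) \<omega>)"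
    by (rule offdiag_step_reindex[OF D, of t]) (auto simp: t_def)
  note [measurable] = step_fun_measurable[OF c(1)] step_integral_measurable[OF c(1)]
  \<comment> \<open>Used with indicators at the two coordinates, and with u = v given by the values
    of \<open>B\<close>, where the last sum is the diagonal correction.\<close>
  have alg: "(\<Sum>i\<in>I. \<Sum>j\<in>I. t i j * u i * v j) = ((\<Sum>i\<in>I. a i * u i) * (\<Sum>i\<in>I. b i * v i) + (\<Sum>i\<in>I. b i * u i) * (\<Sum>i\<in>I. a i * v i)) / 2
      - (\<Sum>i\<in>I. a i * b i * u i * v i)" for u v
  proof -
    have "((\<Sum>i\<in>I. a i * u i) * (\<Sum>i\<in>I. b i * v i) + (\<Sum>i\<in>I. b i * u i) * (\<Sum>i\<in>I. a i * v i)) / 2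
      = (\<Sum>i\<in>I. \<Sum>j\<in>I. (a i * b j + a j * b i) / 2 * u i * v j)"
      unfolding sum_product sum.distrib[symmetric] sum_divide_distrib
      by (intro sum.cong refl) (simp add: algebra_simps add_divide_distrib)
    also have "\<dots> = (\<Sum>i\<in>I. \<Sum>j\<in>I. t i j * u i * v j + (if i = j then a i * b i * u i * v i else 0))"
      by (intro sum.cong refl) (simp add: t_def)
    also have "\<dots> = (\<Sum>i\<in>I. \<Sum>j\<in>I. t i j * u i * v j) + (\<Sum>i\<in>I. a i * b i * u i * v i)"
      using D(1) by (simp add: sum.distrib)
    finally show ?thesis by linarith
  qed
  define sym where "sym z = (f (fst z) * g (snd z) + f (snd z) * g (fst z)) / 2" for z
  have [measurable]: "sym \<in> borel_measurable borel"
  proof -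
    have "sym \<in> borel_measurable (borel \<Otimes>\<^sub>M borel)" unfolding sym_def by measurable
    thus ?thesis unfolding borel_prod .
  qed
  have \<delta>0: "\<delta> \<ge> 0" unfolding \<delta>_def by (intro sum_nonneg) auto
  have sf: "step_fun n A c z - sym z = - (\<Sum>i\<in>I. \<Sum>j\<in>I. (if i = j then a i * b i else 0) * indicator (D i \<times> D j) z)" for z
  proof -
    have "step_fun n A c z = sym z - (\<Sum>i\<in>I. a i * b i * indicator (D i) (fst z) * indicator (D i) (snd z))"
      unfolding c(2) indicator_times mult.assoc[symmetric] alg sym_def f_def g_def by (simp add: mult.commute)
    moreover have "(\<Sum>i\<in>I. \<Sum>j\<in>I. (if i = j then a i * b i else 0) * indicator (D i \<times> D j) z)
      = (\<Sum>i\<in>I. \<Sum>j\<in>I. if i = j then a i * b i * indicator (D i) (fst z) * indicator (D i) (snd z) else 0)"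
      by (intro sum.cong refl) (auto simp: indicator_times)
    ultimately show ?thesis using D(1) by simp
  qed
  have "sq_norm lborel (\<lambda>z. step_fun n A c z - sym z)
      = ennreal (\<Sum>i\<in>I. \<Sum>j\<in>I. (if i = j then a i * b i else 0)\<^sup>2 * (measure lborel (D i) * measure lborel (D j)))"
    unfolding sf sq_norm_def power2_minus by (rule nn_integral_square_step[OF D])
  also have "(\<Sum>i\<in>I. \<Sum>j\<in>I. (if i = j then a i * b i else 0)\<^sup>2 * (measure lborel (D i) * measure lborel (D j))) = (\<Sum>i\<in>I. (\<bar>a i * b i\<bar> * \<mu> i)\<^sup>2)"
  proof (rule sum.cong[OF refl])
    fix i assume "i \<in> I"
    have "(\<Sum>j\<in>I. (if i = j then a i * b i else 0)\<^sup>2 * (measure lborel (D i) * measure lborel (D j)))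
      = (\<Sum>j\<in>I. if i = j then (\<bar>a i * b i\<bar> * \<mu> i)\<^sup>2 else 0)"
      by (intro sum.cong refl) (auto simp: \<mu>_def power_mult_distrib power2_eq_square)
    thus "(\<Sum>j\<in>I. (if i = j then a i * b i else 0)\<^sup>2 * (measure lborel (D i) * measure lborel (D j))) = (\<bar>a i * b i\<bar> * \<mu> i)\<^sup>2"
      using D(1) \<open>i \<in> I\<close> by simp
  qed
  also have "ennreal \<dots> \<le> ennreal (\<delta>\<^sup>2)"
  proof (rule ennreal_leI)
    \<comment> \<open>For nonnegative terms, the sum of the squares is at most the square of the
      sum.\<close>
    have "(\<Sum>i\<in>I. (\<bar>a i * b i\<bar> * \<mu> i)\<^sup>2) \<le> (\<Sum>i\<in>I. (\<bar>a i * b i\<bar> * \<mu> i) * \<delta>)"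
    proof (rule sum_mono)
      fix i assume "i \<in> I"
      have "\<bar>a i * b i\<bar> * \<mu> i \<le> \<delta>" unfolding \<delta>_def \<mu>_def[symmetric]
        by (rule member_le_sum[OF \<open>i \<in> I\<close>]) (auto simp: \<mu> D(1))
      thus "(\<bar>a i * b i\<bar> * \<mu> i)\<^sup>2 \<le> (\<bar>a i * b i\<bar> * \<mu> i) * \<delta>"
        unfolding power2_eq_square by (intro mult_left_mono) (auto simp: \<mu>)
    qed
    also have "\<dots> = \<delta>\<^sup>2" unfolding \<delta>_def \<mu>_def[symmetric] sum_distrib_right[symmetric] power2_eq_square ..
    finally show "(\<Sum>i\<in>I. (\<bar>a i * b i\<bar> * \<mu> i)\<^sup>2) \<le> \<delta>\<^sup>2" .
  qed
  finally have s1: "sq_norm lborel (\<lambda>z. step_fun n A c z - sym z) \<le> ennreal (\<delta>\<^sup>2)" .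
  have "sq_norm lborel (\<lambda>z. step_fun n A c z - K z) \<le> 2 * sq_norm lborel (\<lambda>z. step_fun n A c z - sym z) + 2 * sq_norm lborel (\<lambda>z. sym z - K z)"
    by (rule sq_norm_triangle) measurable
  also have "\<dots> \<le> 2 * ennreal (\<delta>\<^sup>2) + 2 * ennreal E"
    using le unfolding sym_def[symmetric] by (intro add_mono mult_left_mono s1) auto
  finally have s2: "sq_norm lborel (\<lambda>z. step_fun n A c z - K z) \<le> 2 * ennreal (\<delta>\<^sup>2) + 2 * ennreal E" .
  let ?S = "step_integral B n A c"
  \<comment> \<open>16 = 8 * 2, the 8 from \<open>step_integral_dist_le\<close> and the 2 from
    \<open>s2\<close>.\<close>
  define r where "r = 16 * \<delta>\<^sup>2 + 16 * E"
  have r0: "r \<ge> 0" using E by (simp add: r_def)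
  have "sq_norm M (\<lambda>\<omega>. ?S \<omega> - X \<omega>) \<le> 8 * (2 * ennreal (\<delta>\<^sup>2) + 2 * ennreal E)"
    by (rule order_trans[OF step_integral_dist_le[OF X c(1)]]) (intro mult_left_mono s2, simp)
  also have "\<dots> = ennreal r" using E by (simp add: r_def ennreal_plus ennreal_mult distrib_left mult.assoc[symmetric])
  finally have sr: "sq_norm M (\<lambda>\<omega>. ?S \<omega> - X \<omega>) \<le> ennreal r" .
  have SX: "integrable M (\<lambda>\<omega>. ?S \<omega> - X \<omega>)" "expectation (\<lambda>\<omega>. \<bar>?S \<omega> - X \<omega>\<bar>) \<le> sqrt r"
    by (rule expectation_abs_le_sq_norm[OF _ sr r0], measurable)+
  have iS: "integrable M ?S" unfolding c(3)[abs_def] mult.assoc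
    by (intro Bochner_Integration.integrable_sum integrable_mult_right integrable_mult_squares EB) auto
  have iX: "integrable M X" using Bochner_Integration.integrable_diff[OF iS SX(1)] by simp
  define U where "U \<omega> = (\<Sum>i\<in>I. a i * B (D i) \<omega>)" for \<omega>
  define V where "V \<omega> = (\<Sum>i\<in>I. b i * B (D i) \<omega>)" for \<omega>
  have S: "?S \<omega> = U \<omega> * V \<omega> - (\<Sum>i\<in>I. a i * b i * (B (D i) \<omega>)\<^sup>2)" for \<omega>
    unfolding c(3) alg U_def V_def by (simp add: power2_eq_square mult_ac)
  have iD: "integrable M (\<lambda>\<omega>. \<Sum>i\<in>I. a i * b i * (B (D i) \<omega>)\<^sup>2)" using EB by auto
  have iUV: "integrable M (\<lambda>\<omega>. U \<omega> * V \<omega>)"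
    using Bochner_Integration.integrable_add[OF iS iD] by (simp add: S)
  have "\<bar>expectation (\<lambda>\<omega>. h (?S \<omega>)) - expectation (\<lambda>\<omega>. h (X \<omega>))\<bar> \<le> sqrt r"
    by (rule order_trans[OF lipschitz_expectation[OF h iS iX] SX(2)])
  moreover have "\<bar>expectation (\<lambda>\<omega>. h (?S \<omega>)) - expectation (\<lambda>\<omega>. h (U \<omega> * V \<omega>))\<bar> \<le> \<delta>"
  proof -
    have "\<bar>expectation (\<lambda>\<omega>. h (?S \<omega>)) - expectation (\<lambda>\<omega>. h (U \<omega> * V \<omega>))\<bar> \<le> expectation (\<lambda>\<omega>. \<bar>?S \<omega> - U \<omega> * V \<omega>\<bar>)"
      by (rule lipschitz_expectation[OF h iS iUV])
    also have "\<dots> \<le> expectation (\<lambda>\<omega>. \<Sum>i\<in>I. \<bar>a i * b i\<bar> * (B (D i) \<omega>)\<^sup>2)"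
    proof (rule integral_mono)
      show "integrable M (\<lambda>\<omega>. \<bar>?S \<omega> - U \<omega> * V \<omega>\<bar>)" using iS iUV by auto
      show "integrable M (\<lambda>\<omega>. \<Sum>i\<in>I. \<bar>a i * b i\<bar> * (B (D i) \<omega>)\<^sup>2)" using EB by auto
      show "\<bar>?S \<omega> - U \<omega> * V \<omega>\<bar> \<le> (\<Sum>i\<in>I. \<bar>a i * b i\<bar> * (B (D i) \<omega>)\<^sup>2)" for \<omega>
        unfolding S by (simp, rule order_trans[OF sum_abs]) (simp add: abs_mult)
    qed
    also have "\<dots> = \<delta>" unfolding \<delta>_def using EB by (simp add: \<mu>_def)
    finally show ?thesis .
  qed
  moreover have "\<bar>expectation (\<lambda>\<omega>. h (U \<omega> * V \<omega>)) - N.expectation (\<lambda>\<omega>. h (Z1 \<omega> * Z2 \<omega>))\<bar> \<le> \<delta> + \<bar>\<alpha> * \<beta> - 1\<bar> + \<delta>\<^sup>2"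
  proof -
    define \<kappa> where "\<kappa> = (\<Sum>i\<in>I. a i * b i * measure lborel (D i))"
    have \<kappa>: "\<bar>\<kappa>\<bar> \<le> \<delta>" unfolding \<kappa>_def \<delta>_def by (rule order_trans[OF sum_abs]) (simp add: abs_mult)
    hence "\<kappa>\<^sup>2 \<le> \<delta>\<^sup>2" using abs_le_square_iff[of \<kappa> \<delta>] \<delta>0 by auto
    thus ?thesis using gaussian_product_bound[OF D, of a b] \<kappa>
      unfolding U_def V_def \<alpha>_def \<beta>_def \<kappa>_def[symmetric] by linarith
  qed
  ultimately show ?thesis unfolding r_def by linarith
qed

end

section \<open>Comparison for near-product kernels\<close>

lemma nn_integral_lborel_pair:
  fixes F :: "real \<times> real \<Rightarrow> ennreal"
  assumes "F \<in> borel_measurable borel"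
  shows "(\<integral>\<^sup>+z. F z \<partial>lborel) = (\<integral>\<^sup>+x. \<integral>\<^sup>+y. F (x, y) \<partial>lborel \<partial>lborel)"
proof -
  have "F \<in> borel_measurable (lborel \<Otimes>\<^sub>M lborel)" using assms by (simp add: lborel_prod)
  thus ?thesis unfolding lborel_prod[symmetric] by (subst lborel.nn_integral_fst) auto
qed

lemma sq_norm_tensor:
  fixes f g :: "real \<Rightarrow> real"
  assumes [measurable]: "f \<in> borel_measurable borel" "g \<in> borel_measurable borel"
  shows "sq_norm lborel (\<lambda>z. f (fst z) * g (snd z)) = sq_norm lborel f * sq_norm lborel g"
    "sq_norm lborel (\<lambda>z. f (snd z) * g (fst z)) = sq_norm lborel f * sq_norm lborel g"
proof -
  have m: "(\<lambda>z. ennreal ((f (fst z) * g (snd z))\<^sup>2)) \<in> borel_measurable borel"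
    "(\<lambda>z. ennreal ((f (snd z) * g (fst z))\<^sup>2)) \<in> borel_measurable borel"
    unfolding borel_prod[symmetric] by measurable
  show "sq_norm lborel (\<lambda>z. f (fst z) * g (snd z)) = sq_norm lborel f * sq_norm lborel g"
    unfolding sq_norm_def nn_integral_lborel_pair[OF m(1)]
    by (simp add: power_mult_distrib ennreal_mult nn_integral_cmult nn_integral_multc)
  show "sq_norm lborel (\<lambda>z. f (snd z) * g (fst z)) = sq_norm lborel f * sq_norm lborel g"
    unfolding sq_norm_def nn_integral_lborel_pair[OF m(2)]
    by (simp add: power_mult_distrib ennreal_mult nn_integral_cmult nn_integral_multc)
qed

lemma sq_norm_symmetrization_finite:
  fixes f g :: "real \<Rightarrow> real"
  assumes [measurable]: "f \<in> borel_measurable borel" "g \<in> borel_measurable borel"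
    and "sq_norm lborel f < \<infinity>" "sq_norm lborel g < \<infinity>"
  shows "sq_norm lborel (\<lambda>z. (f (fst z) * g (snd z) + f (snd z) * g (fst z)) / 2) < \<infinity>"
proof -
  have mm: "(\<lambda>z::real\<times>real. - f (snd z) * g (fst z)) \<in> borel_measurable borel" "(\<lambda>z::real\<times>real. f (fst z) * g (snd z)) \<in> borel_measurable borel"
    unfolding borel_prod[symmetric] by measurable
  have ms: "(\<lambda>z::real\<times>real. f (fst z) * g (snd z) + f (snd z) * g (fst z)) \<in> borel_measurable borel"
    unfolding borel_prod[symmetric] by measurable
  \<comment> \<open>The sum is written as a difference so that the squared triangle inequality
    applies.\<close>
  have "sq_norm lborel (\<lambda>z. f (fst z) * g (snd z) - (- f (snd z) * g (fst z)))
    \<le> 2 * sq_norm lborel (\<lambda>z. f (fst z) * g (snd z) - 0) + 2 * sq_norm lborel (\<lambda>z. 0 - (- f (snd z) * g (fst z)))"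
    using mm by (intro sq_norm_triangle) auto
  also have "\<dots> = 4 * (sq_norm lborel f * sq_norm lborel g)"
    using sq_norm_tensor[of f g] by (simp add: distrib_right[symmetric])
  also have "\<dots> < \<infinity>" using assms(3,4) by (simp add: ennreal_mult_less_top)
  finally have fin: "sq_norm lborel (\<lambda>z. f (fst z) * g (snd z) + f (snd z) * g (fst z)) < \<infinity>" by simp
  have "sq_norm lborel (\<lambda>z. (f (fst z) * g (snd z) + f (snd z) * g (fst z)) / 2)
    = sq_norm lborel (\<lambda>z. (1/2) * (f (fst z) * g (snd z) + f (snd z) * g (fst z)))" by simp
  also have "\<dots> = ennreal ((1/2)\<^sup>2) * sq_norm lborel (\<lambda>z. f (fst z) * g (snd z) + f (snd z) * g (fst z))"
    using ms by (intro sq_norm_scale) auto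
  also have "\<dots> < \<infinity>" using fin by (auto simp: ennreal_mult_less_top)
  finally show ?thesis .
qed

lemma nn_integral_step1:
  fixes \<phi> :: "'i \<Rightarrow> real"
  assumes "finite I" "D ` I \<subseteq> finite_borel" "\<And>i. i \<in> I \<Longrightarrow> 0 \<le> \<phi> i"
  shows "(\<integral>\<^sup>+x. ennreal (\<Sum>i\<in>I. \<phi> i * indicator (D i) x) \<partial>lborel) = ennreal (\<Sum>i\<in>I. \<phi> i * measure lborel (D i))"
proof -
  have [measurable]: "i \<in> I \<Longrightarrow> D i \<in> sets borel" for i using assms(2) finite_borelD by auto
  have "(\<integral>\<^sup>+x. ennreal (\<Sum>i\<in>I. \<phi> i * indicator (D i) x) \<partial>lborel) = (\<integral>\<^sup>+x. (\<Sum>i\<in>I. ennreal (\<phi> i) * indicator (D i) x) \<partial>lborel)"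
  proof (intro nn_integral_cong)
    fix x
    have "ennreal (\<phi> i) * indicator (D i) x = ennreal (\<phi> i * indicator (D i) x)" for i by (simp add: indicator_def)
    thus "ennreal (\<Sum>i\<in>I. \<phi> i * indicator (D i) x) = (\<Sum>i\<in>I. ennreal (\<phi> i) * indicator (D i) x)"
      using assms(3) by simp
  qed
  also have "\<dots> = (\<Sum>i\<in>I. ennreal (\<phi> i) * emeasure lborel (D i))"
    by (subst nn_integral_sum) (auto simp: nn_integral_cmult_indicator)
  also have "\<dots> = (\<Sum>i\<in>I. ennreal (\<phi> i * measure lborel (D i)))"
    using assms by (intro sum.cong refl) (auto simp: finite_borelD image_subset_iff ennreal_mult)
  finally show ?thesis using assms(3) by simp
qed

lemma sq_norm_tendsto:
  assumes [measurable]: "\<And>n. s n \<in> borel_measurable M" "f \<in> borel_measurable M"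
    and "sq_norm M f < \<infinity>" "\<And>n x. x \<in> space M \<Longrightarrow> \<bar>s n x\<bar> \<le> 2 * \<bar>f x\<bar>" "\<And>x. x \<in> space M \<Longrightarrow> (\<lambda>n. s n x) \<longlonglongrightarrow> f x"
  shows "(\<lambda>n. sq_norm M (s n)) \<longlonglongrightarrow> sq_norm M f"
  unfolding sq_norm_def
proof (rule nn_integral_dominated_convergence[where w="\<lambda>x. 4 * ennreal ((f x)\<^sup>2)"])
  show "AE x in M. ennreal ((s n x)\<^sup>2) \<le> 4 * ennreal ((f x)\<^sup>2)" for n
  proof (rule AE_I2)
    fix x assume x: "x \<in> space M"
    have "(s n x)\<^sup>2 \<le> (2 * \<bar>f x\<bar>)\<^sup>2" using assms(4)[OF x, of n] abs_le_square_iff[of "s n x" "2 * \<bar>f x\<bar>"] by auto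
    from ennreal_leI[OF this] show "ennreal ((s n x)\<^sup>2) \<le> 4 * ennreal ((f x)\<^sup>2)" by (simp add: power_mult_distrib ennreal_mult)
  qed
  show "(\<integral>\<^sup>+ x. 4 * ennreal ((f x)\<^sup>2) \<partial>M) < \<infinity>"
    using assms(3) by (simp add: nn_integral_cmult sq_norm_def ennreal_mult_less_top)
  show "AE x in M. (\<lambda>n. ennreal ((s n x)\<^sup>2)) \<longlonglongrightarrow> ennreal ((f x)\<^sup>2)"
    by (rule AE_I2) (intro tendsto_ennrealI tendsto_power assms(5))
qed measurable

context white_noise_comparison
begin

text \<open>The joint level sets of (s, r) serve as cells, so that both functions are step functions
  over the same disjoint family.\<close>

lemma simple_product_bound:
  fixes s r :: "real \<Rightarrow> real"
  assumes s: "simple_function lborel s" "sq_norm lborel s < \<infinity>"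
    and r: "simple_function lborel r" "sq_norm lborel r < \<infinity>"
    and d: "(\<integral>\<^sup>+x. ennreal \<bar>s x * r x\<bar> \<partial>lborel) \<le> ennreal d" "d \<ge> 0"
    and X: "has_double_integral M B K X" and E: "E \<ge> 0"
    and le: "sq_norm lborel (\<lambda>z. (s (fst z) * r (snd z) + s (snd z) * r (fst z)) / 2 - K z) \<le> ennreal E"
  shows "\<bar>expectation (\<lambda>\<omega>. h (X \<omega>)) - N.expectation (\<lambda>\<omega>. h (Z1 \<omega> * Z2 \<omega>))\<bar>
    \<le> sqrt (16 * d\<^sup>2 + 16 * E) + 2 * d + \<bar>enn2real (sq_norm lborel s) * enn2real (sq_norm lborel r) - 1\<bar> + d\<^sup>2"
proof -
  have [measurable]: "s \<in> borel_measurable borel" "r \<in> borel_measurable borel"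
    using borel_measurable_simple_function[OF s(1)] borel_measurable_simple_function[OF r(1)] by auto
  \<comment> \<open>The value (0, 0) is left out: its level set may have infinite measure, and it
    contributes nothing. On any other cell one of the two square integrable functions is a nonzero
    constant, which forces finite measure.\<close>
  define I where "I = (\<lambda>x. (s x, r x)) ` UNIV - {(0,0)}"
  define D where "D v = {x. s x = fst v \<and> r x = snd v}" for v
  have "finite (s ` UNIV \<times> r ` UNIV)" using s(1) r(1) by (auto simp: simple_function_def)
  hence fI: "finite I" unfolding I_def by (rule rev_finite_subset) auto
  have dD: "disjoint_family_on D I" by (auto simp: disjoint_family_on_def D_def prod_eq_iff)
  have Dm[measurable]: "D v \<in> sets borel" for v unfolding D_def by measurable
  have fin: "emeasure lborel A < \<infinity>" if A: "A \<in> sets borel" "\<And>x. x \<in> A \<Longrightarrow> u x = c" "c \<noteq> 0"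
      and u: "u \<in> borel_measurable borel" "sq_norm lborel u < \<infinity>" for A c and u :: "real \<Rightarrow> real"
  proof -
    have "ennreal (c\<^sup>2) * emeasure lborel A = (\<integral>\<^sup>+x. ennreal (c\<^sup>2) * indicator A x \<partial>lborel)"
      using A(1) by (simp add: nn_integral_cmult_indicator)
    also have "\<dots> \<le> sq_norm lborel u" unfolding sq_norm_def
      by (intro nn_integral_mono) (auto simp: indicator_def A(2))
    finally have "ennreal (c\<^sup>2) * emeasure lborel A < \<infinity>" using u(2) by (rule order_le_less_trans)
    thus ?thesis using A(3) by (auto simp: ennreal_mult_less_top)
  qed
  have fD: "D ` I \<subseteq> finite_borel"
  proof
    fix A assume "A \<in> D ` I"
    then obtain v where v: "v \<in> I" "A = D v" by auto
    hence "fst v \<noteq> 0 \<or> snd v \<noteq> 0" by (auto simp: I_def)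
    hence "emeasure lborel (D v) < \<infinity>"
    proof
      assume "fst v \<noteq> 0"
      thus ?thesis by (intro fin[of "D v" s "fst v"] s(2)) (simp_all add: D_def)
    next
      assume "snd v \<noteq> 0"
      thus ?thesis by (intro fin[of "D v" r "snd v"] r(2)) (simp_all add: D_def)
    qed
    thus "A \<in> finite_borel" using v by (simp add: finite_borel_def)
  qed
  have rep: "\<phi> (s x, r x) = (\<Sum>v\<in>I. \<phi> v * indicator (D v) x)" if "\<phi> (0,0) = 0" for \<phi> :: "real \<times> real \<Rightarrow> real" and x
  proof -
    have "(\<Sum>v\<in>I. \<phi> v * indicator (D v) x) = (\<Sum>v\<in>I. if v = (s x, r x) then \<phi> v else 0)"
      by (intro sum.cong refl) (auto simp: D_def indicator_def prod_eq_iff)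
    also have "\<dots> = \<phi> (s x, r x)" using fI that by (auto simp: I_def)
    finally show ?thesis ..
  qed
  have nn: "(\<integral>\<^sup>+x. ennreal (\<phi> (s x, r x)) \<partial>lborel) = ennreal (\<Sum>v\<in>I. \<phi> v * measure lborel (D v))"
    if "\<phi> (0,0) = 0" "\<And>v. 0 \<le> \<phi> v" for \<phi> :: "real \<times> real \<Rightarrow> real"
    unfolding rep[of \<phi>, OF that(1)] by (rule nn_integral_step1[OF fI fD that(2)])
  define \<delta> where "\<delta> = (\<Sum>v\<in>I. \<bar>fst v * snd v\<bar> * measure lborel (D v))"
  have \<delta>0: "\<delta> \<ge> 0" unfolding \<delta>_def by (intro sum_nonneg) auto
  have "ennreal \<delta> \<le> ennreal d" using nn[of "\<lambda>v. \<bar>fst v * snd v\<bar>"] d(1) by (simp add: \<delta>_def)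
  hence \<delta>: "\<delta> \<le> d" using d(2) by (simp add: ennreal_le_iff)
  have "\<delta>\<^sup>2 \<le> d\<^sup>2" using \<delta> \<delta>0 by (intro power_mono)
  have \<alpha>: "enn2real (sq_norm lborel s) = (\<Sum>v\<in>I. (fst v)\<^sup>2 * measure lborel (D v))"
    using nn[of "\<lambda>v. (fst v)\<^sup>2"] unfolding sq_norm_def by (simp add: sum_nonneg)
  have \<beta>: "enn2real (sq_norm lborel r) = (\<Sum>v\<in>I. (snd v)\<^sup>2 * measure lborel (D v))"
    using nn[of "\<lambda>v. (snd v)\<^sup>2"] unfolding sq_norm_def by (simp add: sum_nonneg)
  have s': "s x = (\<Sum>v\<in>I. fst v * indicator (D v) x)" and r': "r x = (\<Sum>v\<in>I. snd v * indicator (D v) x)" for x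
    using rep[of fst x] rep[of snd x] by auto
  have "\<bar>expectation (\<lambda>\<omega>. h (X \<omega>)) - N.expectation (\<lambda>\<omega>. h (Z1 \<omega> * Z2 \<omega>))\<bar>
    \<le> sqrt (16 * \<delta>\<^sup>2 + 16 * E) + 2 * \<delta> + \<bar>enn2real (sq_norm lborel s) * enn2real (sq_norm lborel r) - 1\<bar> + \<delta>\<^sup>2"
    unfolding \<alpha> \<beta> \<delta>_def
    by (rule step_product_bound[OF fI dD fD X E, where a=fst and b=snd, folded s' r', OF le])
  moreover have "sqrt (16 * \<delta>\<^sup>2 + 16 * E) \<le> sqrt (16 * d\<^sup>2 + 16 * E)" using \<open>\<delta>\<^sup>2 \<le> d\<^sup>2\<close> by (intro real_sqrt_le_mono) auto
  ultimately show ?thesis using \<delta> \<open>\<delta>\<^sup>2 \<le> d\<^sup>2\<close> by linarith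
qed

text \<open>The left side does not depend on the approximation, so the inequality for simple
  functions passes to the limit. Approximants bounded by 2|f| and 2|g| turn d into 4 d, hence 256 =
  16 * 16, 8 and 16; the triangle inequality through the symmetrised product doubles E, hence 32.
  The squared norms converge exactly, which keeps \<open>F * G\<close> sharp.\<close>

lemma double_integral_product_bound:
  fixes f g :: "real \<Rightarrow> real"
  assumes X: "has_double_integral M B K X"
    and [measurable]: "f \<in> borel_measurable borel" "g \<in> borel_measurable borel"
    and f: "sq_norm lborel f = ennreal F" "F \<ge> 0" and g: "sq_norm lborel g = ennreal G" "G \<ge> 0"
    and d: "(\<integral>\<^sup>+x. ennreal \<bar>f x * g x\<bar> \<partial>lborel) \<le> ennreal d" "d \<ge> 0"
    and E: "E \<ge> 0" "sq_norm lborel (\<lambda>z. (f (fst z) * g (snd z) + f (snd z) * g (fst z)) / 2 - K z) \<le> ennreal E"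
  shows "\<bar>expectation (\<lambda>\<omega>. h (X \<omega>)) - N.expectation (\<lambda>\<omega>. h (Z1 \<omega> * Z2 \<omega>))\<bar>
    \<le> sqrt (256 * d\<^sup>2 + 32 * E) + 8 * d + \<bar>F * G - 1\<bar> + 16 * d\<^sup>2" (is "?L \<le> _")
proof -
  have [measurable]: "K \<in> borel_measurable borel" using X by (auto simp: has_double_integral_def)
  obtain s where s: "\<And>i. simple_function lborel (s i)" "\<And>x. (\<lambda>i. s i x) \<longlonglongrightarrow> f x" "\<And>i x. \<bar>s i x\<bar> \<le> 2 * \<bar>f x\<bar>"
    using borel_measurable_implies_sequence_metric[of f lborel 0] by (auto simp: dist_real_def)
  obtain r where r: "\<And>i. simple_function lborel (r i)" "\<And>x. (\<lambda>i. r i x) \<longlonglongrightarrow> g x" "\<And>i x. \<bar>r i x\<bar> \<le> 2 * \<bar>g x\<bar>"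
    using borel_measurable_implies_sequence_metric[of g lborel 0] by (auto simp: dist_real_def)
  have [measurable]: "s i \<in> borel_measurable borel" "r i \<in> borel_measurable borel" for i
    using borel_measurable_simple_function[OF s(1)] borel_measurable_simple_function[OF r(1)] by auto
  have ff: "sq_norm lborel f < \<infinity>" "sq_norm lborel g < \<infinity>" using f g by auto
  have sf: "(\<lambda>n. sq_norm lborel (s n)) \<longlonglongrightarrow> ennreal F" unfolding f(1)[symmetric]
    by (rule sq_norm_tendsto[OF _ _ ff(1)]) (auto simp: s)
  have rf: "(\<lambda>n. sq_norm lborel (r n)) \<longlonglongrightarrow> ennreal G" unfolding g(1)[symmetric]
    by (rule sq_norm_tendsto[OF _ _ ff(2)]) (auto simp: r)
  define sym where "sym p q z = (p (fst z) * q (snd z) + p (snd z) * q (fst z)) / 2" for p q :: "real \<Rightarrow> real" and z :: "real \<times> real"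
  have symm: "sym p q \<in> borel_measurable borel" if [measurable]: "p \<in> borel_measurable borel" "q \<in> borel_measurable borel" for p q
  proof -
    have "sym p q \<in> borel_measurable (borel \<Otimes>\<^sub>M borel)" unfolding sym_def by measurable
    thus ?thesis unfolding borel_prod .
  qed
  have [measurable]: "sym f g \<in> borel_measurable borel" "\<And>n. sym (s n) (r n) \<in> borel_measurable borel" by (auto intro!: symm)
  have conv: "(\<lambda>n. sq_norm lborel (\<lambda>z. sym (s n) (r n) z - sym f g z)) \<longlonglongrightarrow> 0"
  proof (rule sq_norm_dominated_convergence[where H="\<lambda>z. 4 * sym (\<lambda>x. \<bar>f x\<bar>) (\<lambda>x. \<bar>g x\<bar>) z"])
    have [measurable]: "sym (\<lambda>x. \<bar>f x\<bar>) (\<lambda>x. \<bar>g x\<bar>) \<in> borel_measurable borel" by (rule symm) measurable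
    show "(\<lambda>z. 4 * sym (\<lambda>x. \<bar>f x\<bar>) (\<lambda>x. \<bar>g x\<bar>) z) \<in> borel_measurable lborel" by measurable
    have "sq_norm lborel (\<lambda>x. \<bar>f x\<bar>) < \<infinity>" "sq_norm lborel (\<lambda>x. \<bar>g x\<bar>) < \<infinity>"
      using ff by (simp_all add: sq_norm_def)
    hence "sq_norm lborel (sym (\<lambda>x. \<bar>f x\<bar>) (\<lambda>x. \<bar>g x\<bar>)) < \<infinity>"
      unfolding sym_def[abs_def] by (intro sq_norm_symmetrization_finite) measurable
    thus "sq_norm lborel (\<lambda>z. 4 * sym (\<lambda>x. \<bar>f x\<bar>) (\<lambda>x. \<bar>g x\<bar>) z) < \<infinity>"
      by (subst sq_norm_scale) (auto simp: ennreal_mult_less_top)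
    show "\<bar>sym (s n) (r n) z\<bar> \<le> 4 * sym (\<lambda>x. \<bar>f x\<bar>) (\<lambda>x. \<bar>g x\<bar>) z" for n z
    proof -
      have "\<bar>s n x * r n y\<bar> \<le> (2 * \<bar>f x\<bar>) * (2 * \<bar>g y\<bar>)" for x y
        unfolding abs_mult by (intro mult_mono s(3) r(3)) auto
      from this[of "fst z" "snd z"] this[of "snd z" "fst z"]
        abs_triangle_ineq[of "s n (fst z) * r n (snd z)" "s n (snd z) * r n (fst z)"]
      show ?thesis unfolding sym_def by (simp add: abs_mult)
    qed
    show "(\<lambda>n. sym (s n) (r n) z) \<longlonglongrightarrow> sym f g z" for z
      unfolding sym_def by (intro tendsto_intros s(2) r(2)) auto
  qed measurable
  define e where "e n = enn2real (sq_norm lborel (\<lambda>z. sym (s n) (r n) z - sym f g z))" for n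
  have e0: "e \<longlonglongrightarrow> 0" unfolding e_def using conv tendsto_enn2real[of _ 0 sequentially] by simp
  have sF: "(\<lambda>n. enn2real (sq_norm lborel (s n))) \<longlonglongrightarrow> F" using tendsto_enn2real[OF sf f(2)] .
  have rG: "(\<lambda>n. enn2real (sq_norm lborel (r n))) \<longlonglongrightarrow> G" using tendsto_enn2real[OF rf g(2)] .
  have d4: "(\<integral>\<^sup>+x. ennreal \<bar>s n x * r n x\<bar> \<partial>lborel) \<le> ennreal (4 * d)" for n
  proof -
    have "(\<integral>\<^sup>+x. ennreal \<bar>s n x * r n x\<bar> \<partial>lborel) \<le> (\<integral>\<^sup>+x. 4 * ennreal \<bar>f x * g x\<bar> \<partial>lborel)"
    proof (rule nn_integral_mono)
      fix x
      have "\<bar>s n x * r n x\<bar> \<le> (2 * \<bar>f x\<bar>) * (2 * \<bar>g x\<bar>)" unfolding abs_mult by (intro mult_mono s(3) r(3)) auto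
      also have "\<dots> = 4 * \<bar>f x * g x\<bar>" by (simp add: abs_mult)
      finally have "ennreal \<bar>s n x * r n x\<bar> \<le> ennreal (4 * \<bar>f x * g x\<bar>)" by (rule ennreal_leI)
      thus "ennreal \<bar>s n x * r n x\<bar> \<le> 4 * ennreal \<bar>f x * g x\<bar>" by (simp add: ennreal_mult)
    qed
    also have "\<dots> = 4 * (\<integral>\<^sup>+x. ennreal \<bar>f x * g x\<bar> \<partial>lborel)" by (rule nn_integral_cmult) measurable
    also have "\<dots> \<le> 4 * ennreal d" by (intro mult_left_mono d) auto
    finally show ?thesis using d(2) by (simp add: ennreal_mult)
  qed
  have ev: "eventually (\<lambda>n. sq_norm lborel (\<lambda>z. sym (s n) (r n) z - sym f g z) < 1) sequentially"
    "eventually (\<lambda>n. sq_norm lborel (s n) < \<infinity>) sequentially" "eventually (\<lambda>n. sq_norm lborel (r n) < \<infinity>) sequentially"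
    by (rule order_tendstoD(2)[OF conv] order_tendstoD(2)[OF sf] order_tendstoD(2)[OF rf]; simp)+
  have "eventually (\<lambda>n. ?L \<le> sqrt (16 * (4 * d)\<^sup>2 + 16 * (2 * e n + 2 * E)) + 2 * (4 * d)
      + \<bar>enn2real (sq_norm lborel (s n)) * enn2real (sq_norm lborel (r n)) - 1\<bar> + (4 * d)\<^sup>2) sequentially"
    using ev
  proof eventually_elim
    case (elim n)
    have en: "sq_norm lborel (\<lambda>z. sym (s n) (r n) z - sym f g z) = ennreal (e n)" "e n \<ge> 0"
      using elim(1) unfolding e_def by (auto simp: ennreal_enn2real less_top intro!: ennreal_enn2real[symmetric] order_less_trans[OF elim(1)])
    have "sq_norm lborel (\<lambda>z. sym (s n) (r n) z - K z) \<le> 2 * sq_norm lborel (\<lambda>z. sym (s n) (r n) z - sym f g z) + 2 * sq_norm lborel (\<lambda>z. sym f g z - K z)"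
      by (rule sq_norm_triangle) measurable
    also have "\<dots> \<le> 2 * ennreal (e n) + 2 * ennreal E"
      unfolding en(1) using E(2) unfolding sym_def by (intro add_mono mult_left_mono) auto
    also have "\<dots> = ennreal (2 * e n + 2 * E)" using en(2) E(1) by (simp add: ennreal_mult)
    finally have le: "sq_norm lborel (\<lambda>z. sym (s n) (r n) z - K z) \<le> ennreal (2 * e n + 2 * E)" .
    show ?case
      using elim le d(2) en(2) E(1) unfolding sym_def
      by (intro simple_product_bound[OF s(1) _ r(1) _ d4 _ X]) auto
  qed
  moreover have "(\<lambda>n. sqrt (16 * (4 * d)\<^sup>2 + 16 * (2 * e n + 2 * E)) + 2 * (4 * d)
      + \<bar>enn2real (sq_norm lborel (s n)) * enn2real (sq_norm lborel (r n)) - 1\<bar> + (4 * d)\<^sup>2)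
      \<longlonglongrightarrow> sqrt (16 * (4 * d)\<^sup>2 + 16 * (2 * 0 + 2 * E)) + 2 * (4 * d) + \<bar>F * G - 1\<bar> + (4 * d)\<^sup>2"
    by (intro tendsto_intros e0 sF rG)
  ultimately have "?L \<le> sqrt (16 * (4 * d)\<^sup>2 + 16 * (2 * 0 + 2 * E)) + 2 * (4 * d) + \<bar>F * G - 1\<bar> + (4 * d)\<^sup>2"
    by (intro tendsto_lowerbound[OF _ _ sequentially_bot])
  thus ?thesis by (simp add: power_mult_distrib)
qed

end

section \<open>Beta integrals\<close>

text \<open>The substitution u = h v / (1 - v) maps (0, 1) onto (0, \<infinity>); then u + h = h /
  (1 - v) and du = h / (1 - v)^2 dv, which leaves a Beta integrand.\<close>

lemma nn_integral_add_powr_Beta: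
  fixes p q h :: real
  assumes p: "p > -1" and pq: "p + q < -1" and h: "h > 0"
  shows "(\<integral>\<^sup>+u. ennreal (u powr p * (u + h) powr q) * indicator {0<..} u \<partial>lborel)
    = ennreal (h powr (p + q + 1) * Beta (p + 1) (- p - q - 1))"
proof -
  define f where "f u = u powr p * (u + h) powr q" for u
  define g where "g v = h * v / (1 - v)" for v
  define g' where "g' v = h / (1 - v)\<^sup>2" for v
  define c where "c = h powr (p + q + 1)"
  have E: "einterval 0 1 = {0<..<1::real}" "einterval 0 \<infinity> = {0::real<..}"
    by (auto simp: einterval_def zero_ereal_def one_ereal_def)
  have fg: "f (g v) * g' v = c * (v powr (p + 1 - 1) * (1 - v) powr (- p - q - 1 - 1))" if "v \<in> {0<..<1}" for v
  proof -
    have v: "0 < v" "0 < 1 - v" using that by auto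
    have "g v + h = h / (1 - v)" using v by (simp add: g_def field_simps)
    hence "f (g v) * g' v = (h powr p * v powr p / (1 - v) powr p) * (h powr q / (1 - v) powr q) * (h powr 1 / (1 - v) powr 2)"
      using v h by (simp add: f_def g_def g'_def powr_divide powr_mult powr_numeral)
    also have "\<dots> = (h powr p * h powr q * h powr 1) * (v powr p * ((1 - v) powr (- p) * (1 - v) powr (- q) * (1 - v) powr (-2)))"
      by (simp add: powr_minus divide_inverse)
    also have "\<dots> = c * (v powr (p + 1 - 1) * (1 - v) powr (- p - q - 1 - 1))"
      by (simp only: powr_add[symmetric] c_def) (simp add: algebra_simps)
    finally show ?thesis .
  qed
  have Bint: "set_integrable lborel {0<..<1} (\<lambda>v. v powr (p + 1 - 1) * (1 - v) powr (- p - q - 1 - 1))"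
    by (rule set_integrable_subset[OF integrable_Beta]) (use p pq in auto)
  have int: "set_integrable lborel {0<..<1} (\<lambda>v. f (g v) * g' v)"
    using set_integrable_mult_right[OF Bint, of c] by (subst set_integrable_cong[OF refl refl fg]) auto
  have S: "set_integrable lborel (einterval 0 \<infinity>) f" "(LBINT x=0..\<infinity>. f x) = (LBINT x=0..1. f (g x) * g' x)"
  proof -
    have a: "(0::ereal) < 1" by simp
    have d: "DERIV g x :> g' x" if "0 < ereal x" "ereal x < 1" for x
    proof -
      have "x < 1" using that by simp
      thus ?thesis unfolding g_def g'_def by (auto intro!: derivative_eq_intros simp: power2_eq_square field_simps)
    qed
    have gp: "g x > 0" if "0 < ereal x" "ereal x < 1" for x using that h by (simp add: g_def)
    have cf: "isCont f (g x)" if "0 < ereal x" "ereal x < 1" for x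
      unfolding f_def using gp[OF that] h by (intro continuous_intros) auto
    have cg: "isCont g' x" if "0 < ereal x" "ereal x < 1" for x
      unfolding g'_def using that by (intro continuous_intros) auto
    have A: "((ereal \<circ> g \<circ> real_of_ereal) \<longlongrightarrow> 0) (at_right 0)"
    proof -
      have "(g \<longlongrightarrow> g 0) (at_right 0)" unfolding g_def by (intro tendsto_intros) auto
      moreover have "g 0 = 0" by (simp add: g_def)
      ultimately have "((\<lambda>x. ereal (g x)) \<longlongrightarrow> ereal 0) (at_right 0)" by (intro tendsto_intros) simp
      hence "((ereal \<circ> g) \<longlongrightarrow> ereal 0) (at_right 0)" by (simp add: comp_def)
      thus ?thesis unfolding zero_ereal_def ereal_tendsto_simps1 .
    qed
    have B: "((ereal \<circ> g \<circ> real_of_ereal) \<longlongrightarrow> \<infinity>) (at_left 1)"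
    proof -
      have "filterlim g at_top (at_left 1)" unfolding g_def using h by real_asymp
      hence "((\<lambda>x. ereal (g x)) \<longlongrightarrow> \<infinity>) (at_left 1)" by (simp add: tendsto_PInfty_eq_at_top)
      hence "((ereal \<circ> g) \<longlongrightarrow> \<infinity>) (at_left 1)" by (simp add: comp_def)
      thus ?thesis unfolding one_ereal_def ereal_tendsto_simps1 .
    qed
    have i: "set_integrable lborel (einterval 0 1) (\<lambda>x. f (g x) * g' x)" unfolding E by (rule int)
    note R = interval_integral_substitution_nonneg[OF a d cf cg _ _ A B i]
    show "set_integrable lborel (einterval 0 \<infinity>) f" by (rule R(1)) (auto simp: f_def g'_def h less_imp_le)
    show "(LBINT x=0..\<infinity>. f x) = (LBINT x=0..1. f (g x) * g' x)" by (rule R(2)) (auto simp: f_def g'_def h less_imp_le)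
  qed
  have "(LBINT x=0..\<infinity>. f x) = (LBINT x:{0<..}. f x)" by (simp add: interval_lebesgue_integral_def E)
  moreover have "(LBINT x=0..1. f (g x) * g' x) = (LBINT v:{0<..<1}. f (g v) * g' v)"
    by (simp add: interval_lebesgue_integral_def E)
  moreover have "\<dots> = (LBINT v:{0<..<1}. c * (v powr (p + 1 - 1) * (1 - v) powr (- p - q - 1 - 1)))"
    by (rule set_lebesgue_integral_cong) (auto simp: fg)
  moreover have "\<dots> = c * (LBINT v:{0<..<1}. v powr (p + 1 - 1) * (1 - v) powr (- p - q - 1 - 1))" by simp
  moreover have "(LBINT v:{0<..<1}. v powr (p + 1 - 1) * (1 - v) powr (- p - q - 1 - 1)) = Beta (p + 1) (- p - q - 1)"
  proof -
    have "(LBINT v:{0<..<1}. v powr (p + 1 - 1) * (1 - v) powr (- p - q - 1 - 1)) = integral {0<..<1} (\<lambda>v. v powr (p + 1 - 1) * (1 - v) powr (- p - q - 1 - 1))"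
      by (rule set_borel_integral_eq_integral(2)[OF Bint])
    also have "\<dots> = Beta (p + 1) (- p - q - 1)"
      using has_integral_Beta_real[of "p + 1" "- p - q - 1"] p pq
      by (intro integral_unique) (simp add: has_integral_Icc_iff_Ioo)
    finally show ?thesis .
  qed
  ultimately have val: "(LBINT x:{0<..}. f x) = c * Beta (p + 1) (- p - q - 1)" using S(2) by simp
  have "(\<integral>\<^sup>+u. ennreal (u powr p * (u + h) powr q) * indicator {0<..} u \<partial>lborel) = (\<integral>\<^sup>+u. ennreal (indicator {0<..} u *\<^sub>R f u) \<partial>lborel)"
    by (intro nn_integral_cong) (auto simp: f_def indicator_def)
  also have "\<dots> = ennreal (LBINT x:{0<..}. f x)"
    unfolding set_lebesgue_integral_def using S(1)
    by (intro nn_integral_eq_integral) (auto simp: set_integrable_def E f_def indicator_def)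
  finally show ?thesis unfolding val c_def .
qed

lemma nn_integral_powr_from_1:
  fixes c :: real assumes "c < -1"
  shows "(\<integral>\<^sup>+x. ennreal ((- x) powr c) * indicator {..< -1} x \<partial>lborel) = ennreal (1 / (- c - 1))"
proof -
  have "(\<integral>\<^sup>+x. ennreal ((- x) powr c) * indicator {..< -1} x \<partial>lborel) = (\<integral>\<^sup>+x. ennreal (x powr c) * indicator {1<..} x \<partial>lborel)"
    by (subst nn_integral_real_affine[where c="-1" and t=0]) (auto intro!: nn_integral_cong simp: indicator_def)
  also have "\<dots> = (\<integral>\<^sup>+x. ennreal (x powr c) * indicator {1..} x \<partial>lborel)"
    by (intro nn_integral_cong_AE, use AE_lborel_singleton[of "1::real"] in eventually_elim) (auto simp: indicator_def)
  also have "\<dots> = (\<integral>\<^sup>+x. ennreal (indicator {1..} x * x powr c) \<partial>lborel)"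
    by (intro nn_integral_cong) (auto simp: indicator_def)
  also have "\<dots> = ennreal (- (1 powr (c + 1)) / (c + 1))"
    by (rule nn_integral_has_integral_lebesgue) (use has_integral_powr_to_inf[of c 1] assms in auto)
  also have "- (1 powr (c + 1)) / (c + 1) = 1 / (- c - 1)" using assms by (simp add: field_simps)
  finally show ?thesis .
qed

lemma nn_integral_powr_from_0:
  fixes a c :: real assumes "c > -1" "a \<ge> 0"
  shows "(\<integral>\<^sup>+x. ennreal (x powr c) * indicator {0..a} x \<partial>lborel) = ennreal (a powr (c + 1) / (c + 1))"
proof -
  have "(\<integral>\<^sup>+x. ennreal (x powr c) * indicator {0..a} x \<partial>lborel) = (\<integral>\<^sup>+x. ennreal (indicator {0..a} x * x powr c) \<partial>lborel)"
    by (intro nn_integral_cong) (auto simp: indicator_def)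
  also have "\<dots> = ennreal (a powr (c + 1) / (c + 1))"
    by (rule nn_integral_has_integral_lebesgue) (use has_integral_powr_from_0[OF assms] in auto)
  finally show ?thesis .
qed

text \<open>After the space variables are integrated out, the squared norms below reduce to this
  double time integral.\<close>

lemma nn_integral_abs_diff_powr:
  fixes c :: real assumes c: "c > -1"
  shows "(\<integral>\<^sup>+s. \<integral>\<^sup>+t. ennreal (\<bar>s - t\<bar> powr c) * indicator {0..1} s * indicator {0..1} t \<partial>lborel \<partial>lborel) = ennreal (2 / ((c + 1) * (c + 2)))"
proof -
  have inner: "(\<integral>\<^sup>+t. ennreal (\<bar>s - t\<bar> powr c) * indicator {0..1} t \<partial>lborel) = ennreal (s powr (c + 1) / (c + 1)) + ennreal ((1 - s) powr (c + 1) / (c + 1))"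
    if s: "s \<in> {0..1}" for s
  proof -
    have "(\<integral>\<^sup>+t. ennreal (\<bar>s - t\<bar> powr c) * indicator {0..1} t \<partial>lborel)
      = (\<integral>\<^sup>+t. ennreal ((s - t) powr c) * indicator {0..s} t + ennreal ((t - s) powr c) * indicator {s..1} t \<partial>lborel)"
      by (intro nn_integral_cong_AE, use AE_lborel_singleton[of s] in eventually_elim) (use s in \<open>auto simp: indicator_def\<close>)
    also have "\<dots> = (\<integral>\<^sup>+t. ennreal ((s - t) powr c) * indicator {0..s} t \<partial>lborel) + (\<integral>\<^sup>+t. ennreal ((t - s) powr c) * indicator {s..1} t \<partial>lborel)"
      by (rule nn_integral_add) measurable
    also have "(\<integral>\<^sup>+t. ennreal ((s - t) powr c) * indicator {0..s} t \<partial>lborel) = (\<integral>\<^sup>+t. ennreal (t powr c) * indicator {0..s} t \<partial>lborel)"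
      by (subst nn_integral_real_affine[where c="-1" and t=s]) (auto intro!: nn_integral_cong simp: indicator_def)
    also have "(\<integral>\<^sup>+t. ennreal ((t - s) powr c) * indicator {s..1} t \<partial>lborel) = (\<integral>\<^sup>+t. ennreal (t powr c) * indicator {0..1 - s} t \<partial>lborel)"
      by (subst nn_integral_real_affine[where c=1 and t=s]) (auto intro!: nn_integral_cong simp: indicator_def)
    finally show ?thesis using s c by (simp add: nn_integral_powr_from_0)
  qed
  have "(\<integral>\<^sup>+s. \<integral>\<^sup>+t. ennreal (\<bar>s - t\<bar> powr c) * indicator {0..1} s * indicator {0..1} t \<partial>lborel \<partial>lborel)
     = (\<integral>\<^sup>+s. ennreal (1 / (c + 1)) * (ennreal (s powr (c + 1)) * indicator {0..1} s) + ennreal (1 / (c + 1)) * (ennreal ((1 - s) powr (c + 1)) * indicator {0..1} s) \<partial>lborel)"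
  proof (rule nn_integral_cong)
    fix s :: real
    show "(\<integral>\<^sup>+t. ennreal (\<bar>s - t\<bar> powr c) * indicator {0..1} s * indicator {0..1} t \<partial>lborel)
      = ennreal (1 / (c + 1)) * (ennreal (s powr (c + 1)) * indicator {0..1} s) + ennreal (1 / (c + 1)) * (ennreal ((1 - s) powr (c + 1)) * indicator {0..1} s)"
    proof (cases "s \<in> {0..1}")
      case True
      thus ?thesis using inner[OF True] c by (simp add: ennreal_mult[symmetric])
    next
      case False thus ?thesis by simp
    qed
  qed
  also have "\<dots> = ennreal (1 / (c + 1)) * (\<integral>\<^sup>+s. ennreal (s powr (c + 1)) * indicator {0..1} s \<partial>lborel) + ennreal (1 / (c + 1)) * (\<integral>\<^sup>+s. ennreal ((1 - s) powr (c + 1)) * indicator {0..1} s \<partial>lborel)"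
    by (subst nn_integral_add) (simp_all add: nn_integral_cmult)
  also have "(\<integral>\<^sup>+s. ennreal ((1 - s) powr (c + 1)) * indicator {0..1} s \<partial>lborel) = (\<integral>\<^sup>+s. ennreal (s powr (c + 1)) * indicator {0..1} s \<partial>lborel)"
    by (subst nn_integral_real_affine[where c="-1" and t=1]) (auto intro!: nn_integral_cong simp: indicator_def)
  also have "(\<integral>\<^sup>+s. ennreal (s powr (c + 1)) * indicator {0..1} s \<partial>lborel) = ennreal (1 / (c + 2))"
    using c by (subst nn_integral_powr_from_0) auto
  also have "ennreal (1 / (c + 1)) * ennreal (1 / (c + 2)) + ennreal (1 / (c + 1)) * ennreal (1 / (c + 2)) = ennreal (2 / ((c + 1) * (c + 2)))"
    using c by (simp add: ennreal_mult[symmetric] ennreal_plus[symmetric] del: ennreal_plus)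
  finally show ?thesis .
qed

section \<open>The Rosenblatt kernel near the corner\<close>

lemma pos_powr_measurable [measurable (raw)]:
  assumes [measurable]: "f \<in> borel_measurable M"
  shows "(\<lambda>x. pos_powr (f x) g) \<in> borel_measurable M"
  unfolding pos_powr_def by measurable

lemma pos_powr_nonneg [simp]: "0 \<le> pos_powr u g" by (simp add: pos_powr_def)

text \<open>The square becomes a double integral over s and t, and Tonelli moves x and y inside,
  where the variables separate. A squared kernel norm thus becomes an integral of a product of two
  covariances.\<close>

lemma nn_integral_square_convolution:
  fixes A C :: "real \<Rightarrow> real \<Rightarrow> ennreal"
  assumes A[measurable]: "case_prod A \<in> borel_measurable (borel \<Otimes>\<^sub>M borel)" and C[measurable]: "case_prod C \<in> borel_measurable (borel \<Otimes>\<^sub>M borel)"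
  shows "(\<integral>\<^sup>+x. \<integral>\<^sup>+y. (\<integral>\<^sup>+s. A s x * C s y \<partial>lborel)\<^sup>2 \<partial>lborel \<partial>lborel)
    = (\<integral>\<^sup>+s. \<integral>\<^sup>+t. (\<integral>\<^sup>+x. A s x * A t x \<partial>lborel) * (\<integral>\<^sup>+y. C s y * C t y \<partial>lborel) \<partial>lborel \<partial>lborel)"
proof -
  have A': "(\<lambda>x. A (u x) (v x)) \<in> borel_measurable L" if "u \<in> borel_measurable L" "v \<in> borel_measurable L" for u v and L :: "'z measure"
    using measurable_compose[OF measurable_Pair[OF that] A] by simp
  have C': "(\<lambda>x. C (u x) (v x)) \<in> borel_measurable L" if "u \<in> borel_measurable L" "v \<in> borel_measurable L" for u v and L :: "'z measure"
    using measurable_compose[OF measurable_Pair[OF that] C] by simp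
  note [measurable (raw)] = A' C'
  have sq: "(\<integral>\<^sup>+s. A s x * C s y \<partial>lborel)\<^sup>2 = (\<integral>\<^sup>+s. \<integral>\<^sup>+t. (A s x * C s y) * (A t x * C t y) \<partial>lborel \<partial>lborel)" for x y
    unfolding power2_eq_square by (simp add: nn_integral_cmult nn_integral_multc)
  have "(\<integral>\<^sup>+x. \<integral>\<^sup>+y. (\<integral>\<^sup>+s. A s x * C s y \<partial>lborel)\<^sup>2 \<partial>lborel \<partial>lborel)
    = (\<integral>\<^sup>+x. \<integral>\<^sup>+s. \<integral>\<^sup>+y. \<integral>\<^sup>+t. (A s x * C s y) * (A t x * C t y) \<partial>lborel \<partial>lborel \<partial>lborel \<partial>lborel)"
    unfolding sq by (intro nn_integral_cong lborel_pair.Fubini') measurable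
  also have "\<dots> = (\<integral>\<^sup>+s. \<integral>\<^sup>+x. \<integral>\<^sup>+y. \<integral>\<^sup>+t. (A s x * C s y) * (A t x * C t y) \<partial>lborel \<partial>lborel \<partial>lborel \<partial>lborel)"
    by (intro lborel_pair.Fubini') measurable
  also have "\<dots> = (\<integral>\<^sup>+s. \<integral>\<^sup>+x. \<integral>\<^sup>+t. \<integral>\<^sup>+y. (A s x * C s y) * (A t x * C t y) \<partial>lborel \<partial>lborel \<partial>lborel \<partial>lborel)"
    by (intro nn_integral_cong lborel_pair.Fubini') measurable
  also have "\<dots> = (\<integral>\<^sup>+s. \<integral>\<^sup>+t. \<integral>\<^sup>+x. \<integral>\<^sup>+y. (A s x * C s y) * (A t x * C t y) \<partial>lborel \<partial>lborel \<partial>lborel \<partial>lborel)"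
    by (intro nn_integral_cong lborel_pair.Fubini') measurable
  also have "\<dots> = (\<integral>\<^sup>+s. \<integral>\<^sup>+t. \<integral>\<^sup>+x. \<integral>\<^sup>+y. (A s x * A t x) * (C s y * C t y) \<partial>lborel \<partial>lborel \<partial>lborel \<partial>lborel)"
    by (simp add: mult_ac)
  also have "\<dots> = (\<integral>\<^sup>+s. \<integral>\<^sup>+t. (\<integral>\<^sup>+x. A s x * A t x \<partial>lborel) * (\<integral>\<^sup>+y. C s y * C t y \<partial>lborel) \<partial>lborel \<partial>lborel)"
    by (simp add: nn_integral_cmult nn_integral_multc)
  finally show ?thesis .
qed

text \<open>Substitution u = s - x. The weight \<open>k\<close> carries a truncation of x
  along.\<close>

lemma pos_powr_reflect:
  fixes k :: "real \<Rightarrow> ennreal"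
  assumes "s < t" and [measurable]: "k \<in> borel_measurable borel"
  shows "(\<integral>\<^sup>+x. ennreal (pos_powr (s - x) g * pos_powr (t - x) g') * k (s - x) \<partial>lborel)
    = (\<integral>\<^sup>+u. ennreal (u powr g * (u + (t - s)) powr g') * indicator {0<..} u * k u \<partial>lborel)"
  by (subst nn_integral_real_affine[where c="-1" and t=s])
     (use assms in \<open>auto intro!: nn_integral_cong simp: indicator_def pos_powr_def algebra_simps\<close>)

text \<open>After reflection, the Beta integral with h = |s - t|. The constant blows up as g tends
  to -1/2, which is harmless for the second exponent near \<gamma> but not for the first.\<close>

lemma pos_powr_covariance:
  fixes g :: real
  assumes g: "-1 < g" "g < -1/2" and st: "s \<noteq> t"
  shows "(\<integral>\<^sup>+x. ennreal (pos_powr (s - x) g * pos_powr (t - x) g) \<partial>lborel)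
    = ennreal (\<bar>s - t\<bar> powr (2 * g + 1) * Beta (g + 1) (- 2 * g - 1))"
proof -
  have *: "(\<integral>\<^sup>+x. ennreal (pos_powr (s - x) g * pos_powr (t - x) g) \<partial>lborel)
    = ennreal (\<bar>s - t\<bar> powr (2 * g + 1) * Beta (g + 1) (- 2 * g - 1))" if "s < t" for s t
  proof -
    have "(\<integral>\<^sup>+x. ennreal (pos_powr (s - x) g * pos_powr (t - x) g) \<partial>lborel)
      = (\<integral>\<^sup>+u. ennreal (u powr g * (u + (t - s)) powr g) * indicator {0<..} u \<partial>lborel)"
      using pos_powr_reflect[OF that, of "\<lambda>_. 1" g g] by simp
    also have "\<dots> = ennreal ((t - s) powr (g + g + 1) * Beta (g + 1) (- g - g - 1))"
      using that g by (intro nn_integral_add_powr_Beta) auto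
    also have "g + g + 1 = 2 * g + 1" by simp
    also have "- g - g - 1 = - 2 * g - 1" by simp
    also have "t - s = \<bar>s - t\<bar>" using that by simp
    finally show ?thesis .
  qed
  show ?thesis
  proof (cases "s < t")
    case True thus ?thesis by (rule *)
  next
    case False
    hence "t < s" using st by simp
    from *[OF this] show ?thesis by (simp add: mult.commute abs_minus_commute)
  qed
qed

text \<open>Losing a factor \<open>\<bar>s - t\<bar> powr - \<eta>\<close> keeps the bound uniform as \<open>g\<close> tends to \<open>-1/2\<close>.\<close>

lemma pos_powr_covariance_truncated:
  fixes g :: real
  assumes g: "-1 < g" "g < -1/2" and \<eta>: "\<eta> \<ge> 0" and st: "s \<noteq> t" "s \<in> {0..1}" "t \<in> {0..1}"
  shows "(\<integral>\<^sup>+x. ennreal (pos_powr (s - x) g * pos_powr (t - x) g) * indicator {-1..} x \<partial>lborel)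
    \<le> ennreal (2 powr \<eta> * \<bar>s - t\<bar> powr (2 * g + 1 - \<eta>) * Beta (g + 1) (- 2 * g - 1 + \<eta>))"
proof -
  have *: "(\<integral>\<^sup>+x. ennreal (pos_powr (s - x) g * pos_powr (t - x) g) * indicator {-1..} x \<partial>lborel)
    \<le> ennreal (2 powr \<eta> * \<bar>s - t\<bar> powr (2 * g + 1 - \<eta>) * Beta (g + 1) (- 2 * g - 1 + \<eta>))"
    if "s < t" "s \<in> {0..1}" "t \<in> {0..1}" for s t
  proof -
    have "(\<integral>\<^sup>+x. ennreal (pos_powr (s - x) g * pos_powr (t - x) g) * indicator {-1..} x \<partial>lborel)
      = (\<integral>\<^sup>+x. ennreal (pos_powr (s - x) g * pos_powr (t - x) g) * indicator {..s + 1} (s - x) \<partial>lborel)"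
      by (intro nn_integral_cong) (auto simp: indicator_def)
    also have "\<dots> = (\<integral>\<^sup>+u. ennreal (u powr g * (u + (t - s)) powr g) * indicator {0<..} u * indicator {..s + 1} u \<partial>lborel)"
      by (rule pos_powr_reflect[OF that(1)]) measurable
    also have "\<dots> \<le> (\<integral>\<^sup>+u. ennreal (2 powr \<eta>) * (ennreal (u powr g * (u + (t - s)) powr (g - \<eta>)) * indicator {0<..} u) \<partial>lborel)"
    proof (rule nn_integral_mono)
      fix u
      show "ennreal (u powr g * (u + (t - s)) powr g) * indicator {0<..} u * indicator {..s + 1} u
        \<le> ennreal (2 powr \<eta>) * (ennreal (u powr g * (u + (t - s)) powr (g - \<eta>)) * indicator {0<..} u)"
      proof (cases "0 < u \<and> u \<le> s + 1")
        case True
        \<comment> \<open>In the original variable v = t - x, at most 2 once x \<ge> -1; hence the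
          loss of only 2^\<eta> when v^\<eta> is split off.\<close>
        define v where "v = u + (t - s)"
        have v: "0 < v" "v \<le> 2" using True that by (auto simp: v_def)
        have "v powr g = v powr \<eta> * v powr (g - \<eta>)" using v by (simp add: powr_add[symmetric])
        also have "\<dots> \<le> 2 powr \<eta> * v powr (g - \<eta>)" using v \<eta> by (intro mult_right_mono powr_mono2) auto
        finally have "u powr g * v powr g \<le> 2 powr \<eta> * (u powr g * v powr (g - \<eta>))"
          using mult_left_mono[of "v powr g" "2 powr \<eta> * v powr (g - \<eta>)" "u powr g"] by (simp add: mult_ac)
        from ennreal_leI[OF this] show ?thesis using True by (simp add: v_def ennreal_mult[symmetric])
      qed (auto simp: indicator_def)
    qed
    also have "\<dots> = ennreal (2 powr \<eta>) * ennreal ((t - s) powr (g + (g - \<eta>) + 1) * Beta (g + 1) (- g - (g - \<eta>) - 1))"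
      using that g \<eta> by (subst nn_integral_cmult) (auto simp: nn_integral_add_powr_Beta)
    also have "\<dots> = ennreal (2 powr \<eta> * ((t - s) powr (g + (g - \<eta>) + 1) * Beta (g + 1) (- g - (g - \<eta>) - 1)))"
      by (simp add: ennreal_mult')
    also have "2 powr \<eta> * ((t - s) powr (g + (g - \<eta>) + 1) * Beta (g + 1) (- g - (g - \<eta>) - 1))
      = 2 powr \<eta> * \<bar>s - t\<bar> powr (2 * g + 1 - \<eta>) * Beta (g + 1) (- 2 * g - 1 + \<eta>)"
    proof -
      have "g + (g - \<eta>) + 1 = 2 * g + 1 - \<eta>" "- g - (g - \<eta>) - 1 = - 2 * g - 1 + \<eta>" "\<bar>s - t\<bar> = t - s" using that by auto
      thus ?thesis by (simp only: mult.assoc)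
    qed
    finally show ?thesis .
  qed
  show ?thesis
  proof (cases "s < t")
    case True thus ?thesis using * st by blast
  next
    case False
    hence "t < s" using st by simp
    from *[OF this] st show ?thesis by (simp add: mult.commute abs_minus_commute)
  qed
qed

section \<open>Splitting the kernel into a product and a remainder\<close>

lemma Beta_real_nonneg: "a > 0 \<Longrightarrow> b > 0 \<Longrightarrow> 0 \<le> Beta a (b::real)"
  by (simp add: Beta_def Gamma_real_pos less_imp_le)

text \<open>The factor r of the overview, kept in \<open>ennreal\<close> so that Tonelli applies
  freely; \<open>enn2real\<close> is taken only for the comparison.\<close>

definition ramp :: "real \<Rightarrow> real \<Rightarrow> ennreal" where
  "ramp g y = (\<integral>\<^sup>+s. ennreal (pos_powr (s - y) g) * indicator {0..1} s \<partial>lborel)"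

text \<open>One of the two mirrored summands of the kernel at t = 1. Its \<open>ennreal\<close>
  value records the divergence on part of the diagonal, where the Bochner integral in
  \<open>rosenblatt_kernel\<close> falls back to a default value.\<close>

definition half_kernel :: "real \<Rightarrow> real \<Rightarrow> real \<Rightarrow> real \<Rightarrow> ennreal" where
  "half_kernel g1 g2 x y = (\<integral>\<^sup>+s. ennreal (pos_powr (s - x) g1) * (ennreal (pos_powr (s - y) g2) * indicator {0..1} s) \<partial>lborel)"

definition tail :: "real \<Rightarrow> real \<Rightarrow> real" where
  "tail g x = (if x < -1 then (- x) powr g else 0)"

lemma ramp_measurable [measurable]: "ramp g \<in> borel_measurable borel"
  unfolding ramp_def[abs_def] by measurable

lemma half_kernel_measurable [measurable]: "(\<lambda>z. half_kernel g1 g2 (fst z) (snd z)) \<in> borel_measurable (borel \<Otimes>\<^sub>M borel)"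
  unfolding half_kernel_def[abs_def] by measurable

lemma half_kernel_measurable' [measurable (raw)]:
  assumes [measurable]: "u \<in> borel_measurable M" "v \<in> borel_measurable M"
  shows "(\<lambda>x. half_kernel g1 g2 (u x) (v x)) \<in> borel_measurable M"
  using measurable_compose[OF measurable_Pair[OF assms] half_kernel_measurable] by simp

lemma tail_measurable [measurable]: "tail g \<in> borel_measurable borel"
  unfolding tail_def[abs_def] by measurable

lemma AE_pair_neq: "AE s in lborel. AE t in lborel. (s::real) \<noteq> t"
proof (rule AE_I2)
  fix s :: real
  show "AE t in lborel. s \<noteq> t" using AE_lborel_singleton[of s] by eventually_elim auto
qed

text \<open>The two-variable formula is reused with a dummy variable x whose factor is the indicator
  of an interval of length 1.\<close>

lemma nn_integral_ramp_square:
  fixes g :: real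
  assumes g: "-1 < g" "g < -1/2"
  shows "(\<integral>\<^sup>+y. (ramp g y)\<^sup>2 \<partial>lborel) = ennreal (Beta (g + 1) (- 2 * g - 1) / ((g + 1) * (2 * g + 3)))"
proof -
  define b where "b = Beta (g + 1) (- 2 * g - 1)"
  have b: "b \<ge> 0" unfolding b_def using g by (intro Beta_real_nonneg) auto
  have "(\<integral>\<^sup>+y. (ramp g y)\<^sup>2 \<partial>lborel) = (\<integral>\<^sup>+x. \<integral>\<^sup>+y. indicator {0..1} (x::real) * (ramp g y)\<^sup>2 \<partial>lborel \<partial>lborel)"
    by (simp add: nn_integral_cmult nn_integral_multc)
  also have "\<dots> = (\<integral>\<^sup>+x. \<integral>\<^sup>+y. (\<integral>\<^sup>+s. indicator {0..1} (x::real) * (ennreal (pos_powr (s - y) g) * indicator {0..1} s) \<partial>lborel)\<^sup>2 \<partial>lborel \<partial>lborel)"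
  proof (intro nn_integral_cong)
    fix x y :: real
    show "indicator {0..1} x * (ramp g y)\<^sup>2 = (\<integral>\<^sup>+s. indicator {0..1} x * (ennreal (pos_powr (s - y) g) * indicator {0..1} s) \<partial>lborel)\<^sup>2"
      by (subst nn_integral_cmult) (auto simp: ramp_def indicator_def)
  qed
  also have "\<dots> = (\<integral>\<^sup>+s. \<integral>\<^sup>+t. (\<integral>\<^sup>+x. indicator {0..1} (x::real) * indicator {0..1} x \<partial>lborel)
      * (\<integral>\<^sup>+y. (ennreal (pos_powr (s - y) g) * indicator {0..1} s) * (ennreal (pos_powr (t - y) g) * indicator {0..1} t) \<partial>lborel) \<partial>lborel \<partial>lborel)"
    by (rule nn_integral_square_convolution) measurable
  also have "\<dots> = (\<integral>\<^sup>+s. \<integral>\<^sup>+t. ennreal b * (ennreal (\<bar>s - t\<bar> powr (2 * g + 1)) * indicator {0..1} s * indicator {0..1} t) \<partial>lborel \<partial>lborel)"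
  proof (intro nn_integral_cong_AE, use AE_pair_neq in eventually_elim, intro nn_integral_cong_AE, erule eventually_mono)
    fix s t :: real assume st: "s \<noteq> t"
    have "(\<integral>\<^sup>+x. indicator {0..1} (x::real) * indicator {0..1} x \<partial>lborel) = (\<integral>\<^sup>+x. indicator {0..1} (x::real) \<partial>lborel)"
      by (intro nn_integral_cong) (auto simp: indicator_def)
    hence 1: "(\<integral>\<^sup>+x. indicator {0..1} (x::real) * indicator {0..1} x \<partial>lborel) = 1" by simp
    have "(\<integral>\<^sup>+y. (ennreal (pos_powr (s - y) g) * indicator {0..1} s) * (ennreal (pos_powr (t - y) g) * indicator {0..1} t) \<partial>lborel)
      = (\<integral>\<^sup>+y. ennreal (pos_powr (s - y) g * pos_powr (t - y) g) * (indicator {0..1} s * indicator {0..1} t) \<partial>lborel)"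
      by (intro nn_integral_cong) (simp add: ennreal_mult mult_ac)
    also have "\<dots> = (\<integral>\<^sup>+y. ennreal (pos_powr (s - y) g * pos_powr (t - y) g) \<partial>lborel) * (indicator {0..1} s * indicator {0..1} t)"
      by (rule nn_integral_multc) measurable
    also have "\<dots> = ennreal b * (ennreal (\<bar>s - t\<bar> powr (2 * g + 1)) * indicator {0..1} s * indicator {0..1} t)"
      unfolding pos_powr_covariance[OF g st] b_def[symmetric] using b by (simp add: ennreal_mult mult_ac)
    finally show "(\<integral>\<^sup>+x. indicator {0..1} (x::real) * indicator {0..1} x \<partial>lborel)
      * (\<integral>\<^sup>+y. (ennreal (pos_powr (s - y) g) * indicator {0..1} s) * (ennreal (pos_powr (t - y) g) * indicator {0..1} t) \<partial>lborel)
      = ennreal b * (ennreal (\<bar>s - t\<bar> powr (2 * g + 1)) * indicator {0..1} s * indicator {0..1} t)" unfolding 1 by simp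
  qed
  also have "\<dots> = ennreal b * (\<integral>\<^sup>+s. \<integral>\<^sup>+t. ennreal (\<bar>s - t\<bar> powr (2 * g + 1)) * indicator {0..1} s * indicator {0..1} t \<partial>lborel \<partial>lborel)"
    by (simp add: nn_integral_cmult)
  also have "\<dots> = ennreal b * ennreal (2 / ((2 * g + 1 + 1) * (2 * g + 1 + 2)))"
    using g by (subst nn_integral_abs_diff_powr) auto
  also have "\<dots> = ennreal (b / ((g + 1) * (2 * g + 3)))"
  proof -
    have "(2 * g + 1 + 1) * (2 * g + 1 + 2) = 2 * ((g + 1) * (2 * g + 3))" by (simp add: algebra_simps)
    moreover have "0 \<le> (g + 1) * (2 * g + 3)" using g by (intro mult_nonneg_nonneg) auto
    ultimately show ?thesis using b by (subst ennreal_mult[symmetric]) simp_all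
  qed
  finally show ?thesis unfolding b_def .
qed

text \<open>The truncated covariance in x multiplies the full one in y, and the powers of |s - t|
  add up to 2 g1 + 2 g2 + 2 - \<eta>, integrable by hypothesis. For \<eta> > 0 no factor on the
  right blows up as g1 tends to -1/2, provided the exponent stays away from -1.\<close>

lemma half_kernel_near_bound:
  fixes g1 g2 \<eta> :: real
  assumes g1: "-1 < g1" "g1 < -1/2" and g2: "-1 < g2" "g2 < -1/2" and \<eta>: "\<eta> \<ge> 0" "2 * g1 + 2 * g2 + 2 - \<eta> > -1"
  shows "(\<integral>\<^sup>+x. \<integral>\<^sup>+y. (half_kernel g1 g2 x y * indicator {-1..} x)\<^sup>2 \<partial>lborel \<partial>lborel)
    \<le> ennreal (2 powr \<eta> * Beta (g1 + 1) (- 2 * g1 - 1 + \<eta>) * Beta (g2 + 1) (- 2 * g2 - 1)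
        * (2 / ((2 * g1 + 2 * g2 + 3 - \<eta>) * (2 * g1 + 2 * g2 + 4 - \<eta>))))"
proof -
  define b where "b = Beta (g2 + 1) (- 2 * g2 - 1)"
  define a where "a = 2 powr \<eta> * Beta (g1 + 1) (- 2 * g1 - 1 + \<eta>)"
  have b: "b \<ge> 0" unfolding b_def using g2 by (intro Beta_real_nonneg) auto
  have a: "a \<ge> 0" unfolding a_def using g1 \<eta> by (intro mult_nonneg_nonneg Beta_real_nonneg) auto
  define c where "c = 2 * g1 + 2 * g2 + 2 - \<eta>"
  have "(\<integral>\<^sup>+x. \<integral>\<^sup>+y. (half_kernel g1 g2 x y * indicator {-1..} x)\<^sup>2 \<partial>lborel \<partial>lborel)
    = (\<integral>\<^sup>+x. \<integral>\<^sup>+y. (\<integral>\<^sup>+s. (ennreal (pos_powr (s - x) g1) * indicator {-1..} x) * (ennreal (pos_powr (s - y) g2) * indicator {0..1} s) \<partial>lborel)\<^sup>2 \<partial>lborel \<partial>lborel)"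
    unfolding half_kernel_def by (intro nn_integral_cong, subst nn_integral_multc[symmetric]) (auto intro!: arg_cong[where f="\<lambda>x. x\<^sup>2"] nn_integral_cong simp: mult_ac)
  also have "\<dots> = (\<integral>\<^sup>+s. \<integral>\<^sup>+t. (\<integral>\<^sup>+x. (ennreal (pos_powr (s - x) g1) * indicator {-1..} x) * (ennreal (pos_powr (t - x) g1) * indicator {-1..} x) \<partial>lborel)
      * (\<integral>\<^sup>+y. (ennreal (pos_powr (s - y) g2) * indicator {0..1} s) * (ennreal (pos_powr (t - y) g2) * indicator {0..1} t) \<partial>lborel) \<partial>lborel \<partial>lborel)"
    by (rule nn_integral_square_convolution) measurable
  also have "\<dots> \<le> (\<integral>\<^sup>+s. \<integral>\<^sup>+t. ennreal (a * b) * (ennreal (\<bar>s - t\<bar> powr c) * indicator {0..1} s * indicator {0..1} t) \<partial>lborel \<partial>lborel)"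
  proof (intro nn_integral_mono_AE, use AE_pair_neq in eventually_elim, intro nn_integral_mono_AE, erule eventually_mono)
    fix s t :: real assume st: "s \<noteq> t"
    show "(\<integral>\<^sup>+x. (ennreal (pos_powr (s - x) g1) * indicator {-1..} x) * (ennreal (pos_powr (t - x) g1) * indicator {-1..} x) \<partial>lborel)
      * (\<integral>\<^sup>+y. (ennreal (pos_powr (s - y) g2) * indicator {0..1} s) * (ennreal (pos_powr (t - y) g2) * indicator {0..1} t) \<partial>lborel)
      \<le> ennreal (a * b) * (ennreal (\<bar>s - t\<bar> powr c) * indicator {0..1} s * indicator {0..1} t)"
    proof (cases "s \<in> {0..1} \<and> t \<in> {0..1}")
      case True
      have "(\<integral>\<^sup>+x. (ennreal (pos_powr (s - x) g1) * indicator {-1..} x) * (ennreal (pos_powr (t - x) g1) * indicator {-1..} x) \<partial>lborel)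
        = (\<integral>\<^sup>+x. ennreal (pos_powr (s - x) g1 * pos_powr (t - x) g1) * indicator {-1..} x \<partial>lborel)"
        by (intro nn_integral_cong) (auto simp: ennreal_mult indicator_def)
      also have "\<dots> \<le> ennreal (2 powr \<eta> * \<bar>s - t\<bar> powr (2 * g1 + 1 - \<eta>) * Beta (g1 + 1) (- 2 * g1 - 1 + \<eta>))"
        using True by (intro pos_powr_covariance_truncated[OF g1 \<eta>(1) st]) auto
      also have "\<dots> = ennreal (a * \<bar>s - t\<bar> powr (2 * g1 + 1 - \<eta>))" by (simp add: a_def mult_ac)
      finally have 1: "(\<integral>\<^sup>+x. (ennreal (pos_powr (s - x) g1) * indicator {-1..} x) * (ennreal (pos_powr (t - x) g1) * indicator {-1..} x) \<partial>lborel)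
        \<le> ennreal (a * \<bar>s - t\<bar> powr (2 * g1 + 1 - \<eta>))" .
      have "(\<integral>\<^sup>+y. (ennreal (pos_powr (s - y) g2) * indicator {0..1} s) * (ennreal (pos_powr (t - y) g2) * indicator {0..1} t) \<partial>lborel)
        = (\<integral>\<^sup>+y. ennreal (pos_powr (s - y) g2 * pos_powr (t - y) g2) \<partial>lborel)"
        using True by (intro nn_integral_cong) (auto simp: ennreal_mult)
      also have "\<dots> = ennreal (\<bar>s - t\<bar> powr (2 * g2 + 1) * b)" unfolding pos_powr_covariance[OF g2 st] b_def ..
      finally have 2: "(\<integral>\<^sup>+y. (ennreal (pos_powr (s - y) g2) * indicator {0..1} s) * (ennreal (pos_powr (t - y) g2) * indicator {0..1} t) \<partial>lborel)
        = ennreal (\<bar>s - t\<bar> powr (2 * g2 + 1) * b)" .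
      have "(\<integral>\<^sup>+x. (ennreal (pos_powr (s - x) g1) * indicator {-1..} x) * (ennreal (pos_powr (t - x) g1) * indicator {-1..} x) \<partial>lborel)
        * (\<integral>\<^sup>+y. (ennreal (pos_powr (s - y) g2) * indicator {0..1} s) * (ennreal (pos_powr (t - y) g2) * indicator {0..1} t) \<partial>lborel)
        \<le> ennreal (a * \<bar>s - t\<bar> powr (2 * g1 + 1 - \<eta>)) * ennreal (\<bar>s - t\<bar> powr (2 * g2 + 1) * b)"
        unfolding 2 by (intro mult_right_mono 1) simp
      also have "\<dots> = ennreal ((a * \<bar>s - t\<bar> powr (2 * g1 + 1 - \<eta>)) * (\<bar>s - t\<bar> powr (2 * g2 + 1) * b))"
        using a b by (subst ennreal_mult) auto
      also have "(a * \<bar>s - t\<bar> powr (2 * g1 + 1 - \<eta>)) * (\<bar>s - t\<bar> powr (2 * g2 + 1) * b) = a * b * \<bar>s - t\<bar> powr c"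
      proof -
        have "c = (2 * g1 + 1 - \<eta>) + (2 * g2 + 1)" by (simp add: c_def)
        hence "\<bar>s - t\<bar> powr c = \<bar>s - t\<bar> powr (2 * g1 + 1 - \<eta>) * \<bar>s - t\<bar> powr (2 * g2 + 1)" by (simp only: powr_add)
        thus ?thesis by (simp add: mult_ac)
      qed
      finally show ?thesis using True a b by (simp add: ennreal_mult)
    next
      case False
      hence "(\<integral>\<^sup>+y. (ennreal (pos_powr (s - y) g2) * indicator {0..1} s) * (ennreal (pos_powr (t - y) g2) * indicator {0..1} t) \<partial>lborel) = (\<integral>\<^sup>+(y::real). 0 \<partial>lborel)"
        by (intro nn_integral_cong) auto
      thus ?thesis by simp
    qed
  qed
  also have "\<dots> = ennreal (a * b) * (\<integral>\<^sup>+s. \<integral>\<^sup>+t. ennreal (\<bar>s - t\<bar> powr c) * indicator {0..1} s * indicator {0..1} t \<partial>lborel \<partial>lborel)"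
    by (simp add: nn_integral_cmult)
  also have "\<dots> = ennreal (a * b) * ennreal (2 / ((c + 1) * (c + 2)))"
    using \<eta> by (subst nn_integral_abs_diff_powr) (auto simp: c_def)
  also have "\<dots> = ennreal (a * b * (2 / ((c + 1) * (c + 2))))"
    using a b \<eta> by (subst ennreal_mult) (auto simp: c_def)
  also have "a * b * (2 / ((c + 1) * (c + 2))) = 2 powr \<eta> * Beta (g1 + 1) (- 2 * g1 - 1 + \<eta>) * Beta (g2 + 1) (- 2 * g2 - 1)
        * (2 / ((2 * g1 + 2 * g2 + 3 - \<eta>) * (2 * g1 + 2 * g2 + 4 - \<eta>)))"
  proof -
    have "c + 1 = 2 * g1 + 2 * g2 + 3 - \<eta>" "c + 2 = 2 * g1 + 2 * g2 + 4 - \<eta>" by (auto simp: c_def)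
    thus ?thesis by (simp only: a_def b_def)
  qed
  finally show ?thesis .
qed

text \<open>Mean value theorem with |g| \<le> 1 and s \<le> 1. The exponent -3/2 bounds g - 1
  uniformly in g, and its square is integrable at infinity.\<close>

lemma powr_increment_bound:
  fixes u s g :: real
  assumes g: "-1 < g" "g < -1/2" and u: "u > 1" and s: "0 \<le> s" "s \<le> 1"
  shows "(u + s) powr g \<le> u powr g" "u powr g \<le> (u + s) powr g + u powr (-3/2)"
proof -
  show "(u + s) powr g \<le> u powr g" using assms by (intro powr_mono2') auto
  show "u powr g \<le> (u + s) powr g + u powr (-3/2)"
  proof (cases "s = 0")
    case False
    hence "s > 0" using s by simp
    have "\<exists>z. u < z \<and> z < u + s \<and> (u + s) powr g - u powr g = (u + s - u) * (g * z powr (g - 1))"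
      using \<open>s > 0\<close> u by (intro MVT2) (auto intro!: derivative_eq_intros simp: powr_diff)
    then obtain z where z: "u < z" "(u + s) powr g - u powr g = s * (g * z powr (g - 1))" by auto
    have "u powr g - (u + s) powr g = (s * (- g)) * z powr (g - 1)" using z(2) by (simp add: algebra_simps)
    also have "\<dots> \<le> 1 * z powr (g - 1)" using s g mult_mono[of s 1 "- g" 1] by (intro mult_right_mono) auto
    also have "\<dots> \<le> 1 * u powr (g - 1)" using z u g by (intro mult_left_mono powr_mono2') auto
    also have "u powr (g - 1) \<le> u powr (-3/2)" using u g by (intro powr_mono) auto
    finally show ?thesis by simp
  qed simp
qed

text \<open>Pointwise majorant of the difference between \<open>tail\<close> times
  \<open>ramp\<close> and \<open>half_kernel\<close>: for x < -1 it comes from the increment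
  estimate, elsewhere \<open>tail\<close> vanishes and the half kernel itself is the error.\<close>

definition remainder_bound :: "real \<Rightarrow> real \<Rightarrow> real \<Rightarrow> real \<Rightarrow> ennreal" where
  "remainder_bound g1 g2 x y = (if x < -1 then ennreal ((- x) powr (-3/2)) * ramp g2 y else half_kernel g1 g2 x y)"

lemma remainder_bound_measurable [measurable (raw)]:
  assumes [measurable]: "u \<in> borel_measurable M" "v \<in> borel_measurable M"
  shows "(\<lambda>x. remainder_bound g1 g2 (u x) (v x)) \<in> borel_measurable M"
  unfolding remainder_bound_def by measurable

text \<open>The two increment inequalities are integrated against the second power. The lower one is
  kept in additive form to avoid subtraction in \<open>ennreal\<close>; reals are taken only after
  finiteness is known.\<close>

lemma half_kernel_approx:
  assumes g1: "-1 < g1" "g1 < -1/2" and fin: "remainder_bound g1 g2 x y < \<infinity>"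
  shows "half_kernel g1 g2 x y < \<infinity>"
    "\<bar>tail g1 x * enn2real (ramp g2 y) - enn2real (half_kernel g1 g2 x y)\<bar> \<le> enn2real (remainder_bound g1 g2 x y)"
proof -
  have "half_kernel g1 g2 x y < \<infinity> \<and>
    \<bar>tail g1 x * enn2real (ramp g2 y) - enn2real (half_kernel g1 g2 x y)\<bar> \<le> enn2real (remainder_bound g1 g2 x y)"
  proof (cases "x < -1")
    case False
    thus ?thesis using fin by (simp add: remainder_bound_def tail_def)
  next
    case True
    define u where "u = - x"
    have u: "u > 1" using True by (simp add: u_def)
    have fr: "ramp g2 y < \<infinity>" using fin True by (auto simp: remainder_bound_def ennreal_mult_less_top)
    have up: "half_kernel g1 g2 x y \<le> ennreal (u powr g1) * ramp g2 y"
    proof -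
      have "half_kernel g1 g2 x y \<le> (\<integral>\<^sup>+s. ennreal (u powr g1) * (ennreal (pos_powr (s - y) g2) * indicator {0..1} s) \<partial>lborel)"
        unfolding half_kernel_def
      proof (rule nn_integral_mono)
        fix s
        show "ennreal (pos_powr (s - x) g1) * (ennreal (pos_powr (s - y) g2) * indicator {0..1} s)
          \<le> ennreal (u powr g1) * (ennreal (pos_powr (s - y) g2) * indicator {0..1} s)"
        proof (cases "s \<in> {0..1}")
          case s: True
          hence "pos_powr (s - x) g1 = (u + s) powr g1" using u by (simp add: pos_powr_def u_def add.commute)
          thus ?thesis using powr_increment_bound(1)[OF g1 u, of s] s by (intro mult_right_mono) auto
        qed simp
      qed
      thus ?thesis unfolding ramp_def by (subst (asm) nn_integral_cmult) auto
    qed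
    have lo: "ennreal (u powr g1) * ramp g2 y \<le> half_kernel g1 g2 x y + ennreal (u powr (-3/2)) * ramp g2 y"
    proof -
      have "ennreal (u powr g1) * ramp g2 y = (\<integral>\<^sup>+s. ennreal (u powr g1) * (ennreal (pos_powr (s - y) g2) * indicator {0..1} s) \<partial>lborel)"
        unfolding ramp_def by (subst nn_integral_cmult) auto
      also have "\<dots> \<le> (\<integral>\<^sup>+s. ennreal (pos_powr (s - x) g1) * (ennreal (pos_powr (s - y) g2) * indicator {0..1} s)
          + ennreal (u powr (-3/2)) * (ennreal (pos_powr (s - y) g2) * indicator {0..1} s) \<partial>lborel)"
      proof (rule nn_integral_mono)
        fix s
        show "ennreal (u powr g1) * (ennreal (pos_powr (s - y) g2) * indicator {0..1} s)
          \<le> ennreal (pos_powr (s - x) g1) * (ennreal (pos_powr (s - y) g2) * indicator {0..1} s)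
          + ennreal (u powr (-3/2)) * (ennreal (pos_powr (s - y) g2) * indicator {0..1} s)"
        proof (cases "s \<in> {0..1}")
          case s: True
          hence "pos_powr (s - x) g1 = (u + s) powr g1" using u by (simp add: pos_powr_def u_def add.commute)
          hence "u powr g1 \<le> pos_powr (s - x) g1 + u powr (-3/2)" using powr_increment_bound(2)[OF g1 u, of s] s by simp
          hence "ennreal (u powr g1) \<le> ennreal (pos_powr (s - x) g1) + ennreal (u powr (-3/2))"
            using ennreal_leI[of "u powr g1" "pos_powr (s - x) g1 + u powr (-3/2)"] by (subst (asm) ennreal_plus) auto
          thus ?thesis unfolding distrib_right[symmetric] by (intro mult_right_mono) auto
        qed simp
      qed
      also have "\<dots> = half_kernel g1 g2 x y + ennreal (u powr (-3/2)) * ramp g2 y"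
        unfolding half_kernel_def ramp_def by (subst nn_integral_add) (auto simp: nn_integral_cmult)
      finally show ?thesis .
    qed
    obtain R where R: "ramp g2 y = ennreal R" "R \<ge> 0" using fr by (cases "ramp g2 y") auto
    have fk: "half_kernel g1 g2 x y < \<infinity>" using up unfolding R by (rule order_le_less_trans) (simp add: ennreal_mult_less_top)
    obtain k where k: "half_kernel g1 g2 x y = ennreal k" "k \<ge> 0" using fk by (cases "half_kernel g1 g2 x y") auto
    have "k \<le> u powr g1 * R" using up k(2) R(2) unfolding k R by (simp add: ennreal_mult'[symmetric] ennreal_le_iff)
    moreover have "u powr g1 * R \<le> k + u powr (-3/2) * R"
      using lo k(2) R(2) unfolding k R by (simp add: ennreal_mult'[symmetric] ennreal_plus[symmetric] ennreal_le_iff del: ennreal_plus)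
    moreover have "remainder_bound g1 g2 x y = ennreal (u powr (-3/2) * R)"
      using True R(2) by (simp add: remainder_bound_def R u_def ennreal_mult')
    moreover have "tail g1 x = u powr g1" using True by (simp add: tail_def u_def)
    ultimately show ?thesis using fk R k by simp
  qed
  thus "half_kernel g1 g2 x y < \<infinity>"
    "\<bar>tail g1 x * enn2real (ramp g2 y) - enn2real (half_kernel g1 g2 x y)\<bar> \<le> enn2real (remainder_bound g1 g2 x y)" by auto
qed

text \<open>The first summand is the squared norm of \<open>ramp\<close> times 1/2, the integral of
  (-x)^(-3) over x < -1; the second is the bound of \<open>half_kernel_near_bound\<close>. For
  suitable \<eta> > 0 it stays bounded near the corner.\<close>

definition remainder_const :: "real \<Rightarrow> real \<Rightarrow> real \<Rightarrow> real" where
  "remainder_const \<eta> g1 g2 = Beta (g2 + 1) (- 2 * g2 - 1) / (2 * ((g2 + 1) * (2 * g2 + 3)))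
     + 2 powr \<eta> * Beta (g1 + 1) (- 2 * g1 - 1 + \<eta>) * Beta (g2 + 1) (- 2 * g2 - 1)
        * (2 / ((2 * g1 + 2 * g2 + 3 - \<eta>) * (2 * g1 + 2 * g2 + 4 - \<eta>)))"

lemma remainder_const_nonneg:
  assumes "-1 < g1" "g1 < -1/2" "-1 < g2" "g2 < -1/2" "\<eta> \<ge> 0" "2 * g1 + 2 * g2 + 2 - \<eta> > -1"
  shows "remainder_const \<eta> g1 g2 \<ge> 0"
proof -
  have "0 \<le> Beta (g2 + 1) (- 2 * g2 - 1)" "0 \<le> Beta (g1 + 1) (- 2 * g1 - 1 + \<eta>)"
    using assms by (auto intro!: Beta_real_nonneg)
  moreover have "0 < g2 + 1" "0 < 2 * g2 + 3" "0 < 2 * g1 + 2 * g2 + 3 - \<eta>" "0 < 2 * g1 + 2 * g2 + 4 - \<eta>"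
    using assms by auto
  ultimately show ?thesis unfolding remainder_const_def by (intro add_nonneg_nonneg[of "_ / _"]) simp_all
qed

lemma nn_integral_remainder_bound:
  fixes g1 g2 \<eta> :: real
  assumes g1: "-1 < g1" "g1 < -1/2" and g2: "-1 < g2" "g2 < -1/2" and \<eta>: "\<eta> \<ge> 0" "2 * g1 + 2 * g2 + 2 - \<eta> > -1"
  shows "(\<integral>\<^sup>+x. \<integral>\<^sup>+y. (remainder_bound g1 g2 x y)\<^sup>2 \<partial>lborel \<partial>lborel) \<le> ennreal (remainder_const \<eta> g1 g2)"
proof -
  define G where "G = Beta (g2 + 1) (- 2 * g2 - 1) / ((g2 + 1) * (2 * g2 + 3))"
  define H where "H = 2 powr \<eta> * Beta (g1 + 1) (- 2 * g1 - 1 + \<eta>) * Beta (g2 + 1) (- 2 * g2 - 1)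
        * (2 / ((2 * g1 + 2 * g2 + 3 - \<eta>) * (2 * g1 + 2 * g2 + 4 - \<eta>)))"
  have G: "G \<ge> 0" unfolding G_def using g2 by (intro divide_nonneg_nonneg mult_nonneg_nonneg Beta_real_nonneg) auto
  have H: "H \<ge> 0" unfolding H_def using g1 g2 \<eta> by (intro divide_nonneg_nonneg mult_nonneg_nonneg Beta_real_nonneg) auto
  have "(\<integral>\<^sup>+x. \<integral>\<^sup>+y. (remainder_bound g1 g2 x y)\<^sup>2 \<partial>lborel \<partial>lborel)
    = (\<integral>\<^sup>+x. \<integral>\<^sup>+y. ennreal ((- x) powr (-3)) * indicator {..< -1} x * (ramp g2 y)\<^sup>2 + (half_kernel g1 g2 x y * indicator {-1..} x)\<^sup>2 \<partial>lborel \<partial>lborel)"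
  proof (intro nn_integral_cong)
    fix x y :: real
    have "(ennreal ((- x) powr (-3/2)))\<^sup>2 = ennreal ((- x) powr (-3))" if "x < -1"
    proof -
      have "((- x) powr (-3/2))\<^sup>2 = (- x) powr (-3)" unfolding power2_eq_square powr_add[symmetric] by simp
      thus ?thesis by (simp add: ennreal_power)
    qed
    thus "(remainder_bound g1 g2 x y)\<^sup>2 = ennreal ((- x) powr (-3)) * indicator {..< -1} x * (ramp g2 y)\<^sup>2 + (half_kernel g1 g2 x y * indicator {-1..} x)\<^sup>2"
      by (auto simp: remainder_bound_def indicator_def power_mult_distrib)
  qed
  also have "\<dots> = (\<integral>\<^sup>+x. ennreal ((- x) powr (-3)) * indicator {..< -1} x * ennreal G + (\<integral>\<^sup>+y. (half_kernel g1 g2 x y * indicator {-1..} x)\<^sup>2 \<partial>lborel) \<partial>lborel)"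
    by (intro nn_integral_cong, subst nn_integral_add) (auto simp: nn_integral_cmult nn_integral_ramp_square[OF g2] G_def)
  also have "\<dots> = (\<integral>\<^sup>+x. ennreal ((- x) powr (-3)) * indicator {..< -1} x \<partial>lborel) * ennreal G + (\<integral>\<^sup>+x. \<integral>\<^sup>+y. (half_kernel g1 g2 x y * indicator {-1..} x)\<^sup>2 \<partial>lborel \<partial>lborel)"
    by (subst nn_integral_add) (auto simp: nn_integral_multc)
  also have "\<dots> \<le> ennreal (1 / 2) * ennreal G + ennreal H"
    using nn_integral_powr_from_1[of "-3"] half_kernel_near_bound[OF g1 g2 \<eta>] unfolding H_def[symmetric]
    by (intro add_mono mult_right_mono) auto
  also have "\<dots> = ennreal (1 / 2 * G) + ennreal H" using G by (subst ennreal_mult[of "1/2" G]) auto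
  also have "\<dots> = ennreal (1 / 2 * G + H)" using G H by (intro ennreal_plus[symmetric]) auto
  also have "1 / 2 * G + H = remainder_const \<eta> g1 g2" by (simp add: remainder_const_def G_def H_def)
  finally show ?thesis .
qed

lemma rosenblatt_kernel_measurable: "rosenblatt_kernel g1 g2 t \<in> borel_measurable borel"
proof -
  have "rosenblatt_kernel g1 g2 t \<in> borel_measurable (borel \<Otimes>\<^sub>M borel)"
    unfolding rosenblatt_kernel_def set_lebesgue_integral_def split_def by measurable
  thus ?thesis unfolding borel_prod .
qed

lemma rosenblatt_kernel_eq:
  assumes "half_kernel g1 g2 x y < \<infinity>" "half_kernel g1 g2 y x < \<infinity>"
  shows "rosenblatt_kernel g1 g2 1 (x, y) = enn2real (half_kernel g1 g2 x y) + enn2real (half_kernel g1 g2 y x)"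
proof -
  have nn: "(\<integral>\<^sup>+s. ennreal (indicator {0..1} s *\<^sub>R (pos_powr (s - u) g1 * pos_powr (s - v) g2)) \<partial>lborel) = half_kernel g1 g2 u v" for u v
    unfolding half_kernel_def by (intro nn_integral_cong) (auto simp: indicator_def ennreal_mult)
  have i: "set_integrable lborel {0..1} (\<lambda>s. pos_powr (s - u) g1 * pos_powr (s - v) g2)"
    and v: "(LINT s:{0..1}|lborel. pos_powr (s - u) g1 * pos_powr (s - v) g2) = enn2real (half_kernel g1 g2 u v)"
    if "half_kernel g1 g2 u v < \<infinity>" for u v
  proof -
    show i: "set_integrable lborel {0..1} (\<lambda>s. pos_powr (s - u) g1 * pos_powr (s - v) g2)"
      unfolding set_integrable_def using that by (intro integrableI_nonneg) (auto simp: nn[unfolded real_scaleR_def])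
    show "(LINT s:{0..1}|lborel. pos_powr (s - u) g1 * pos_powr (s - v) g2) = enn2real (half_kernel g1 g2 u v)"
      unfolding set_lebesgue_integral_def by (subst integral_eq_nn_integral) (auto simp: nn[unfolded real_scaleR_def])
  qed
  have "rosenblatt_kernel g1 g2 1 (x, y) = (LINT s:{0..1}|lborel. pos_powr (s - x) g1 * pos_powr (s - y) g2 + pos_powr (s - y) g1 * pos_powr (s - x) g2)"
    by (simp add: rosenblatt_kernel_def mult.commute)
  also have "\<dots> = enn2real (half_kernel g1 g2 x y) + enn2real (half_kernel g1 g2 y x)"
    using i[OF assms(1)] i[OF assms(2)] v[OF assms(1)] v[OF assms(2)] by (subst set_integral_add(2)) auto
  finally show ?thesis .
qed

text \<open>The kernel is a sum of two mirrored half kernels with equal remainder norms. The weights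
  combine to (c/2)^2 * 2 * 2 = c^2 times one remainder norm.\<close>

lemma rosenblatt_kernel_approx:
  fixes g1 g2 \<eta> c :: real
  assumes g1: "-1 < g1" "g1 < -1/2" and g2: "-1 < g2" "g2 < -1/2" and \<eta>: "\<eta> \<ge> 0" "2 * g1 + 2 * g2 + 2 - \<eta> > -1"
  defines "f \<equiv> \<lambda>x. c * tail g1 x" and "r \<equiv> \<lambda>y. enn2real (ramp g2 y)"
  shows "sq_norm lborel (\<lambda>z. (f (fst z) * r (snd z) + f (snd z) * r (fst z)) / 2 - c / 2 * rosenblatt_kernel g1 g2 1 z)
    \<le> ennreal (c\<^sup>2 * remainder_const \<eta> g1 g2)"
proof -
  let ?R = "remainder_bound g1 g2"
  have R0: "remainder_const \<eta> g1 g2 \<ge> 0" by (rule remainder_const_nonneg) (use assms in auto)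
  have pt: "ennreal (((f x * r y + f y * r x) / 2 - c / 2 * rosenblatt_kernel g1 g2 1 (x, y))\<^sup>2)
    \<le> ennreal (c\<^sup>2 / 2) * ((?R x y)\<^sup>2 + (?R y x)\<^sup>2)" for x y
  proof -
    \<comment> \<open>Where a majorant is infinite the estimate is trivial, but only for c \<noteq>
      0, since 0 times \<infinity> is 0.\<close>
    consider "c = 0" | "c \<noteq> 0" "?R x y = \<infinity> \<or> ?R y x = \<infinity>" | "?R x y < \<infinity>" "?R y x < \<infinity>"
      by (cases "c = 0"; cases "?R x y = \<infinity>"; cases "?R y x = \<infinity>") (auto simp: less_top)
    thus ?thesis
    proof cases
      case 1 thus ?thesis by (simp add: f_def)
    next
      case 2 thus ?thesis by (auto simp: power2_eq_square ennreal_mult_eq_top_iff ennreal_mult_top ennreal_top_mult)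
    next
      case 3
      define p where "p = enn2real (?R x y)"
      define q where "q = enn2real (?R y x)"
      have pq: "?R x y = ennreal p" "?R y x = ennreal q" "0 \<le> p" "0 \<le> q" using 3 by (auto simp: p_def q_def)
      note h1 = half_kernel_approx[OF g1 3(1), folded p_def] and h2 = half_kernel_approx[OF g1 3(2), folded q_def]
      define u where "u = tail g1 x * r y - enn2real (half_kernel g1 g2 x y)"
      define v where "v = tail g1 y * r x - enn2real (half_kernel g1 g2 y x)"
      have uv: "\<bar>u\<bar> \<le> p" "\<bar>v\<bar> \<le> q" using h1(2) h2(2) by (auto simp: u_def v_def r_def)
      have eq: "((f x * r y + f y * r x) / 2 - c / 2 * rosenblatt_kernel g1 g2 1 (x, y)) = c / 2 * (u + v)"
        unfolding rosenblatt_kernel_eq[OF h1(1) h2(1)] f_def u_def v_def by (simp add: algebra_simps add_divide_distrib)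
      have "((f x * r y + f y * r x) / 2 - c / 2 * rosenblatt_kernel g1 g2 1 (x, y))\<^sup>2 = c\<^sup>2 / 4 * (u + v)\<^sup>2"
        unfolding eq by (simp add: power_mult_distrib power_divide)
      also have "\<dots> \<le> c\<^sup>2 / 4 * (2 * (p\<^sup>2 + q\<^sup>2))"
      proof (intro mult_left_mono)
        have sq: "u\<^sup>2 \<le> p\<^sup>2" "v\<^sup>2 \<le> q\<^sup>2" using uv pq abs_le_square_iff[of u p] abs_le_square_iff[of v q] by auto
        have "(u + v)\<^sup>2 \<le> 2 * (u\<^sup>2 + v\<^sup>2)"
          using zero_le_power2[of "u - v"] by (simp add: power2_eq_square algebra_simps)
        also have "2 * (u\<^sup>2 + v\<^sup>2) \<le> 2 * (p\<^sup>2 + q\<^sup>2)" using sq by simp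
        finally show "(u + v)\<^sup>2 \<le> 2 * (p\<^sup>2 + q\<^sup>2)" .
      qed auto
      also have "\<dots> = c\<^sup>2 / 2 * (p\<^sup>2 + q\<^sup>2)" by simp
      finally have "ennreal (((f x * r y + f y * r x) / 2 - c / 2 * rosenblatt_kernel g1 g2 1 (x, y))\<^sup>2) \<le> ennreal (c\<^sup>2 / 2 * (p\<^sup>2 + q\<^sup>2))"
        by (rule ennreal_leI)
      also have "\<dots> = ennreal (c\<^sup>2 / 2) * ((?R x y)\<^sup>2 + (?R y x)\<^sup>2)"
      proof -
        have "(?R x y)\<^sup>2 + (?R y x)\<^sup>2 = ennreal (p\<^sup>2 + q\<^sup>2)"
          unfolding pq(1,2) using pq(3,4) by (simp add: ennreal_power ennreal_plus)
        thus ?thesis by (subst ennreal_mult) auto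
      qed
      finally show ?thesis .
    qed
  qed
  have [measurable]: "f \<in> borel_measurable borel" "r \<in> borel_measurable borel" unfolding f_def r_def by measurable
  have [measurable]: "rosenblatt_kernel g1 g2 1 \<in> borel_measurable (borel \<Otimes>\<^sub>M borel)"
    using rosenblatt_kernel_measurable[of g1 g2 1] unfolding borel_prod .
  have m: "(\<lambda>z. ennreal (((f (fst z) * r (snd z) + f (snd z) * r (fst z)) / 2 - c / 2 * rosenblatt_kernel g1 g2 1 z)\<^sup>2)) \<in> borel_measurable borel"
    unfolding borel_prod[symmetric] by measurable
  have "sq_norm lborel (\<lambda>z. (f (fst z) * r (snd z) + f (snd z) * r (fst z)) / 2 - c / 2 * rosenblatt_kernel g1 g2 1 z)
    = (\<integral>\<^sup>+x. \<integral>\<^sup>+y. ennreal (((f x * r y + f y * r x) / 2 - c / 2 * rosenblatt_kernel g1 g2 1 (x, y))\<^sup>2) \<partial>lborel \<partial>lborel)"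
    unfolding sq_norm_def nn_integral_lborel_pair[OF m] by simp
  also have "\<dots> \<le> (\<integral>\<^sup>+x. \<integral>\<^sup>+y. ennreal (c\<^sup>2 / 2) * ((?R x y)\<^sup>2 + (?R y x)\<^sup>2) \<partial>lborel \<partial>lborel)"
    by (intro nn_integral_mono pt)
  also have "\<dots> = ennreal (c\<^sup>2 / 2) * ((\<integral>\<^sup>+x. \<integral>\<^sup>+y. (?R x y)\<^sup>2 \<partial>lborel \<partial>lborel) + (\<integral>\<^sup>+x. \<integral>\<^sup>+y. (?R y x)\<^sup>2 \<partial>lborel \<partial>lborel))"
    by (simp add: nn_integral_cmult nn_integral_add)
  also have "(\<integral>\<^sup>+x. \<integral>\<^sup>+y. (?R y x)\<^sup>2 \<partial>lborel \<partial>lborel) = (\<integral>\<^sup>+x. \<integral>\<^sup>+y. (?R x y)\<^sup>2 \<partial>lborel \<partial>lborel)"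
    by (rule lborel_pair.Fubini') measurable
  also have "ennreal (c\<^sup>2 / 2) * ((\<integral>\<^sup>+x. \<integral>\<^sup>+y. (?R x y)\<^sup>2 \<partial>lborel \<partial>lborel) + (\<integral>\<^sup>+x. \<integral>\<^sup>+y. (?R x y)\<^sup>2 \<partial>lborel \<partial>lborel))
    \<le> ennreal (c\<^sup>2 / 2) * (ennreal (remainder_const \<eta> g1 g2) + ennreal (remainder_const \<eta> g1 g2))"
    by (intro mult_left_mono add_mono nn_integral_remainder_bound[OF g1 g2 \<eta>]) auto
  also have "\<dots> = ennreal (c\<^sup>2 / 2) * ennreal (remainder_const \<eta> g1 g2 + remainder_const \<eta> g1 g2)"
    using R0 by (subst ennreal_plus) auto
  also have "\<dots> = ennreal (c\<^sup>2 / 2 * (remainder_const \<eta> g1 g2 + remainder_const \<eta> g1 g2))"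
    using R0 by (intro ennreal_mult[symmetric]) auto
  finally show ?thesis by simp
qed

lemma sq_norm_scaled_tail:
  assumes "g < -1/2"
  shows "sq_norm lborel (\<lambda>x. c * tail g x) = ennreal (c\<^sup>2 / (- 2 * g - 1))"
proof -
  have "sq_norm lborel (tail g) = (\<integral>\<^sup>+x. ennreal ((- x) powr (2 * g)) * indicator {..< -1} x \<partial>lborel)"
    unfolding sq_norm_def
  proof (rule nn_integral_cong)
    fix x :: real
    have "((- x) powr g)\<^sup>2 = (- x) powr (2 * g)" unfolding power2_eq_square powr_add[symmetric] by simp
    thus "ennreal ((tail g x)\<^sup>2) = ennreal ((- x) powr (2 * g)) * indicator {..< -1} x" by (simp add: tail_def)
  qed
  also have "\<dots> = ennreal (1 / (- (2 * g) - 1))" using assms by (intro nn_integral_powr_from_1) simp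
  finally have "sq_norm lborel (\<lambda>x. c * tail g x) = ennreal (c\<^sup>2) * ennreal (1 / (- (2 * g) - 1))"
    by (simp add: sq_norm_scale)
  also have "\<dots> = ennreal (c\<^sup>2 / (- 2 * g - 1))" using assms by (subst ennreal_mult[symmetric]) auto
  finally show ?thesis .
qed

lemma sq_norm_ramp:
  assumes g: "-1 < g" "g < -1/2"
  shows "sq_norm lborel (\<lambda>y. enn2real (ramp g y)) = ennreal (Beta (g + 1) (- 2 * g - 1) / ((g + 1) * (2 * g + 3)))"
proof -
  \<comment> \<open>A finite integral makes \<open>ramp\<close> finite almost everywhere, so passing
    to reals does not change the norm.\<close>
  have "AE y in lborel. (ramp g y)\<^sup>2 \<noteq> \<infinity>"
    by (rule nn_integral_noteq_infinite) (simp_all add: nn_integral_ramp_square[OF g])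
  hence "sq_norm lborel (\<lambda>y. enn2real (ramp g y)) = (\<integral>\<^sup>+y. (ramp g y)\<^sup>2 \<partial>lborel)"
    unfolding sq_norm_def
  proof (intro nn_integral_cong_AE, eventually_elim)
    case (elim y)
    hence "ramp g y < \<infinity>" by (auto simp: power2_eq_square ennreal_mult_eq_top_iff less_top)
    thus ?case by (simp add: ennreal_power[symmetric])
  qed
  thus ?thesis by (simp add: nn_integral_ramp_square[OF g])
qed

text \<open>On x < -1 \<open>ramp\<close> is at most (-x)^g2, so the product is at most c (-x)^(g1 +
  g2). As g2 stays below -1/2, the integral for c = 1 stays bounded as g1 tends to -1/2; this is the
  near orthogonality.\<close>

lemma nn_integral_tail_ramp:
  assumes g1: "g1 < -1/2" and g2: "-1 < g2" "g2 < -1/2" and c: "c \<ge> 0"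
  shows "(\<integral>\<^sup>+x. ennreal \<bar>c * tail g1 x * enn2real (ramp g2 x)\<bar> \<partial>lborel) \<le> ennreal (c / (- g1 - g2 - 1))"
proof -
  have "(\<integral>\<^sup>+x. ennreal \<bar>c * tail g1 x * enn2real (ramp g2 x)\<bar> \<partial>lborel)
    \<le> (\<integral>\<^sup>+x. ennreal c * (ennreal ((- x) powr (g1 + g2)) * indicator {..< -1} x) \<partial>lborel)"
  proof (rule nn_integral_mono)
    fix x :: real
    show "ennreal \<bar>c * tail g1 x * enn2real (ramp g2 x)\<bar> \<le> ennreal c * (ennreal ((- x) powr (g1 + g2)) * indicator {..< -1} x)"
    proof (cases "x < -1")
      case True
      have "ramp g2 x \<le> (\<integral>\<^sup>+s. ennreal ((- x) powr g2) * indicator {0..1::real} s \<partial>lborel)"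
        unfolding ramp_def
      proof (rule nn_integral_mono)
        fix s :: real
        show "ennreal (pos_powr (s - x) g2) * indicator {0..1} s \<le> ennreal ((- x) powr g2) * indicator {0..1} s"
        proof (cases "s \<in> {0..1}")
          case s: True
          have "(s - x) powr g2 \<le> (- x) powr g2" using s True g2 by (intro powr_mono2') auto
          thus ?thesis using s True by (auto simp: pos_powr_def intro!: ennreal_leI)
        qed simp
      qed
      also have "\<dots> = ennreal ((- x) powr g2)" by (simp add: nn_integral_cmult_indicator)
      finally have "enn2real (ramp g2 x) \<le> (- x) powr g2" by (intro enn2real_leI) auto
      hence "c * (- x) powr g1 * enn2real (ramp g2 x) \<le> c * (- x) powr g1 * (- x) powr g2" using c by (intro mult_left_mono) auto
      also have "\<dots> = c * (- x) powr (g1 + g2)" by (simp add: powr_add)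
      finally have "ennreal \<bar>c * tail g1 x * enn2real (ramp g2 x)\<bar> \<le> ennreal (c * (- x) powr (g1 + g2))"
        using True c by (intro ennreal_leI) (simp add: tail_def abs_mult)
      thus ?thesis using True c by (simp add: ennreal_mult)
    qed (simp add: tail_def)
  qed
  also have "\<dots> = ennreal c * ennreal (1 / (- (g1 + g2) - 1))"
    using assms by (subst nn_integral_cmult) (auto simp: nn_integral_powr_from_1)
  also have "\<dots> = ennreal (c / (- g1 - g2 - 1))" using assms by (subst ennreal_mult[symmetric]) (auto simp: algebra_simps)
  finally show ?thesis .
qed

section \<open>The explicit bound at fixed exponents\<close>

context white_noise_comparison
begin

lemma rosenblatt_bound:
  fixes g1 g2 \<eta> :: real
  assumes g1: "-1 < g1" "g1 < -1/2" and g2: "-1 < g2" "g2 < -1/2" and \<eta>: "\<eta> \<ge> 0" "2 * g1 + 2 * g2 + 2 - \<eta> > -1"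
  defines "A \<equiv> rosenblatt_const g1 g2"
  defines "d \<equiv> A / (- g1 - g2 - 1)" and "E \<equiv> A\<^sup>2 * remainder_const \<eta> g1 g2"
    and "F \<equiv> A\<^sup>2 / (- 2 * g1 - 1)" and "G \<equiv> Beta (g2 + 1) (- 2 * g2 - 1) / ((g2 + 1) * (2 * g2 + 3))"
  shows "\<bar>expectation (\<lambda>\<omega>. h (rosenblatt M B g1 g2 1 \<omega>)) - N.expectation (\<lambda>\<omega>. h (Z1 \<omega> * Z2 \<omega>))\<bar>
    \<le> sqrt (256 * d\<^sup>2 + 32 * E) + 8 * d + \<bar>F * G - 1\<bar> + 16 * d\<^sup>2"
proof -
  have A: "A \<ge> 0" unfolding A_def rosenblatt_const_def by simp
  have R0: "remainder_const \<eta> g1 g2 \<ge> 0" by (rule remainder_const_nonneg) (use assms in auto)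
  have d: "d \<ge> 0" unfolding d_def using A g1 g2 by (intro divide_nonneg_nonneg) auto
  have E: "E \<ge> 0" unfolding E_def using R0 by simp
  have F: "F \<ge> 0" unfolding F_def using g1 by (intro divide_nonneg_nonneg) auto
  have G: "G \<ge> 0" unfolding G_def using g2 by (intro divide_nonneg_nonneg mult_nonneg_nonneg Beta_real_nonneg) auto
  let ?K = "rosenblatt_kernel g1 g2 1"
  note [measurable] = rosenblatt_kernel_measurable[of g1 g2 1]
  define r where "r y = enn2real (ramp g2 y)" for y
  have r[measurable]: "r \<in> borel_measurable borel" unfolding r_def[abs_def] by measurable
  have sr: "sq_norm lborel r = ennreal G" unfolding r_def[abs_def] G_def by (rule sq_norm_ramp[OF g2])
  define sym where "sym c z = ((c * tail g1 (fst z)) * r (snd z) + (c * tail g1 (snd z)) * r (fst z)) / 2" for c z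
  have [measurable]: "sym c \<in> borel_measurable borel" for c
  proof -
    have "sym c \<in> borel_measurable (borel \<Otimes>\<^sub>M borel)" unfolding sym_def by measurable
    thus ?thesis unfolding borel_prod .
  qed
  have approx: "sq_norm lborel (\<lambda>z. sym c z - c / 2 * ?K z) \<le> ennreal (c\<^sup>2 * remainder_const \<eta> g1 g2)" for c
    unfolding sym_def r_def by (rule rosenblatt_kernel_approx[OF g1 g2 \<eta>])
  \<comment> \<open>Square integrability of the kernel, needed for the chosen integral to be
    meaningful, is read off from the approximation with c = 2, for which c / 2 = 1.\<close>
  have "sq_norm lborel ?K = sq_norm lborel (\<lambda>z. ?K z - 0)" by simp
  also have "\<dots> \<le> 2 * sq_norm lborel (\<lambda>z. ?K z - sym 2 z) + 2 * sq_norm lborel (\<lambda>z. sym 2 z - 0)"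
    by (rule sq_norm_triangle) measurable
  also have "\<dots> < \<infinity>"
  proof -
    have "sq_norm lborel (\<lambda>z. ?K z - sym 2 z) < \<infinity>"
      using approx[of 2] order_le_less_trans by (subst sq_norm_commute) fastforce
    moreover have "sq_norm lborel (sym 2) < \<infinity>" unfolding sym_def[abs_def]
      by (rule sq_norm_symmetrization_finite) (use sr sq_norm_scaled_tail[OF g1(2), of 2] in auto)
    ultimately show ?thesis by (simp add: ennreal_mult_less_top)
  qed
  finally have "has_double_integral M B ?K (double_integral M B ?K)" by (intro double_integral_exists) auto
  from has_double_integral_scale[OF this, of "A / 2"]
  have X: "has_double_integral M B (\<lambda>z. A / 2 * ?K z) (rosenblatt M B g1 g2 1)"
    unfolding rosenblatt_def[abs_def] A_def .
  show ?thesis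
  proof (rule double_integral_product_bound[OF X, where f="\<lambda>x. A * tail g1 x" and g=r])
    show "sq_norm lborel (\<lambda>x. A * tail g1 x) = ennreal F" unfolding F_def by (rule sq_norm_scaled_tail[OF g1(2)])
    show "(\<integral>\<^sup>+x. ennreal \<bar>A * tail g1 x * r x\<bar> \<partial>lborel) \<le> ennreal d"
      unfolding d_def r_def by (rule nn_integral_tail_ramp[OF g1(2) g2 A])
    show "sq_norm lborel (\<lambda>z. (A * tail g1 (fst z) * r (snd z) + A * tail g1 (snd z) * r (fst z)) / 2 - A / 2 * ?K z) \<le> ennreal E"
      using approx[of A] unfolding sym_def E_def .
  qed (use F G d E sr in measurable)
qed

end

section \<open>Beta factors near the corner\<close>

lemma tendsto_Beta_real:
  fixes u v :: "'z \<Rightarrow> real"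
  assumes "(u \<longlongrightarrow> a) L" "(v \<longlongrightarrow> b) L" "a > 0" "b > 0"
  shows "((\<lambda>x. Beta (u x) (v x)) \<longlongrightarrow> Beta a b) L"
  unfolding Beta_def using assms by (intro tendsto_intros) (auto simp: Gamma_eq_zero_iff nonpos_Ints_def)

text \<open>Numerator and denominator are multiplied by 2\<epsilon>. The singular factor of the
  denominator is Beta(1/2 - \<epsilon>, 2\<epsilon>), and the recurrence in its second argument
  identifies 2\<epsilon> times it with \<open>T\<close>, which is regular at \<epsilon> = 0.\<close>

lemma rosenblatt_const_square:
  assumes "-1 < g1" "g1 < -1/2" "-1 < g2" "g2 < -1/2" "g1 + g2 > -3/2"
  defines "\<epsilon> \<equiv> - g1 - 1/2"
  defines "T \<equiv> (1/2 + \<epsilon>) * Beta (1/2 - \<epsilon>) (1 + 2 * \<epsilon>)"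
    and "D \<equiv> Beta (g1 + 1) (- g1 - g2 - 1) * Beta (g2 + 1) (- g1 - g2 - 1)"
    and "b \<equiv> Beta (g2 + 1) (- 2 * g2 - 1)"
  shows "(rosenblatt_const g1 g2)\<^sup>2 = 2 * \<epsilon> * ((g1 + g2 + 2) * (2 * (g1 + g2) + 3)) / (2 * \<epsilon> * D + T * b)"
    "D > 0" "b > 0" "T > 0"
proof -
  have Bp: "Beta x y > 0" if "x > 0" "y > 0" for x y :: real using that by (simp add: Beta_def Gamma_real_pos)
  have \<epsilon>: "0 < \<epsilon>" "\<epsilon> < 1/2" using assms by auto
  show D: "D > 0" unfolding D_def using assms by (intro mult_pos_pos Bp) auto
  show b: "b > 0" unfolding b_def using assms by (intro Bp) auto
  show T: "T > 0" unfolding T_def using \<epsilon> by (intro mult_pos_pos Bp) auto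
  define \<beta> where "\<beta> = Beta (g1 + 1) (- 2 * g1 - 1)"
  have \<beta>: "\<beta> > 0" unfolding \<beta>_def using assms by (intro Bp) auto
  have "(1/2 - \<epsilon> + 2 * \<epsilon>) * Beta (1/2 - \<epsilon>) (2 * \<epsilon> + 1) = 2 * \<epsilon> * Beta (1/2 - \<epsilon>) (2 * \<epsilon>)"
    using \<epsilon> by (intro Beta_plus1_right) (auto dest: nonpos_Ints_nonpos)
  moreover have "1/2 - \<epsilon> + 2 * \<epsilon> = 1/2 + \<epsilon>" "2 * \<epsilon> + 1 = 1 + 2 * \<epsilon>" by auto
  moreover have e: "g1 + 1 = 1/2 - \<epsilon>" "- 2 * g1 - 1 = 2 * \<epsilon>" by (auto simp: \<epsilon>_def)
  ultimately have T\<beta>: "T = 2 * \<epsilon> * \<beta>" unfolding T_def \<beta>_def e by (simp only:)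
  define P where "P = (g1 + g2 + 2) * (2 * (g1 + g2) + 3)"
  define S where "S = D + \<beta> * b"
  have P: "P \<ge> 0" unfolding P_def using assms by (intro mult_nonneg_nonneg) auto
  have S: "S > 0" unfolding S_def using D b \<beta> by (simp add: add_pos_pos)
  have "rosenblatt_const g1 g2 = P powr (1/2) * S powr (- 1/2)"
    unfolding rosenblatt_const_def P_def S_def D_def \<beta>_def b_def by simp
  hence "(rosenblatt_const g1 g2)\<^sup>2 = (P powr (1/2))\<^sup>2 * (S powr (- 1/2))\<^sup>2" by (simp add: power_mult_distrib)
  also have "(P powr (1/2))\<^sup>2 = P" using P by (simp add: powr_half_sqrt)
  also have "(S powr (- 1/2))\<^sup>2 = 1 / S"
  proof -
    have "(S powr (- 1/2))\<^sup>2 = S powr (- 1)" unfolding power2_eq_square powr_add[symmetric] by simp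
    thus ?thesis using S by (simp add: powr_minus_divide)
  qed
  also have "P * (1 / S) = 2 * \<epsilon> * P / (2 * \<epsilon> * S)" using \<epsilon> by simp
  also have "2 * \<epsilon> * S = 2 * \<epsilon> * D + T * b" unfolding S_def T\<beta> by (simp add: algebra_simps)
  finally show "(rosenblatt_const g1 g2)\<^sup>2 = 2 * \<epsilon> * ((g1 + g2 + 2) * (2 * (g1 + g2) + 3)) / (2 * \<epsilon> * D + T * b)" unfolding P_def .
qed

text \<open>The function is differentiable at 0 with value 1/2 * Beta(1/2, 1) = 1, so its difference
  quotient is bounded nearby.\<close>

lemma Beta_factor_expansion:
  obtains C :: real where "C \<ge> 0"
    "eventually (\<lambda>e. \<bar>(1/2 + e) * Beta (1/2 - e) (1 + 2 * e) - 1\<bar> \<le> C * \<bar>e\<bar>) (at 0)"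
proof -
  define T where "T e = (1/2 + e) * Beta (1/2 - e) (1 + 2 * e)" for e :: real
  have "\<exists>T'. (T has_real_derivative T') (at 0)"
    unfolding T_def Beta_def
    by (rule exI) (auto intro!: derivative_eq_intros simp: Gamma_eq_zero_iff nonpos_Ints_def)
  then obtain T' where T': "(T has_real_derivative T') (at 0)" by blast
  have T0: "T 0 = 1"
  proof -
    have "Gamma (1/2 + 1 :: real) = 1/2 * Gamma (1/2)" by (rule Gamma_plus1) (auto dest: nonpos_Ints_nonpos)
    moreover have "Gamma (3/2 :: real) \<noteq> 0" by (rule less_imp_neq[THEN not_sym], rule Gamma_real_pos) simp
    ultimately show ?thesis unfolding T_def Beta_def by (simp add: add.commute)
  qed
  have "((\<lambda>e. (T e - 1) / e) \<longlongrightarrow> T') (at 0)" using T' unfolding has_field_derivative_iff by (simp add: T0)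
  hence "eventually (\<lambda>e. \<bar>(T e - 1) / e\<bar> < \<bar>T'\<bar> + 1) (at 0)"
    by (intro order_tendstoD(2)[OF tendsto_rabs]) auto
  moreover have "eventually (\<lambda>e::real. e \<noteq> 0) (at 0)" by (simp add: eventually_at_filter)
  ultimately have "eventually (\<lambda>e. \<bar>T e - 1\<bar> \<le> (\<bar>T'\<bar> + 1) * \<bar>e\<bar>) (at 0)"
    by eventually_elim (simp add: abs_divide divide_less_eq less_imp_le)
  thus ?thesis using that[of "\<bar>T'\<bar> + 1"] unfolding T_def by simp
qed

section \<open>Asymptotics of the normalising constant\<close>

text \<open>The two quotients in the second estimate are the squared norms of \<open>rosenblatt_const g1 g2 * f\<close>
  and of \<open>r\<close>, so their product is the limit variance.\<close>

lemma rosenblatt_const_asymptotics: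
  fixes \<gamma> :: real
  assumes \<gamma>: "-1 < \<gamma>" "\<gamma> < -1/2"
  defines "L \<equiv> at (- 1/2, \<gamma>) within Delta"
  obtains c where "c \<ge> 0"
    "eventually (\<lambda>(g1, g2). (rosenblatt_const g1 g2)\<^sup>2 \<le> c * (- g1 - 1/2)) L"
    "eventually (\<lambda>(g1, g2). \<bar>(rosenblatt_const g1 g2)\<^sup>2 / (- 2 * g1 - 1) * (Beta (g2 + 1) (- 2 * g2 - 1) / ((g2 + 1) * (2 * g2 + 3))) - 1\<bar>
      \<le> c * (- g1 - 1/2)) L"
proof -
  define e where "e p = - fst p - 1/2" for p :: "real \<times> real"
  define T where "T p = (1/2 + e p) * Beta (1/2 - e p) (1 + 2 * e p)" for p
  define b where "b p = Beta (snd p + 1) (- 2 * snd p - 1)" for p :: "real \<times> real"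
  define D where "D p = Beta (fst p + 1) (- fst p - snd p - 1) * Beta (snd p + 1) (- fst p - snd p - 1)" for p :: "real \<times> real"
  define m where "m p = (snd p + 1) * (2 * snd p + 3)" for p :: "real \<times> real"
  have id: "((\<lambda>p. p) \<longlongrightarrow> (- 1/2, \<gamma>)) L" unfolding L_def by (rule tendsto_ident_at)
  have t1: "(fst \<longlongrightarrow> - 1/2) L" and t2: "(snd \<longlongrightarrow> \<gamma>) L" using tendsto_fst[OF id] tendsto_snd[OF id] by simp_all
  have te: "(e \<longlongrightarrow> 0) L" unfolding e_def using tendsto_diff[OF tendsto_minus[OF t1] tendsto_const[of "1/2"]] by simp
  have inD: "eventually (\<lambda>p. p \<in> Delta) L" unfolding L_def by (simp add: eventually_at_filter)
  define b0 where "b0 = Beta (\<gamma> + 1) (- 2 * \<gamma> - 1)"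
  define m0 where "m0 = (\<gamma> + 1) * (2 * \<gamma> + 3)"
  define D0 where "D0 = Beta (- 1/2 + 1) (- (- 1/2) - \<gamma> - 1) * Beta (\<gamma> + 1) (- (- 1/2) - \<gamma> - 1)"
  have b0: "b0 > 0" unfolding b0_def Beta_def using \<gamma> by (intro divide_pos_pos mult_pos_pos Gamma_real_pos) auto
  have m0: "m0 > 0" unfolding m0_def using \<gamma> by (intro mult_pos_pos) auto
  have "(b \<longlongrightarrow> b0) L" unfolding b_def b0_def using \<gamma> by (intro tendsto_Beta_real tendsto_intros t2) auto
  hence evb: "eventually (\<lambda>p. b p > b0 / 2) L" using b0 by (intro order_tendstoD(1)) auto
  have "(m \<longlongrightarrow> m0) L" unfolding m_def m0_def by (intro tendsto_intros t2)
  hence evm: "eventually (\<lambda>p. m p > m0 / 2) L" using m0 by (intro order_tendstoD(1)) auto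
  have "(D \<longlongrightarrow> D0) L" unfolding D_def D0_def using \<gamma> by (intro tendsto_mult tendsto_Beta_real tendsto_intros t1 t2) auto
  hence evD: "eventually (\<lambda>p. D p < \<bar>D0\<bar> + 1) L" by (intro order_tendstoD(2)) auto
  obtain K where K: "K \<ge> 0" "eventually (\<lambda>e::real. \<bar>(1/2 + e) * Beta (1/2 - e) (1 + 2 * e) - 1\<bar> \<le> K * \<bar>e\<bar>) (at 0)"
    by (rule Beta_factor_expansion)
  have "filterlim e (at 0) L" unfolding filterlim_at using te inD
    by (auto elim!: eventually_mono simp: Delta_def e_def)
  from eventually_compose_filterlim[OF K(2) this]
  have evT: "eventually (\<lambda>p. \<bar>T p - 1\<bar> \<le> K * \<bar>e p\<bar>) L" unfolding T_def .
  have eve: "eventually (\<lambda>p. K * e p < 1/2) L" using tendsto_mult[OF tendsto_const[of K] te] by (intro order_tendstoD(2)) auto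
  have eve1: "eventually (\<lambda>p. e p < 1) L" using te by (intro order_tendstoD(2)) auto
  \<comment> \<open>8 / b0 serves the first estimate, the bracket the second.\<close>
  define c where "c = 8 / b0 + (28 / m0 + 2 * K + 8 * (\<bar>D0\<bar> + 1) / b0)"
  have c0: "c \<ge> 0" unfolding c_def using b0 m0 K by (intro add_nonneg_nonneg) auto
  have main: "eventually (\<lambda>p. (rosenblatt_const (fst p) (snd p))\<^sup>2 \<le> c * e p \<and>
     \<bar>(rosenblatt_const (fst p) (snd p))\<^sup>2 / (2 * e p) * (b p / m p) - 1\<bar> \<le> c * e p) L"
    using inD evb evm evD evT eve eve1
  proof eventually_elim
    case (elim p)
    obtain g1 g2 where p: "p = (g1, g2)" by (cases p)
    have g: "-1 < g1" "g1 < -1/2" "-1 < g2" "g2 < -1/2" "g1 + g2 > -3/2" using elim(1) by (auto simp: Delta_def p)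
    note rc = rosenblatt_const_square[OF g]
    define P where "P = (g1 + g2 + 2) * (2 * (g1 + g2) + 3)"
    define A2 where "A2 = (rosenblatt_const g1 g2)\<^sup>2"
    have ee: "e p > 0" "e p < 1" using g elim by (auto simp: e_def p)
    have Tb: "T p > 0" "b p > 0" "D p > 0" "m p > 0" using rc g by (auto simp: T_def b_def D_def e_def p m_def intro!: mult_pos_pos)
    \<comment> \<open>From |T - 1| \<le> K e < 1/2; this keeps the denominators away from 0.\<close>
    have T12: "T p \<ge> 1/2" using elim(5,6) ee by (auto simp: abs_if split: if_splits)
    have A2: "A2 = 2 * e p * P / (2 * e p * D p + T p * b p)"
      using rc(1) unfolding A2_def P_def by (simp add: T_def b_def D_def e_def p)
    define S where "S = 2 * e p * D p + T p * b p"
    have S: "S \<ge> T p * b p" "S > 0" unfolding S_def using ee Tb by (auto intro!: add_pos_pos)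
    have Tbl: "T p * b p \<ge> b0 / 4" using mult_mono[of "1/2" "T p" "b0 / 2" "b p"] T12 elim(2) b0 Tb by simp
    have P1: "P \<le> 1" unfolding P_def using g mult_mono[of "g1 + g2 + 2" 1 "2 * (g1 + g2) + 3" 1] by simp
    have P0: "P \<ge> 0" unfolding P_def using g by (intro mult_nonneg_nonneg) auto
    have "A2 = 2 * e p * P / S" unfolding A2 S_def ..
    also have "\<dots> \<le> 2 * e p * 1 / (b0 / 4)" using S Tbl b0 P1 P0 ee by (intro frac_le mult_left_mono) auto
    also have "\<dots> = 8 / b0 * e p" by simp
    also have "\<dots> \<le> c * e p" unfolding c_def using ee m0 K b0 by (intro mult_right_mono) auto
    finally have 1: "A2 \<le> c * e p" .
    \<comment> \<open>P and m agree at g1 = -1/2. The 7 is 5 + 2: |4 g2 + 5| \<le> 5 from the linear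
      term, and e^2 \<le> e for the quadratic one.\<close>
    have Pm: "\<bar>P - m p\<bar> \<le> 7 * e p"
    proof -
      define x where "x = e p"
      have g1x: "g1 = - 1/2 - x" by (simp add: x_def e_def p)
      have "m p = (g2 + 1) * (2 * g2 + 3)" by (simp add: m_def p)
      hence "P - m p = - (x * (4 * g2 + 5)) + 2 * (x * x)" unfolding P_def g1x by (simp add: algebra_simps)
      hence "P - m p = - (e p * (4 * g2 + 5)) + 2 * (e p * e p)" unfolding x_def .
      moreover have "\<bar>e p * (4 * g2 + 5)\<bar> \<le> e p * 5" unfolding abs_mult using ee g by (intro mult_mono) auto
      moreover have "e p * e p \<le> e p * 1" using ee by (intro mult_left_mono) auto
      moreover have "0 \<le> e p * e p" by simp
      ultimately show ?thesis using ee by linarith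
    qed
    \<comment> \<open>The numerator P b - S m is split into terms with P - m, 1 - T and e D, each of
      order e.\<close>
    have "A2 / (2 * e p) * (b p / m p) - 1 = (b p * (P - m p) + b p * m p * (1 - T p) - 2 * e p * D p * m p) / (S * m p)"
    proof -
      have "A2 / (2 * e p) * (b p / m p) = P * b p / (S * m p)" unfolding A2 S_def using ee by simp
      hence "A2 / (2 * e p) * (b p / m p) - 1 = (P * b p - S * m p) / (S * m p)" using S Tb by (simp add: diff_divide_distrib)
      also have "P * b p - S * m p = b p * (P - m p) + b p * m p * (1 - T p) - 2 * e p * D p * m p"
        unfolding S_def by (simp add: algebra_simps)
      finally show ?thesis .
    qed
    hence "\<bar>A2 / (2 * e p) * (b p / m p) - 1\<bar> = \<bar>b p * (P - m p) + b p * m p * (1 - T p) - 2 * e p * D p * m p\<bar> / (S * m p)"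
      using S Tb by (simp add: abs_divide)
    also have "\<dots> \<le> (b p * (7 * e p) + b p * m p * (K * e p) + 2 * e p * D p * m p) / (T p * b p * m p)"
    proof (rule frac_le)
      have "\<bar>b p * (P - m p)\<bar> \<le> b p * (7 * e p)" using Pm Tb by (simp add: abs_mult)
      moreover have "\<bar>b p * m p * (1 - T p)\<bar> \<le> b p * m p * (K * e p)"
        using elim(5) Tb ee by (simp add: abs_mult abs_minus_commute)
      moreover have "\<bar>2 * e p * D p * m p\<bar> = 2 * e p * D p * m p" using Tb ee by simp
      ultimately show "\<bar>b p * (P - m p) + b p * m p * (1 - T p) - 2 * e p * D p * m p\<bar>
        \<le> b p * (7 * e p) + b p * m p * (K * e p) + 2 * e p * D p * m p" by linarith
      show "T p * b p * m p \<le> S * m p" using S Tb by (intro mult_right_mono) auto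
      show "0 \<le> b p * (7 * e p) + b p * m p * (K * e p) + 2 * e p * D p * m p" using Tb ee K by simp
      show "0 < T p * b p * m p" using Tb by simp
    qed
    also have "\<dots> = (7 / (T p * m p) + K / T p + 2 * D p / (T p * b p)) * e p"
      using Tb by (simp add: field_simps)
    also have "\<dots> \<le> (7 / (m0 / 4) + K / (1/2) + 2 * (\<bar>D0\<bar> + 1) / (b0 / 4)) * e p"
    proof (intro mult_right_mono add_mono frac_le)
      show "m0 / 4 \<le> T p * m p" using mult_mono[of "1/2" "T p" "m0 / 2" "m p"] T12 elim(3) m0 Tb by simp
      show "2 * D p \<le> 2 * (\<bar>D0\<bar> + 1)" using elim(4) by simp
    qed (use m0 b0 K T12 Tbl Tb ee in auto)
    also have "\<dots> = (28 / m0 + 2 * K + 8 * (\<bar>D0\<bar> + 1) / b0) * e p" by simp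
    also have "\<dots> \<le> c * e p" unfolding c_def using ee b0 by (intro mult_right_mono) auto
    finally have 2: "\<bar>A2 / (2 * e p) * (b p / m p) - 1\<bar> \<le> c * e p" .
    show ?case using 1 2 by (simp add: A2_def p)
  qed
  show ?thesis
  proof (rule that[OF c0])
    show "eventually (\<lambda>(g1, g2). (rosenblatt_const g1 g2)\<^sup>2 \<le> c * (- g1 - 1/2)) L"
      using main by eventually_elim (auto simp: e_def)
    have "2 * e p = - 2 * fst p - 1" for p by (simp add: e_def)
    with main show "eventually (\<lambda>(g1, g2). \<bar>(rosenblatt_const g1 g2)\<^sup>2 / (- 2 * g1 - 1) * (Beta (g2 + 1) (- 2 * g2 - 1) / ((g2 + 1) * (2 * g2 + 3))) - 1\<bar>
      \<le> c * (- g1 - 1/2)) L"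
      by (auto elim!: eventually_mono simp: b_def m_def split_def) (simp add: e_def)
  qed
qed

section \<open>The Wasserstein rate\<close>

lemma wasserstein_le:
  assumes "\<And>h. (\<And>x y. \<bar>h x - h y\<bar> \<le> \<bar>x - y\<bar>) \<Longrightarrow> \<bar>(\<integral>\<omega>. h (X \<omega>) \<partial>M) - (\<integral>\<omega>. h (Y \<omega>) \<partial>N)\<bar> \<le> c"
  shows "wasserstein M X N Y \<le> ennreal c"
  unfolding wasserstein_def using assms by (intro SUP_least ennreal_leI) auto

text \<open>Finiteness is a separate conjunct because \<open>enn2real\<close> sends \<infinity> to
  0, so that the O-estimate alone would not exclude an infinite distance.\<close>

theorem theorem5p3:
  fixes M :: "'a measure" and B :: "real set \<Rightarrow> 'a \<Rightarrow> real"
    and N :: "'b measure" and Z1 Z2 :: "'b \<Rightarrow> real" and \<gamma> :: real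
  assumes "brownian_random_measure M B"
    and "prob_space N"
    and "distributed N lborel Z1 std_normal_density"
    and "distributed N lborel Z2 std_normal_density"
    and "prob_space.indep_var N borel Z1 borel Z2"
    and "- 1 < \<gamma>" and "\<gamma> < - 1/2"
  defines "d \<equiv> \<lambda>(\<gamma>1, \<gamma>2). wasserstein M (rosenblatt M B \<gamma>1 \<gamma>2 1) N (\<lambda>\<omega>. Z1 \<omega> * Z2 \<omega>)"
  shows "(\<forall>\<^sub>F p in at (- 1/2, \<gamma>) within Delta. d p < \<infinity>) \<and>
    (\<lambda>p. enn2real (d p)) \<in> O[at (- 1/2, \<gamma>) within Delta](\<lambda>(\<gamma>1, \<gamma>2). (- \<gamma>1 - 1/2) powr (1/2))"
proof -
  define L where "L = at (- 1/2, \<gamma>) within Delta"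
  \<comment> \<open>Positive, which keeps the Beta factor in g1 bounded, and small enough: at the
    corner the exponent 2 g1 + 2 g2 + 2 - \<eta> equals \<gamma>, which exceeds -1.\<close>
  define \<eta> where "\<eta> = 1 + \<gamma>"
  define e where "e p = - fst p - 1/2" for p :: "real \<times> real"
  have id: "((\<lambda>p. p) \<longlongrightarrow> (- 1/2, \<gamma>)) L" unfolding L_def by (rule tendsto_ident_at)
  have t1: "(fst \<longlongrightarrow> - 1/2) L" and t2: "(snd \<longlongrightarrow> \<gamma>) L" using tendsto_fst[OF id] tendsto_snd[OF id] by simp_all
  obtain c where c: "c \<ge> 0"
    "eventually (\<lambda>(g1, g2). (rosenblatt_const g1 g2)\<^sup>2 \<le> c * (- g1 - 1/2)) L"
    "eventually (\<lambda>(g1, g2). \<bar>(rosenblatt_const g1 g2)\<^sup>2 / (- 2 * g1 - 1) * (Beta (g2 + 1) (- 2 * g2 - 1) / ((g2 + 1) * (2 * g2 + 3))) - 1\<bar>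
      \<le> c * (- g1 - 1/2)) L"
    unfolding L_def by (rule rosenblatt_const_asymptotics[OF assms(6,7)])
  have inD: "eventually (\<lambda>p. p \<in> Delta) L" unfolding L_def by (simp add: eventually_at_filter)
  have "((\<lambda>p. 2 * fst p + 2 * snd p + 2 - \<eta>) \<longlongrightarrow> 2 * (- 1/2) + 2 * \<gamma> + 2 - \<eta>) L" by (intro tendsto_intros t1 t2)
  hence ev\<eta>: "eventually (\<lambda>p. 2 * fst p + 2 * snd p + 2 - \<eta> > -1) L"
    using assms(6) by (intro order_tendstoD(1)) (auto simp: \<eta>_def)
  obtain R where R: "R \<ge> 0" "eventually (\<lambda>p. remainder_const \<eta> (fst p) (snd p) \<le> R) L"
  proof -
    have "((\<lambda>p. remainder_const \<eta> (fst p) (snd p)) \<longlongrightarrow> remainder_const \<eta> (- 1/2) \<gamma>) L"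
      unfolding remainder_const_def using assms(6,7)
      by (intro tendsto_intros tendsto_Beta_real t1 t2) (auto simp: \<eta>_def)
    moreover have "remainder_const \<eta> (- 1/2) \<gamma> < \<bar>remainder_const \<eta> (- 1/2) \<gamma>\<bar> + 1" by linarith
    ultimately have "eventually (\<lambda>p. remainder_const \<eta> (fst p) (snd p) < \<bar>remainder_const \<eta> (- 1/2) \<gamma>\<bar> + 1) L"
      by (rule order_tendstoD(2))
    hence "eventually (\<lambda>p. remainder_const \<eta> (fst p) (snd p) \<le> \<bar>remainder_const \<eta> (- 1/2) \<gamma>\<bar> + 1) L"
      by (auto elim!: eventually_mono)
    thus ?thesis by (intro that[of "\<bar>remainder_const \<eta> (- 1/2) \<gamma>\<bar> + 1"]) auto
  qed
  \<comment> \<open>Twice the limit of 1 / (- g1 - g2 - 1) at the corner.\<close>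
  define q where "q = 2 / (- \<gamma> - 1/2)"
  have q: "q \<ge> 0" using assms(7) by (simp add: q_def)
  have evq: "eventually (\<lambda>p. 1 / (- fst p - snd p - 1) \<le> q) L"
  proof -
    have "((\<lambda>p. - fst p - snd p - 1) \<longlongrightarrow> - (- 1/2) - \<gamma> - 1) L" by (intro tendsto_intros t1 t2)
    hence "eventually (\<lambda>p. - fst p - snd p - 1 > (- \<gamma> - 1/2) / 2) L" using assms(7) by (intro order_tendstoD(1)) auto
    thus ?thesis
    proof eventually_elim
      case (elim p)
      have "1 / (- fst p - snd p - 1) \<le> 1 / ((- \<gamma> - 1/2) / 2)" using elim assms(7) by (intro frac_le) auto
      thus ?case by (simp add: q_def)
    qed
  qed
  have "(e \<longlongrightarrow> - (- 1/2) - 1/2) L" unfolding e_def by (intro tendsto_intros t1)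
  hence eve: "eventually (\<lambda>p. e p < 1) L" by (intro order_tendstoD(2)) auto
  \<comment> \<open>Each summand is the coefficient of \<open>a\<close> in the bound for the
    matching term of \<open>rosenblatt_bound\<close>.\<close>
  define C where "C = sqrt (256 * (q\<^sup>2 * c) + 32 * (c * R)) + 8 * (q * sqrt c) + c + 16 * (q\<^sup>2 * c)"
  have bound: "eventually (\<lambda>p. d p \<le> ennreal (C * e p powr (1/2))) L"
    using inD c(2,3) ev\<eta> R(2) evq eve
  proof eventually_elim
    case (elim p)
    obtain g1 g2 where p: "p = (g1, g2)" by (cases p)
    have g: "-1 < g1" "g1 < -1/2" "-1 < g2" "g2 < -1/2" "g1 + g2 > -3/2" using elim(1) by (auto simp: Delta_def p)
    define A where "A = rosenblatt_const g1 g2"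
    define \<delta> where "\<delta> = A / (- g1 - g2 - 1)"
    define E where "E = A\<^sup>2 * remainder_const \<eta> g1 g2"
    have A: "A \<ge> 0" unfolding A_def rosenblatt_const_def by simp
    \<comment> \<open>All terms are measured by \<open>a\<close>, the target rate. Those of order
      a^2 are absorbed by a^2 \<le> a, as a \<le> 1.\<close>
    define a where "a = sqrt (e p)"
    have ep: "0 < e p" "e p < 1" using g elim(7) by (auto simp: e_def p)
    have a: "0 \<le> a" "a\<^sup>2 = e p" "a \<le> 1" using ep by (auto simp: a_def)
    have a2: "a\<^sup>2 \<le> a" using mult_left_mono[OF a(3) a(1)] by (simp add: power2_eq_square)
    have A2: "A\<^sup>2 \<le> c * a\<^sup>2" using elim(2) unfolding a(2) by (simp add: A_def p e_def)
    have A1: "A \<le> sqrt c * a" using real_le_rsqrt[OF A2] a(1) by (simp add: real_sqrt_mult)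
    have \<delta>: "0 \<le> \<delta>" "\<delta> \<le> q * A"
    proof -
      show "0 \<le> \<delta>" unfolding \<delta>_def using A g by simp
      have "A * (1 / (- g1 - g2 - 1)) \<le> A * q" using elim(6) A by (intro mult_left_mono) (auto simp: p)
      thus "\<delta> \<le> q * A" by (simp add: \<delta>_def mult.commute)
    qed
    have \<delta>2: "\<delta>\<^sup>2 \<le> q\<^sup>2 * c * a\<^sup>2"
    proof -
      have "\<delta>\<^sup>2 \<le> (q * A)\<^sup>2" using \<delta> by (intro power_mono) auto
      also have "\<dots> \<le> q\<^sup>2 * (c * a\<^sup>2)" unfolding power_mult_distrib by (intro mult_left_mono A2) auto
      finally show ?thesis by (simp add: mult.assoc)
    qed
    have E: "E \<le> c * R * a\<^sup>2"
    proof -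
      have "E \<le> (c * a\<^sup>2) * R" unfolding E_def using elim(5) A2 c(1) R(1)
        by (intro mult_mono remainder_const_nonneg) (use g elim(4) assms(6) in \<open>auto simp: p \<eta>_def\<close>)
      thus ?thesis by (simp add: mult_ac)
    qed
    have s: "sqrt (256 * \<delta>\<^sup>2 + 32 * E) \<le> sqrt (256 * (q\<^sup>2 * c) + 32 * (c * R)) * a"
    proof -
      have "256 * \<delta>\<^sup>2 + 32 * E \<le> (256 * (q\<^sup>2 * c) + 32 * (c * R)) * a\<^sup>2" using \<delta>2 E by (simp add: algebra_simps)
      hence "sqrt (256 * \<delta>\<^sup>2 + 32 * E) \<le> sqrt ((256 * (q\<^sup>2 * c) + 32 * (c * R)) * a\<^sup>2)" by (rule real_sqrt_le_mono)
      thus ?thesis using a(1) by (simp add: real_sqrt_mult)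
    qed
    have FG: "\<bar>A\<^sup>2 / (- 2 * g1 - 1) * (Beta (g2 + 1) (- 2 * g2 - 1) / ((g2 + 1) * (2 * g2 + 3))) - 1\<bar> \<le> c * a"
    proof -
      have "\<bar>A\<^sup>2 / (- 2 * g1 - 1) * (Beta (g2 + 1) (- 2 * g2 - 1) / ((g2 + 1) * (2 * g2 + 3))) - 1\<bar> \<le> c * a\<^sup>2"
        using elim(3) unfolding a(2) by (simp add: A_def p e_def)
      also have "\<dots> \<le> c * a" using c(1) a2 by (intro mult_left_mono) auto
      finally show ?thesis .
    qed
    have d8: "8 * \<delta> \<le> 8 * (q * sqrt c) * a" using \<delta>(2) mult_left_mono[OF A1 q] by (simp add: mult.assoc)
    have d16: "16 * \<delta>\<^sup>2 \<le> 16 * (q\<^sup>2 * c) * a"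
    proof -
      have "q\<^sup>2 * c * a\<^sup>2 \<le> q\<^sup>2 * c * a" using a2 c(1) by (intro mult_left_mono) auto
      thus ?thesis using \<delta>2 by simp
    qed
    have "d p \<le> ennreal (C * a)"
      unfolding d_def p prod.case
    proof (rule wasserstein_le)
      \<comment> \<open>The comparison locale is entered separately for each \<open>h\<close>, with
        the same constant \<open>C\<close>.\<close>
      fix h :: "real \<Rightarrow> real" assume h: "\<And>x y. \<bar>h x - h y\<bar> \<le> \<bar>x - y\<bar>"
      interpret P: brownian_random_measure M B by fact
      interpret N: prob_space N by fact
      interpret white_noise_comparison M B N Z1 Z2 h
        by unfold_locales (use assms h in auto)
      have "\<bar>(\<integral>\<omega>. h (rosenblatt M B g1 g2 1 \<omega>) \<partial>M) - (\<integral>\<omega>. h (Z1 \<omega> * Z2 \<omega>) \<partial>N)\<bar>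
        \<le> sqrt (256 * \<delta>\<^sup>2 + 32 * E) + 8 * \<delta> + \<bar>A\<^sup>2 / (- 2 * g1 - 1) * (Beta (g2 + 1) (- 2 * g2 - 1) / ((g2 + 1) * (2 * g2 + 3))) - 1\<bar> + 16 * \<delta>\<^sup>2"
        unfolding \<delta>_def E_def A_def
        by (rule rosenblatt_bound[OF g(1-4)]) (use elim(4) assms(6) in \<open>auto simp: p \<eta>_def\<close>)
      also have "\<dots> \<le> sqrt (256 * (q\<^sup>2 * c) + 32 * (c * R)) * a + 8 * (q * sqrt c) * a + c * a + 16 * (q\<^sup>2 * c) * a"
        by (intro add_mono s d8 FG d16)
      also have "\<dots> = C * a" unfolding C_def by (simp only: distrib_right)
      finally show "\<bar>(\<integral>\<omega>. h (rosenblatt M B g1 g2 1 \<omega>) \<partial>M) - (\<integral>\<omega>. h (Z1 \<omega> * Z2 \<omega>) \<partial>N)\<bar> \<le> C * a" .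
    qed
    moreover have "a = e p powr (1/2)" unfolding a_def using ep by (simp add: powr_half_sqrt)
    ultimately show ?case by simp
  qed
  have "eventually (\<lambda>p. d p < \<infinity>) L"
    using bound by eventually_elim (erule order_le_less_trans, simp)
  moreover have "(\<lambda>p. enn2real (d p)) \<in> O[L](\<lambda>(\<gamma>1, \<gamma>2). (- \<gamma>1 - 1/2) powr (1/2))"
  proof (rule bigoI[where c="\<bar>C\<bar>"], use bound in eventually_elim)
    case (elim p)
    have "d p \<le> ennreal (\<bar>C\<bar> * e p powr (1/2))"
      by (rule order_trans[OF elim]) (intro ennreal_leI mult_right_mono, auto)
    hence "enn2real (d p) \<le> \<bar>C\<bar> * e p powr (1/2)" by (intro enn2real_leI) auto
    thus ?case by (simp add: split_def e_def)
  qed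
  ultimately show ?thesis unfolding L_def ..
qed

end
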